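(* For every $T\in\mathrm{SYT}(r\times2)$ and every graph $\mathcal F(T)$ produced by Fraser's map from $T$ (for any choice of triangulation), $\mathrm{trip}_i(\mathcal F(T))=\mathrm{prom}_i(T)$ for all $1\le i\le r-1$.
   Context: $r$-hourglass plabic graph: bipartite planar graph in a disk with a fixed black–white coloring and positive integer edge multiplicities (an edge of multiplicity $m$ drawn as $m$ strands twisted so the clockwise order of strands agrees at both ends), all internal vertices of degree $r$ (counted with multiplicity), boundary vertices of simple degree one labeled $b_1,\dots,b_n$ clockwise. $\mathrm{trip}_i(G)(j)=k$ ($1\le i\le r-1$) if the walk from $b_j$ along strands taking the $i$-th leftmost turn at white vertices and the $i$-th rightmost turn at black vertices ends at $b_k$. $\mathrm{SYT}(r\times d)$: standard Young tableaux of $r\times d$ rectangular shape, $n=rd$. Promotion $\partial(T)$: delete 1, repeatedly slide into the empty box the smaller of the entries right of or below it until it reaches the lower right corner, fill with $n+1$, subtract 1 from all entries. $\mathrm{prom}_i(T)(j)\equiv a+j-1\pmod n$ (values in $[n]$) where $a$ is the unique entry moving from row $i+1$ to row $i$ when promotion is applied to $\partial^{j-1}(T)$. Fraser's map: $\mathfrak M(T)$ is the noncrossing perfect matching of $[2r]$ in which each first-column entry of $T$ is the smaller element of its pair. Let $i_1,\dots,i_s$ (cyclically ordered) be those $i$ with $i$ and $i+1\pmod{2r}$ matched; claw sets are the cyclic intervals $C_j=(i_j,i_{j+1}]$. Form an $s$-gon with vertices $\delta_1,\dots,\delta_s$ and for each pair of claw sets joined by arcs an edge of weight equal to the number of arcs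 between them; add weight-0 diagonals (and weight-0 sides) arbitrarily to obtain a weighted triangulation. $\mathcal F(T)$ has black boundary vertices $b_1,\dots,b_{2r}$, a white internal vertex $w(\delta_j)$ joined by simple edges to each $b_k$, $k\in C_j$, and for each triangle $\Delta$ a black vertex $b(\Delta)$ joined to the white vertex of each corner $\delta$ of $\Delta$ by an edge of multiplicity equal to the total weight of edges of the triangulation lying in the part cut off by the side of $\Delta$ opposite $\delta$ (not containing $\Delta$), including that side; edges of multiplicity 0 are omitted. *)

theory Defs
  imports Main
begin

text \<open>The representative in \<open>{1..n}\<close> of a residue class modulo \<open>n\<close>.\<close>

definition wrap :: "nat \<Rightarrow> nat \<Rightarrow> nat" where
  "wrap n x = (if n dvd x then n else x mod n)"


section \<open>Rectangular standard Young tableaux and promotion\<close>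

text \<open>Cells are (row, column), both counted from 1; row 1 is the top row.  Values of a
  filling outside the \<open>r \<times> d\<close> rectangle are irrelevant.\<close>

type_synonym filling = "nat \<times> nat \<Rightarrow> nat"

definition SYT :: "nat \<Rightarrow> nat \<Rightarrow> filling set" where
  "SYT r d = {T. bij_betw T ({1..r} \<times> {1..d}) {1..r * d} \<and>
     (\<forall>p\<in>{1..r}. \<forall>q\<in>{1..d}. \<forall>q'\<in>{1..d}. q < q' \<longrightarrow> T (p, q) < T (p, q')) \<and>
     (\<forall>p\<in>{1..r}. \<forall>p'\<in>{1..r}. \<forall>q\<in>{1..d}. p < p' \<longrightarrow> T (p, q) < T (p', q))}"

text \<open>The cell whose entry slides into the empty box: below or to the right, whichever
  cell of the rectangle has the smaller entry.\<close>

fun slide_source :: "nat \<Rightarrow> nat \<Rightarrow> filling \<Rightarrow> nat \<times> nat \<Rightarrow> nat \<times> nat" where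
  "slide_source r d U (p, q) =
     (if p < r \<and> (q < d \<longrightarrow> U (p + 1, q) < U (p, q + 1)) then (p + 1, q) else (p, q + 1))"

fun slide_step :: "nat \<Rightarrow> nat \<Rightarrow> filling \<times> (nat \<times> nat) \<Rightarrow> filling \<times> (nat \<times> nat)" where
  "slide_step r d (U, c) = (let c' = slide_source r d U c in (U(c := U c'), c'))"

text \<open>Filling and position of the empty box after \<open>m\<close> slides.  The (meaningless) value stored
  in the empty box is never read.  Each slide increases row + column by one, so the lower
  right corner is reached after exactly \<open>r + d - 2\<close> slides.\<close>

definition slide_state :: "nat \<Rightarrow> nat \<Rightarrow> filling \<Rightarrow> nat \<Rightarrow> filling \<times> (nat \<times> nat)" where
  "slide_state r d T m = (slide_step r d ^^ m) (T, (1, 1))"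

definition promotion :: "nat \<Rightarrow> nat \<Rightarrow> filling \<Rightarrow> filling" where
  "promotion r d T =
     (\<lambda>c. ((fst (slide_state r d T (r + d - 2)))((r, d) := r * d + 1)) c - 1)"

text \<open>The entry moving from row \<open>i + 1\<close> to row \<open>i\<close> (its value before 1 is subtracted).\<close>

definition moving_entry :: "nat \<Rightarrow> nat \<Rightarrow> nat \<Rightarrow> filling \<Rightarrow> nat" where
  "moving_entry r d i T = (THE a. \<exists>m < r + d - 2. \<exists>q.
      snd (slide_state r d T m) = (i, q) \<and>
      snd (slide_state r d T (Suc m)) = (i + 1, q) \<and>
      a = fst (slide_state r d T m) (i + 1, q))"

definition prom :: "nat \<Rightarrow> nat \<Rightarrow> nat \<Rightarrow> filling \<Rightarrow> nat \<Rightarrow> nat" where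
  "prom r d i T j =
     wrap (r * d) (moving_entry r d i ((promotion r d ^^ (j - 1)) T) + j - 1)"


section \<open>Hourglass graphs in the disk and trips\<close>

text \<open>The planar embedding is recorded by its rotation system: \<open>rot G v\<close> lists the edges at
  \<open>v\<close> in clockwise order (as a cyclic list).  An edge of multiplicity \<open>m\<close> is a bundle of \<open>m\<close>
  strands.  \<open>bdry G k\<close> is the boundary vertex labelled \<open>k\<close>, for \<open>k \<in> {1..bdry_size G}\<close>.\<close>

record ('v, 'e) hourglass_graph =
  verts :: "'v set"
  white :: "'v \<Rightarrow> bool"
  edges :: "'e set"
  white_end :: "'e \<Rightarrow> 'v"
  black_end :: "'e \<Rightarrow> 'v"
  mult :: "'e \<Rightarrow> nat"
  rot :: "'v \<Rightarrow> 'e list"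
  bdry_size :: nat
  bdry :: "nat \<Rightarrow> 'v"

definition other_end :: "('v, 'e) hourglass_graph \<Rightarrow> 'e \<Rightarrow> 'v \<Rightarrow> 'v" where
  "other_end G e v = (if v = white_end G e then black_end G e else white_end G e)"

text \<open>The strands at \<open>v\<close> in clockwise order; \<open>(e, t)\<close> is the \<open>t\<close>-th strand of \<open>e\<close> in the
  clockwise order at \<open>v\<close>.  Because of the twist, the clockwise orders at both ends of \<open>e\<close>
  agree, so \<open>(e, t)\<close> names the same strand at either end.\<close>

definition strands_at :: "('v, 'e) hourglass_graph \<Rightarrow> 'v \<Rightarrow> ('e \<times> nat) list" where
  "strands_at G v = concat (map (\<lambda>e. map (Pair e) [0..<mult G e]) (rot G v))"

text \<open>\<open>trip_walk G i j s v\<close>: the \<open>i\<close>-th trip from \<open>bdry G j\<close> at some point traverses the strand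
  \<open>s\<close> and thereby arrives at \<open>v\<close>.  Coming in along a strand, the \<open>i\<close>-th leftmost turn
  leaves by the \<open>i\<close>-th strand after it in clockwise order, and the \<open>i\<close>-th rightmost turn by the
  \<open>i\<close>-th strand before it.\<close>

inductive trip_walk ::
  "('v, 'e) hourglass_graph \<Rightarrow> nat \<Rightarrow> nat \<Rightarrow> 'e \<times> nat \<Rightarrow> 'v \<Rightarrow> bool"
  for G :: "('v, 'e) hourglass_graph" and i j :: nat where
  start: "s \<in> set (strands_at G (bdry G j)) \<Longrightarrow>
     trip_walk G i j s (other_end G (fst s) (bdry G j))"
| turn: "trip_walk G i j s v \<Longrightarrow> v \<notin> bdry G ` {1..bdry_size G} \<Longrightarrow>
     L = strands_at G v \<Longrightarrow> p < length L \<Longrightarrow> L ! p = s \<Longrightarrow>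
     s' = L ! nat ((if white G v then int p + int i else int p - int i) mod int (length L)) \<Longrightarrow>
     trip_walk G i j s' (other_end G (fst s') v)"

definition trip :: "('v, 'e) hourglass_graph \<Rightarrow> nat \<Rightarrow> nat \<Rightarrow> nat" where
  "trip G i j = (THE k. k \<in> {1..bdry_size G} \<and> (\<exists>s. trip_walk G i j s (bdry G k)))"


section \<open>Noncrossing matchings, claw sets and weighted triangulations\<close>

text \<open>Arcs of matchings are pairs \<open>(a, b)\<close> with \<open>a < b\<close>.\<close>

definition noncrossing_perfect_matching :: "nat \<Rightarrow> (nat \<times> nat) set \<Rightarrow> bool" where
  "noncrossing_perfect_matching n M \<longleftrightarrow>
     M \<subseteq> {(a, b). 1 \<le> a \<and> a < b \<and> b \<le> n} \<and>
     (\<forall>x\<in>{1..n}. \<exists>!e. e \<in> M \<and> (x = fst e \<or> x = snd e)) \<and>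
     (\<forall>(a, b)\<in>M. \<forall>(c, d)\<in>M. \<not> (a < c \<and> c < b \<and> b < d))"

definition is_matching_of :: "nat \<Rightarrow> filling \<Rightarrow> (nat \<times> nat) set \<Rightarrow> bool" where
  "is_matching_of r T M \<longleftrightarrow> noncrossing_perfect_matching (2 * r) M \<and>
     (\<forall>p\<in>{1..r}. T (p, 1) \<in> fst ` M)"

definition short_arcs :: "nat \<Rightarrow> (nat \<times> nat) set \<Rightarrow> nat list" where
  "short_arcs r M = sorted_list_of_set
     {i \<in> {1..2 * r}. (i, wrap (2 * r) (i + 1)) \<in> M \<or> (wrap (2 * r) (i + 1), i) \<in> M}"

definition num_claws :: "nat \<Rightarrow> (nat \<times> nat) set \<Rightarrow> nat" where
  "num_claws r M = length (short_arcs r M)"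

text \<open>The cyclic interval \<open>(a, b]\<close> of \<open>{1..n}\<close>, in clockwise order.\<close>

definition cyc_interval :: "nat \<Rightarrow> nat \<Rightarrow> nat \<Rightarrow> nat list" where
  "cyc_interval n a b = (if a < b then [a + 1..<b + 1] else [a + 1..<n + 1] @ [1..<b + 1])"

text \<open>Claw sets, and the corresponding vertices of the \<open>s\<close>-gon, are indexed clockwise
  by \<open>{0..<s}\<close> where \<open>s = num_claws r M\<close>.\<close>

definition claw :: "nat \<Rightarrow> (nat \<times> nat) set \<Rightarrow> nat \<Rightarrow> nat list" where
  "claw r M j = cyc_interval (2 * r) (short_arcs r M ! j)
     (short_arcs r M ! ((j + 1) mod num_claws r M))"

text \<open>Sides and diagonals of the \<open>s\<close>-gon are 2-element subsets of \<open>{0..<s}\<close>.\<close>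

definition weight :: "nat \<Rightarrow> (nat \<times> nat) set \<Rightarrow> nat set \<Rightarrow> nat" where
  "weight r M E = card {(a, b) \<in> M. \<exists>j < num_claws r M. \<exists>k < num_claws r M.
     a \<in> set (claw r M j) \<and> b \<in> set (claw r M k) \<and> E = {j, k}}"

definition chords :: "nat \<Rightarrow> nat set set" where
  "chords s = {E. E \<subseteq> {0..<s} \<and> card E = 2}"

definition crossing :: "nat set \<Rightarrow> nat set \<Rightarrow> bool" where
  "crossing E F \<longleftrightarrow> (\<exists>a b c d. a < b \<and> b < c \<and> c < d \<and>
     (E = {a, c} \<and> F = {b, d} \<or> E = {b, d} \<and> F = {a, c}))"

text \<open>A triangulation of the \<open>s\<close>-gon is a maximal set of pairwise noncrossing chords; in
  particular it contains all sides.\<close>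

definition triangulation :: "nat \<Rightarrow> nat set set \<Rightarrow> bool" where
  "triangulation s D \<longleftrightarrow> D \<subseteq> chords s \<and> (\<forall>E\<in>D. \<forall>F\<in>D. \<not> crossing E F) \<and>
     (\<forall>E\<in>chords s. (\<forall>F\<in>D. \<not> crossing E F) \<longrightarrow> E \<in> D)"

definition weighted_triangulation ::
  "nat \<Rightarrow> (nat \<times> nat) set \<Rightarrow> nat set set \<Rightarrow> bool" where
  "weighted_triangulation r M D \<longleftrightarrow> triangulation (num_claws r M) D \<and>
     {E \<in> chords (num_claws r M). 0 < weight r M E} \<subseteq> D"

text \<open>Three vertices of a convex polygon joined pairwise by noncrossing chords always bound
  a triangle of the triangulation.\<close>

definition triangles :: "nat set set \<Rightarrow> nat set set" where
  "triangles D = {\<Delta>. card \<Delta> = 3 \<and> (\<forall>x\<in>\<Delta>. \<forall>y\<in>\<Delta>. x \<noteq> y \<longrightarrow> {x, y} \<in> D)}"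

text \<open>Vertices of the part cut off by the chord \<open>E\<close> not containing the vertex \<open>z \<notin> E\<close>,
  including the endpoints of \<open>E\<close>.\<close>

definition cut_off :: "nat set \<Rightarrow> nat \<Rightarrow> nat set" where
  "cut_off E z =
     (if Min E < z \<and> z < Max E then {v. v \<le> Min E \<or> Max E \<le> v} else {Min E..Max E})"

definition corner_mult ::
  "nat \<Rightarrow> (nat \<times> nat) set \<Rightarrow> nat set set \<Rightarrow> nat set \<Rightarrow> nat \<Rightarrow> nat" where
  "corner_mult r M D \<Delta> z = (\<Sum>E | E \<in> D \<and> E \<subseteq> cut_off (\<Delta> - {z}) z. weight r M E)"


section \<open>Fraser's graphs\<close>

datatype fvertex = Boundary nat | White nat | Black "nat set"

text \<open>Edges are pairs (white end, black end).\<close>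

type_synonym fedge = "fvertex \<times> fvertex"

fun fmult :: "nat \<Rightarrow> (nat \<times> nat) set \<Rightarrow> nat set set \<Rightarrow> fedge \<Rightarrow> nat" where
  "fmult r M D (White j, Boundary k) = (if k \<in> set (claw r M j) then 1 else 0)"
| "fmult r M D (White j, Black \<Delta>) =
     (if \<Delta> \<in> triangles D \<and> j \<in> \<Delta> then corner_mult r M D \<Delta> j else 0)"
| "fmult r M D _ = 0"

definition fverts :: "nat \<Rightarrow> (nat \<times> nat) set \<Rightarrow> nat set set \<Rightarrow> fvertex set" where
  "fverts r M D = Boundary ` {1..2 * r} \<union> White ` {0..<num_claws r M} \<union> Black ` triangles D"

definition fedges :: "nat \<Rightarrow> (nat \<times> nat) set \<Rightarrow> nat set set \<Rightarrow> fedge set" where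
  "fedges r M D = {e \<in> fverts r M D \<times> fverts r M D. 0 < fmult r M D e}"

text \<open>The triangles at vertex \<open>j\<close> of the \<open>s\<close>-gon in clockwise order, that is, from the side
  towards \<open>j + 1\<close> to the side towards \<open>j - 1\<close>.\<close>

definition triangles_at :: "nat \<Rightarrow> nat set set \<Rightarrow> nat \<Rightarrow> nat set list" where
  "triangles_at s D j = filter (\<lambda>\<Delta>. \<Delta> \<in> triangles D)
     (concat (map (\<lambda>p. map (\<lambda>q. {j, (j + p) mod s, (j + q) mod s}) [p + 1..<s]) [1..<s]))"

text \<open>Clockwise order at a white vertex: first the boundary vertices of its claw, which lie
  outside the polygon, then the triangles inside.\<close>

fun frot :: "nat \<Rightarrow> (nat \<times> nat) set \<Rightarrow> nat set set \<Rightarrow> fvertex \<Rightarrow> fedge list" where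
  "frot r M D (Boundary k) =
     filter (\<lambda>e. e \<in> fedges r M D) (map (\<lambda>j. (White j, Boundary k)) [0..<num_claws r M])"
| "frot r M D (White j) = filter (\<lambda>e. e \<in> fedges r M D)
     (map (\<lambda>k. (White j, Boundary k)) (claw r M j) @
      map (\<lambda>\<Delta>. (White j, Black \<Delta>)) (triangles_at (num_claws r M) D j))"
| "frot r M D (Black \<Delta>) = filter (\<lambda>e. e \<in> fedges r M D)
     (map (\<lambda>j. (White j, Black \<Delta>)) (sorted_list_of_set \<Delta>))"

definition fraser_graph ::
  "nat \<Rightarrow> (nat \<times> nat) set \<Rightarrow> nat set set \<Rightarrow> (fvertex, fedge) hourglass_graph" where
  "fraser_graph r M D = \<lparr>
     verts = fverts r M D,
     white = (\<lambda>v. \<exists>j. v = White j),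
     edges = fedges r M D,
     white_end = fst,
     black_end = snd,
     mult = fmult r M D,
     rot = frot r M D,
     bdry_size = 2 * r,
     bdry = Boundary\<rparr>"

definition fraser_graphs :: "nat \<Rightarrow> filling \<Rightarrow> (fvertex, fedge) hourglass_graph set" where
  "fraser_graphs r T =
     {fraser_graph r M D | M D. is_matching_of r T M \<and> weighted_triangulation r M D}"

end

theory Submission
  imports Defs
begin

text \<open>Cut the circle just before the starting point \<open>x\<close> and orient every arc of the matching from its
  first to its last end.  Promotion rotates the matching, so \<open>prom\<^sub>i(x)\<close> is the opener of rank \<open>i\<close>
  (counted from 0) if that opener precedes the partner of \<open>x\<close>, and otherwise the closer of rank \<open>i\<close>.

  On the graph side every internal vertex has \<open>r\<close> strands, corresponding to the \<open>r\<close> arcs: at a white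
  vertex the strands to a triangle count the arcs cut off by its opposite side.  A trip that enters the
  triangle \<open>a, b, c\<close> from \<open>a\<close> on strand \<open>t\<close> and turns back by \<open>i\<close> leaves through \<open>c\<close> or \<open>b\<close>, after which
  turning forward by \<open>i\<close> again selects the arc number \<open>t\<close> cut off by the side \<open>bc\<close>, in the order of
  closers when coming through \<open>c\<close> and in the order of openers when coming through \<open>b\<close>.  Hence the trip
  descends through smaller and smaller parts of the polygon, always containing the same opener or
  closer of rank \<open>i\<close>, until it reaches it.\<close>

section \<open>Matchings on a circle\<close>

text \<open>Strands can be counted as arcs for two reasons: no arc has both ends in one claw, and
  the chord of every arc has positive weight, hence belongs to the triangulation. So no arc crosses
  a diagonal, each triangle splits the \<open>r\<close> arcs into three parts, and every strand
  position becomes a number of arcs whose ends lie in prescribed ranges of claws. Inside a claw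
  closers come before openers, since otherwise two arcs would cross; this turns the index in a claw
  into a rank. The obstacle is the claw of \<open>x\<close>, which the cut divides: its points from
  \<open>x\<close> on are the nearest ones, its other points the farthest. Its polygon vertex
  therefore has two indices, 0 and \<open>s\<close>, and several side conditions deal with arcs that
  touch it. The arc of \<open>x\<close> makes the choice of the goal: it cannot cross the side
  opposite the corner where the first triangle is entered, and whether it ends before or after that
  side decides between a closer and an opener. As \<open>trip\<close> is a definite description, a
  trip must also be shown not to meet the boundary at two further points.\<close>

definition cdist :: "nat \<Rightarrow> nat \<Rightarrow> nat \<Rightarrow> nat" where
  "cdist n x w = (if x \<le> w then w - x else w + n - x)"

lemma cdist_less: "x \<in> {1..n} \<Longrightarrow> w \<in> {1..n} \<Longrightarrow> cdist n x w < n"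
  by (auto simp: cdist_def)

text \<open>The three disjuncts are the positions of the cut \<open>x\<close> relative to
  \<open>u\<close> and \<open>v\<close>; in this form comparisons of distances can be handed to
  linear arithmetic.\<close>

lemma cdist_less_iff:
  "x \<in> {1..n} \<Longrightarrow> u \<in> {1..n} \<Longrightarrow> v \<in> {1..n} \<Longrightarrow>
    cdist n x u < cdist n x v \<longleftrightarrow> x \<le> u \<and> u < v \<or> v < x \<and> x \<le> u \<or> u < v \<and> v < x"
  unfolding cdist_def by auto

lemma cdist_inj: "x \<in> {1..n} \<Longrightarrow> v \<in> {1..n} \<Longrightarrow> w \<in> {1..n} \<Longrightarrow> cdist n x v = cdist n x w \<Longrightarrow> v = w"
  by (auto simp: cdist_def split: if_splits)

lemma cdist_self [simp]: "cdist n x x = 0"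
  by (simp add: cdist_def)

lemma wrap_cdist: "x \<in> {1..n} \<Longrightarrow> w \<in> {1..n} \<Longrightarrow> wrap n (cdist n x w + x) = w"
  by (cases "w = n") (auto simp: cdist_def wrap_def dest: dvd_imp_le)

text \<open>A point with smaller value has strictly smaller rank, because it is itself counted in
  the rank of the other.\<close>

lemma card_less_inj:
  fixes f :: "'a \<Rightarrow> nat"
  assumes "finite A" "w \<in> A" "v \<in> A" "inj_on f A"
    and "card {u \<in> A. f u < f w} = card {u \<in> A. f u < f v}"
  shows "w = v"
proof (rule ccontr)
  assume "w \<noteq> v"
  then have "f w \<noteq> f v" using assms by (auto dest: inj_onD)
  moreover have less: "card {u \<in> A. f u < f p} < card {u \<in> A. f u < f q}"
    if "f p < f q" "p \<in> A" for p q
    using assms(1) that by (intro psubset_card_mono) auto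
  ultimately show False using less[of w v] less[of v w] assms(2,3,5) by linarith
qed

section \<open>Partners in a noncrossing perfect matching\<close>

locale ncm =
  fixes n :: nat and M :: "(nat \<times> nat) set"
  assumes nc: "noncrossing_perfect_matching n M"
begin

definition partner :: "nat \<Rightarrow> nat" where
  "partner x = (THE y. (x, y) \<in> M \<or> (y, x) \<in> M)"

lemma M_bounds: "(a, b) \<in> M \<Longrightarrow> 1 \<le> a \<and> a < b \<and> b \<le> n"
  using nc by (auto simp: noncrossing_perfect_matching_def)

lemma partner_ex1:
  assumes "x \<in> {1..n}" shows "\<exists>!y. (x, y) \<in> M \<or> (y, x) \<in> M"
proof -
  have u: "\<exists>!e. e \<in> M \<and> (x = fst e \<or> x = snd e)"
    using nc assms by (auto simp: noncrossing_perfect_matching_def)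
  then obtain e where e: "e \<in> M" "x = fst e \<or> x = snd e" by blast
  show ?thesis
  proof (rule ex_ex1I)
    show "\<exists>y. (x, y) \<in> M \<or> (y, x) \<in> M" using e by (cases e) auto
  next
    have eq: "f = e" if "f \<in> M" "x = fst f \<or> x = snd f" for f
      using u e that by blast
    fix y y' assume "(x, y) \<in> M \<or> (y, x) \<in> M" "(x, y') \<in> M \<or> (y', x) \<in> M"
    then have "(x, y) = e \<or> (y, x) = e" "(x, y') = e \<or> (y', x) = e"
      using eq[of "(x, y)"] eq[of "(y, x)"] eq[of "(x, y')"] eq[of "(y', x)"] by auto
    then show "y = y'" by auto
  qed
qed

lemma partner_iff:
  assumes "x \<in> {1..n}" shows "partner x = y \<longleftrightarrow> (x, y) \<in> M \<or> (y, x) \<in> M"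
  using theI'[OF partner_ex1[OF assms]] partner_ex1[OF assms] unfolding partner_def by blast

lemma partner_in: "x \<in> {1..n} \<Longrightarrow> partner x \<in> {1..n}"
  using partner_iff[of x "partner x"] M_bounds by fastforce

lemma partner_partner: "x \<in> {1..n} \<Longrightarrow> partner (partner x) = x"
  using partner_iff[of x "partner x"] partner_iff[of "partner x" x] partner_in by blast

lemma partner_neq: "x \<in> {1..n} \<Longrightarrow> partner x \<noteq> x"
  using partner_iff[of x x] M_bounds by fastforce

lemma inj_partner: "inj_on partner {1..n}"
  unfolding inj_on_def using partner_partner by metis

lemma M_iff: "(a, b) \<in> M \<longleftrightarrow> a \<in> {1..n} \<and> a < b \<and> partner a = b"
proof
  assume "(a, b) \<in> M"
  then show "a \<in> {1..n} \<and> a < b \<and> partner a = b"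
    using M_bounds[of a b] partner_iff[of a b] by auto
next
  assume "a \<in> {1..n} \<and> a < b \<and> partner a = b"
  then show "(a, b) \<in> M" using partner_iff[of a b] M_bounds[of b a] by auto
qed

lemma noncross_M: "(a, b) \<in> M \<Longrightarrow> (c, d) \<in> M \<Longrightarrow> \<not> (a < c \<and> c < b \<and> b < d)"
  using nc unfolding noncrossing_perfect_matching_def
  by (elim conjE) (drule (1) bspec, clarify, drule (1) bspec, simp)

lemma noncross_lin:
  assumes "a \<in> {1..n}" "b \<in> {1..n}" "a < b" "b < partner a"
  shows "a < partner b \<and> partner b < partner a"
proof -
  have a: "(a, partner a) \<in> M" using assms by (simp add: M_iff)
  have ne: "partner b \<noteq> a" "partner b \<noteq> partner a" "partner b \<noteq> b"
    using assms partner_partner[of b] partner_partner[of a] partner_neq[of b] by auto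
  show ?thesis
  proof (cases "b < partner b")
    case True
    then have "(b, partner b) \<in> M" using assms by (simp add: M_iff)
    then have "\<not> partner a < partner b" using noncross_M[OF a] assms by blast
    then show ?thesis using assms ne True by linarith
  next
    case False
    then have "(partner b, b) \<in> M" using assms ne partner_in[of b] partner_partner[of b] by (simp add: M_iff)
    \<comment> \<open>The definition of noncrossing forbids one order of the four ends; here it is
      applied with the two arcs exchanged.\<close>
    then have "\<not> partner b < a" using noncross_M[OF _ a] assms by blast
    then show ?thesis using assms ne False by linarith
  qed
qed

abbreviation dist :: "nat \<Rightarrow> nat \<Rightarrow> nat" where "dist \<equiv> cdist n"

text \<open>Noncrossing does not depend on the cut. A point lies strictly between the two ends of
  the arc of \<open>a\<close>, in the linear order, exactly if its partner does
  (\<open>side\<close>). The points outside are then paired among themselves too, so the statement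
  survives when the arc passes over the cut.\<close>

lemma noncross:
  assumes "x \<in> {1..n}" "a \<in> {1..n}" "b \<in> {1..n}"
    and "dist x a < dist x b" "dist x b < dist x (partner a)"
  shows "dist x a < dist x (partner b) \<and> dist x (partner b) < dist x (partner a)"
proof -
  define a' where "a' = partner a"
  define b' where "b' = partner b"
  have aa: "partner a' = a" "partner b' = b" "a' \<in> {1..n}" "b' \<in> {1..n}"
    unfolding a'_def b'_def using assms partner_partner partner_in by auto
  have ne: "b' \<noteq> a" "b' \<noteq> a'"
  proof -
    show "b' \<noteq> a" using aa(2) assms(5) by blast
    show "b' \<noteq> a'" using aa(1,2) assms(4) by force
  qed
  have side: "(p < b \<and> b < q) \<longleftrightarrow> (p < b' \<and> b' < q)"
    if "p = a \<and> q = a' \<or> p = a' \<and> q = a" for p q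
    using that noncross_lin[of p b] noncross_lin[of p b'] assms aa
    unfolding a'_def b'_def by auto
  have "dist x a < dist x b' \<and> dist x b' < dist x a'"
    using side[OF disjI1[OF conjI[OF refl refl]]] side[OF disjI2[OF conjI[OF refl refl]]] assms(4) assms(5)[folded a'_def] ne
    unfolding cdist_less_iff[OF assms(1,2,3)] cdist_less_iff[OF assms(1,3) aa(3)]
      cdist_less_iff[OF assms(1,2) aa(4)] cdist_less_iff[OF assms(1) aa(4,3)]
    by linarith
  then show ?thesis unfolding a'_def b'_def .
qed

section \<open>Openers, closers and their ranks\<close>

definition opener :: "nat \<Rightarrow> nat \<Rightarrow> bool" where
  "opener x w \<longleftrightarrow> dist x w < dist x (partner w)"

lemma opener_partner:
  "x \<in> {1..n} \<Longrightarrow> w \<in> {1..n} \<Longrightarrow> opener x (partner w) \<longleftrightarrow> \<not> opener x w"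
  using cdist_inj[of x n w "partner w"] partner_in[of w] partner_neq[of w] partner_partner[of w]
  unfolding opener_def by (auto simp: not_less le_less)

lemma opener_self: "x \<in> {1..n} \<Longrightarrow> opener x x"
  unfolding opener_def using cdist_inj[of x n "partner x" x] partner_in partner_neq
  by fastforce

definition openers :: "nat \<Rightarrow> nat set" where "openers x = {w \<in> {1..n}. opener x w}"
definition closers :: "nat \<Rightarrow> nat set" where "closers x = {w \<in> {1..n}. \<not> opener x w}"

lemma finite_openers [simp]: "finite (openers x)" "finite (closers x)"
  by (auto simp: openers_def closers_def)

lemma bij_partner: "x \<in> {1..n} \<Longrightarrow> bij_betw partner (openers x) (closers x)"
  unfolding openers_def closers_def
  by (rule bij_betw_byWitness[where f' = partner])
    (use opener_partner partner_partner partner_in in \<open>blast+\<close>)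

lemma card_openers: "x \<in> {1..n} \<Longrightarrow> 2 * card (openers x) = n" "x \<in> {1..n} \<Longrightarrow> 2 * card (closers x) = n"
proof -
  assume x: "x \<in> {1..n}"
  have "card (openers x) = card (closers x)" using bij_partner[OF x] by (rule bij_betw_same_card)
  moreover have "card (openers x) + card (closers x) = n"
  proof -
    have "openers x \<union> closers x = {1..n}" "openers x \<inter> closers x = {}"
      by (auto simp: openers_def closers_def)
    then show ?thesis using card_Un_disjoint[of "openers x" "closers x"] by simp
  qed
  ultimately show "2 * card (openers x) = n" "2 * card (closers x) = n" by auto
qed

text \<open>Defined at every point \<open>w\<close>, not only at openers: comparing openers with
  closers, and \<open>turn_row\<close> in particular, needs the value at a closer.\<close>

definition orank :: "nat \<Rightarrow> nat \<Rightarrow> nat" where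
  "orank x w = card {v \<in> openers x. dist x v < dist x w}"
definition crank :: "nat \<Rightarrow> nat \<Rightarrow> nat" where
  "crank x w = card {v \<in> closers x. dist x v < dist x w}"

lemma dist_inj_on: "x \<in> {1..n} \<Longrightarrow> inj_on (dist x) {1..n}"
  unfolding inj_on_def using cdist_inj by blast

lemma orank_inj: "x \<in> {1..n} \<Longrightarrow> v \<in> openers x \<Longrightarrow> w \<in> openers x \<Longrightarrow> orank x v = orank x w \<Longrightarrow> v = w"
  unfolding orank_def
  by (rule card_less_inj[of "openers x" _ _ "dist x"]) (auto simp: openers_def intro: inj_on_subset[OF dist_inj_on])

lemma crank_inj: "x \<in> {1..n} \<Longrightarrow> v \<in> closers x \<Longrightarrow> w \<in> closers x \<Longrightarrow> crank x v = crank x w \<Longrightarrow> v = w"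
  unfolding crank_def
  by (rule card_less_inj[of "closers x" _ _ "dist x"]) (auto simp: closers_def intro: inj_on_subset[OF dist_inj_on])

lemma orank_mono: "v \<in> openers x \<Longrightarrow> dist x v < dist x w \<Longrightarrow> orank x v < orank x w"
  unfolding orank_def by (rule psubset_card_mono) auto

lemma crank_mono: "v \<in> closers x \<Longrightarrow> dist x v < dist x w \<Longrightarrow> crank x v < crank x w"
  unfolding crank_def by (rule psubset_card_mono) auto

lemma orank_mono_le: "dist x v \<le> dist x w \<Longrightarrow> orank x v \<le> orank x w"
  unfolding orank_def by (rule card_mono) auto

lemma crank_mono_le: "dist x v \<le> dist x w \<Longrightarrow> crank x v \<le> crank x w"
  unfolding crank_def by (rule card_mono) auto

lemma orank_less_iff: "v \<in> openers x \<Longrightarrow> orank x v < orank x w \<longleftrightarrow> dist x v < dist x w"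
  by (meson leD not_less orank_mono orank_mono_le)

lemma crank_less_iff: "v \<in> closers x \<Longrightarrow> crank x v < crank x w \<longleftrightarrow> dist x v < dist x w"
  by (meson leD not_less crank_mono crank_mono_le)

lemma opener_before_partner:
  assumes x: "x \<in> {1..n}" and w: "w \<in> {1..n}" "w \<noteq> partner x"
    and "dist x w < dist x (partner x)"
  shows "dist x (partner w) < dist x (partner x) \<or> w = x"
proof (cases "w = x")
  case False
  then have "dist x x < dist x w" using w x cdist_inj[of x n x w] by fastforce
  then show ?thesis using noncross[of x x w] assms by auto
qed auto

text \<open>Strictly between \<open>x\<close> and \<open>partner x\<close> the points are matched
  among themselves, as no arc crosses that of \<open>x\<close>, so there are as many openers as
  closers there; \<open>x\<close> is the one opener in excess.\<close>

lemma crank_partner_self: "x \<in> {1..n} \<Longrightarrow> Suc (crank x (partner x)) = orank x (partner x)"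
proof -
  assume x: "x \<in> {1..n}"
  let ?z = "partner x"
  have "partner ` {v \<in> closers x. dist x v < dist x ?z} = {v \<in> openers x. dist x v < dist x ?z} - {x}"
    (is "partner ` ?A = ?B")
  proof (rule antisym)
    show "partner ` ?A \<subseteq> ?B"
    proof
      fix w assume "w \<in> partner ` ?A"
      then obtain v where v: "v \<in> {1..n}" "\<not> opener x v" "dist x v < dist x ?z" "w = partner v"
        by (auto simp: closers_def)
      then show "w \<in> ?B"
        using opener_before_partner[of x v] x opener_self[OF x] partner_in[OF v(1)] opener_partner[OF x v(1)]
          partner_partner[OF v(1)]
        by (auto simp: openers_def)
    qed
    show "?B \<subseteq> partner ` ?A"
    proof
      fix w assume w: "w \<in> ?B"
      then have w': "w \<in> {1..n}" "opener x w" "dist x w < dist x ?z" "w \<noteq> x" by (auto simp: openers_def)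
      then have "partner w \<in> ?A"
        using opener_before_partner[of x w] x partner_in[of w] opener_partner[OF x w'(1)]
        by (auto simp: closers_def)
      then show "w \<in> partner ` ?A" using partner_partner[OF w'(1)] image_eqI[of w partner "partner w" ?A] by simp
    qed
  qed
  moreover have "inj_on partner ?A"
    by (rule inj_on_subset[OF inj_partner]) (auto simp: closers_def)
  ultimately have "card ?A = card ?B" using card_image[of partner ?A] by simp
  moreover have "x \<in> {v \<in> openers x. dist x v < dist x ?z}"
    using opener_self[OF x] x by (auto simp: openers_def opener_def)
  ultimately show ?thesis
    using card_Suc_Diff1[of "{v \<in> openers x. dist x v < dist x ?z}" x] unfolding crank_def orank_def by simp
qed

text \<open>Every closer up to \<open>v\<close> matches an earlier opener, and the opener \<open>x\<close> is still unmatched.\<close>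

lemma crank_less_orank:
  assumes x: "x \<in> {1..n}" and v: "v \<in> closers x" and lt: "dist x v < dist x (partner x)"
  shows "Suc (crank x v) < orank x v"
proof -
  let ?A = "insert v {u \<in> closers x. dist x u < dist x v}"
  have "partner ` ?A \<subseteq> {w \<in> openers x. dist x w < dist x v} - {x}"
  proof
    fix w assume "w \<in> partner ` ?A"
    then obtain u where u: "u \<in> {1..n}" "\<not> opener x u" "dist x u \<le> dist x v" "w = partner u"
      using v by (auto simp: closers_def)
    then have "opener x w" "w \<in> {1..n}" "dist x w < dist x u"
      using x opener_partner[of x u] partner_partner[of u] partner_in[of u] by (auto simp: opener_def)
    moreover have "w \<noteq> x" using u lt partner_partner[of u] by auto
    ultimately show "w \<in> {w \<in> openers x. dist x w < dist x v} - {x}" using u by (auto simp: openers_def)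
  qed
  moreover have "inj_on partner ?A"
    by (rule inj_on_subset[OF inj_partner]) (use v in \<open>auto simp: closers_def\<close>)
  ultimately have "card ?A \<le> card ({w \<in> openers x. dist x w < dist x v} - {x})"
    using card_mono[of "{w \<in> openers x. dist x w < dist x v} - {x}" "partner ` ?A"]
    by (simp add: card_image)
  moreover have "card ?A = Suc (crank x v)" by (simp add: crank_def)
  moreover have "x \<in> {w \<in> openers x. dist x w < dist x v}"
    using opener_self[OF x] x v cdist_inj[of x n x v] by (fastforce simp: openers_def closers_def)
  ultimately show ?thesis
    using card_Suc_Diff1[of "{w \<in> openers x. dist x w < dist x v}" x] unfolding orank_def by simp
qed

end

section \<open>Promotion of two-column tableaux\<close>

context
  fixes r p :: nat and T :: filling
  assumes p: "1 \<le> p" "p \<le> r"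
    and down: "\<And>q. 1 \<le> q \<Longrightarrow> q < p \<Longrightarrow> T (q + 1, 1) < T (q, 2)"
    and right: "p < r \<Longrightarrow> T (p, 2) \<le> T (p + 1, 1)"
begin

text \<open>\<open>p\<close> is the row in which the path turns to the second column: above it the
  entry below is smaller than the one to the right, in row \<open>p\<close> it is not. The empty box
  \<open>(m + 1, 1)\<close> still carries its stale value, as \<open>slide_step\<close> leaves
  it.\<close>

lemma slide_state_down:
  "m < p \<Longrightarrow> slide_state r 2 T m =
     (\<lambda>c. if snd c = 1 \<and> 1 \<le> fst c \<and> fst c \<le> m then T (fst c + 1, 1) else T c, (m + 1, 1))"
proof (induction m)
  case 0
  then show ?case by (auto simp: slide_state_def)
next
  case (Suc m)
  have "slide_state r 2 T (Suc m) = slide_step r 2 (slide_state r 2 T m)"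
    by (simp add: slide_state_def)
  also have "\<dots> = (\<lambda>c. if snd c = 1 \<and> 1 \<le> fst c \<and> fst c \<le> Suc m then T (fst c + 1, 1) else T c, (Suc m + 1, 1))"
    using Suc p down[of "m + 1"] by (auto simp: Let_def fun_eq_iff numeral_2_eq_2)
  finally show ?case .
qed

lemma slide_state_right:
  assumes "p \<le> m" "m \<le> r"
  shows "slide_state r 2 T m =
     (\<lambda>c. if snd c = 1 \<and> 1 \<le> fst c \<and> fst c < p then T (fst c + 1, 1)
          else if c = (p, 1) then T (p, 2)
          else if snd c = 2 \<and> p \<le> fst c \<and> fst c < m then T (fst c + 1, 2) else T c, (m, 2))"
  using assms
proof (induction m rule: dec_induct)
  case base
  have "slide_state r 2 T p = slide_step r 2 (slide_state r 2 T (p - 1))"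
    using p by (cases p) (simp_all add: slide_state_def)
  also have "\<dots> = slide_step r 2
    (\<lambda>c. if snd c = 1 \<and> 1 \<le> fst c \<and> fst c \<le> p - 1 then T (fst c + 1, 1) else T c, (p, 1))"
    using slide_state_down[of "p - 1"] p by simp
  finally have e1: "slide_state r 2 T p = slide_step r 2
    (\<lambda>c. if snd c = 1 \<and> 1 \<le> fst c \<and> fst c \<le> p - 1 then T (fst c + 1, 1) else T c, (p, 1))" .
  have e2: "slide_source r 2 (\<lambda>c. if snd c = 1 \<and> 1 \<le> fst c \<and> fst c \<le> p - 1 then T (fst c + 1, 1) else T c) (p, 1) = (p, 2)"
    using p right by (auto simp: numeral_2_eq_2)
  show ?case unfolding e1 slide_step.simps e2 Let_def using p by (auto simp: fun_eq_iff)
next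
  case (step m)
  have "slide_state r 2 T (Suc m) = slide_step r 2 (slide_state r 2 T m)"
    by (simp add: slide_state_def)
  also have "\<dots> = (\<lambda>c. if snd c = 1 \<and> 1 \<le> fst c \<and> fst c < p then T (fst c + 1, 1)
          else if c = (p, 1) then T (p, 2)
          else if snd c = 2 \<and> p \<le> fst c \<and> fst c < Suc m then T (fst c + 1, 2) else T c, (Suc m, 2))"
    using step p by (auto simp: Let_def fun_eq_iff)
  finally show ?case .
qed

lemma promotion_two_columns:
  assumes "1 \<le> q" "q \<le> r"
  shows "promotion r 2 T (q, 1) = (if q < p then T (q + 1, 1) else if q = p then T (p, 2) else T (q, 1)) - 1"
    and "promotion r 2 T (q, 2) = (if q < p then T (q, 2) else if q < r then T (q + 1, 2) else r * 2 + 1) - 1"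
  using assms slide_state_right[of r] p by (auto simp: promotion_def)

lemma moving_entry_two_columns:
  assumes "1 \<le> i" "i < r"
  shows "moving_entry r 2 i T = (if i < p then T (i + 1, 1) else T (i + 1, 2))"
proof -
  have pos: "snd (slide_state r 2 T m) = (if m < p then (m + 1, 1) else (m, 2))" if "m \<le> r" for m
    using slide_state_down[of m] slide_state_right[of m] that by auto
  \<comment> \<open>The horizontal slide in row \<open>p\<close> takes one unit of time, so the box
    leaves row \<open>i\<close> downwards at time \<open>i - 1\<close> in the first column but at
    time \<open>i\<close> in the second.\<close>
  define m0 where "m0 = (if i < p then i - 1 else i)"
  have uniq: "m = m0 \<and> q = (if i < p then 1 else 2)"
    if "m < r" "snd (slide_state r 2 T m) = (i, q)" "snd (slide_state r 2 T (Suc m)) = (i + 1, q)" for m q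
    using that pos[of m] pos[of "Suc m"] p unfolding m0_def by (auto split: if_splits)
  have val: "fst (slide_state r 2 T m0) (i + 1, if i < p then 1 else 2) = (if i < p then T (i + 1, 1) else T (i + 1, 2))"
    using slide_state_down[of m0] slide_state_right[of m0] p assms unfolding m0_def by auto
  have ex: "m0 < r" "snd (slide_state r 2 T m0) = (i, if i < p then 1 else 2)"
     "snd (slide_state r 2 T (Suc m0)) = (i + 1, if i < p then 1 else 2)"
    using pos[of m0] pos[of "Suc m0"] p assms unfolding m0_def by auto
  show ?thesis unfolding moving_entry_def
  proof (rule the_equality)
    show "\<exists>m<r + 2 - 2. \<exists>q. snd (slide_state r 2 T m) = (i, q) \<and> snd (slide_state r 2 T (Suc m)) = (i + 1, q) \<and>
        (if i < p then T (i + 1, 1) else T (i + 1, 2)) = fst (slide_state r 2 T m) (i + 1, q)"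
      by (rule exI[of _ m0], intro conjI exI[of _ "if i < p then 1 else 2"]) (use ex val in simp_all)
  next
    fix a assume "\<exists>m<r + 2 - 2. \<exists>q. snd (slide_state r 2 T m) = (i, q) \<and> snd (slide_state r 2 T (Suc m)) = (i + 1, q) \<and>
        a = fst (slide_state r 2 T m) (i + 1, q)"
    then obtain m q where m: "m < r" "snd (slide_state r 2 T m) = (i, q)"
      "snd (slide_state r 2 T (Suc m)) = (i + 1, q)" "a = fst (slide_state r 2 T m) (i + 1, q)" by auto
    show "a = (if i < p then T (i + 1, 1) else T (i + 1, 2))"
      using uniq[OF m(1-3)] m(4) val by simp
  qed
qed

end

context ncm
begin

text \<open>The tableau read from the point \<open>x\<close>: its first column holds the openers and its second column
  the closers, for the circle cut just before \<open>x\<close>.  Promotion moves the cut to \<open>x + 1\<close>.\<close>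

definition tableau_from :: "nat \<Rightarrow> nat \<Rightarrow> filling \<Rightarrow> bool" where
  "tableau_from r x T \<longleftrightarrow>
     (\<forall>q\<in>{1..r}. \<exists>w\<in>openers x. T (q, 1) = dist x w + 1 \<and> orank x w + 1 = q) \<and>
     (\<forall>q\<in>{1..r}. \<exists>w\<in>closers x. T (q, 2) = dist x w + 1 \<and> crank x w + 1 = q)"

lemma tableau_fromE:
  assumes "tableau_from r x T"
  shows "1 \<le> q \<Longrightarrow> q \<le> r \<Longrightarrow> \<exists>w\<in>openers x. T (q, 1) = dist x w + 1 \<and> orank x w + 1 = q"
    and "q < r \<Longrightarrow> \<exists>w\<in>openers x. T (q + 1, 1) = dist x w + 1 \<and> orank x w = q"
    and "1 \<le> q \<Longrightarrow> q \<le> r \<Longrightarrow> \<exists>w\<in>closers x. T (q, 2) = dist x w + 1 \<and> crank x w + 1 = q"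
    and "q < r \<Longrightarrow> \<exists>w\<in>closers x. T (q + 1, 2) = dist x w + 1 \<and> crank x w = q"
proof -
  have A: "\<exists>w\<in>openers x. T (q, 1) = dist x w + 1 \<and> orank x w + 1 = q"
    and B: "\<exists>w\<in>closers x. T (q, 2) = dist x w + 1 \<and> crank x w + 1 = q" if "q \<in> {1..r}" for q
    using assms that unfolding tableau_from_def by blast+
  show "1 \<le> q \<Longrightarrow> q \<le> r \<Longrightarrow> \<exists>w\<in>openers x. T (q, 1) = dist x w + 1 \<and> orank x w + 1 = q" using A[of q] by simp
  show "q < r \<Longrightarrow> \<exists>w\<in>openers x. T (q + 1, 1) = dist x w + 1 \<and> orank x w = q" using A[of "q + 1"] by simp
  show "1 \<le> q \<Longrightarrow> q \<le> r \<Longrightarrow> \<exists>w\<in>closers x. T (q, 2) = dist x w + 1 \<and> crank x w + 1 = q" using B[of q] by simp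
  show "q < r \<Longrightarrow> \<exists>w\<in>closers x. T (q + 1, 2) = dist x w + 1 \<and> crank x w = q" using B[of "q + 1"] by simp
qed

text \<open>The row in which the slide path moves to the second column: the partner of \<open>x\<close> is the first
  closer by which all openers seen so far are matched.\<close>

definition turn_row :: "nat \<Rightarrow> nat" where "turn_row x = orank x (partner x)"

lemma partner_closer: "x \<in> {1..n} \<Longrightarrow> partner x \<in> closers x"
  using partner_in opener_partner opener_self by (auto simp: closers_def)

lemma turn_row_bounds:
  assumes "n = 2 * r" "x \<in> {1..n}"
  shows "1 \<le> turn_row x" "turn_row x \<le> r"
proof -
  show "1 \<le> turn_row x" using crank_partner_self[OF assms(2)] unfolding turn_row_def by simp
  have "orank x (partner x) \<le> card (openers x)" unfolding orank_def by (rule card_mono) auto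
  then show "turn_row x \<le> r" using card_openers[OF assms(2)] assms unfolding turn_row_def by simp
qed

text \<open>Above the turn row the closer \<open>v\<close> of rank \<open>q - 1\<close> precedes
  \<open>partner x\<close>, so more than \<open>q\<close> openers come before it, among them the
  opener of rank \<open>q\<close>. In the turn row the closer is \<open>partner x\<close> itself,
  which has exactly \<open>turn_row x\<close> openers before it, so the opener of that rank comes
  later.\<close>

lemma tableau_turn:
  assumes "n = 2 * r" "x \<in> {1..n}" "tableau_from r x T"
  shows "1 \<le> q \<Longrightarrow> q < turn_row x \<Longrightarrow> T (q + 1, 1) < T (q, 2)"
    and "turn_row x < r \<Longrightarrow> T (turn_row x, 2) \<le> T (turn_row x + 1, 1)"
proof -
  assume q: "1 \<le> q" "q < turn_row x"
  have q': "q < r" "q \<le> r" using q turn_row_bounds[OF assms(1,2)] by auto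
  then obtain v w where w: "w \<in> openers x" "T (q + 1, 1) = dist x w + 1" "orank x w = q"
    and v: "v \<in> closers x" "T (q, 2) = dist x v + 1" "crank x v + 1 = q"
    using tableau_fromE(2,3)[OF assms(3), of q] q q' by blast
  have "crank x v < crank x (partner x)" using q v crank_partner_self[OF assms(2)] unfolding turn_row_def by simp
  then have "Suc (crank x v) < orank x v"
    using crank_less_orank[OF assms(2) v(1)] crank_less_iff[OF v(1)] by simp
  then have "orank x w < orank x v" using w v by simp
  then show "T (q + 1, 1) < T (q, 2)" using orank_less_iff[OF w(1)] w v by simp
next
  assume q: "turn_row x < r"
  then obtain v w where w: "w \<in> openers x" "T (turn_row x + 1, 1) = dist x w + 1" "orank x w = turn_row x"
    and v: "v \<in> closers x" "T (turn_row x, 2) = dist x v + 1" "crank x v + 1 = turn_row x"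
    using tableau_fromE(2,3)[OF assms(3), of "turn_row x"] q turn_row_bounds[OF assms(1,2)] by blast
  have "v = partner x"
    using crank_inj[OF assms(2) v(1) partner_closer[OF assms(2)]] v(3) crank_partner_self[OF assms(2)]
    unfolding turn_row_def by simp
  then have "\<not> orank x w < orank x v" using w unfolding turn_row_def by simp
  then show "T (turn_row x, 2) \<le> T (turn_row x + 1, 1)" using orank_less_iff[OF w(1)] w v by simp
qed

section \<open>Moving the cut past one point\<close>

lemma dist_Suc:
  assumes "x \<in> {1..n}" "x < n" "w \<in> {1..n}" "w \<noteq> x" shows "dist x w = dist (x + 1) w + 1"
  using assms by (auto simp: cdist_def)

lemma dist_Suc_self:
  assumes "x \<in> {1..n}" "x < n" shows "dist (x + 1) x = n - 1"
  using assms by (auto simp: cdist_def)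

text \<open>Moving the cut takes \<open>x\<close> from the near end to the far end and keeps the
  order of all other points, so only the arc of \<open>x\<close> changes its direction.\<close>

lemma opener_Suc:
  assumes x: "x \<in> {1..n}" "x < n" and w: "w \<in> {1..n}"
  shows "opener (x + 1) w \<longleftrightarrow> (opener x w \<and> w \<noteq> x) \<or> w = partner x"
proof -
  have lt: "dist (x + 1) v < n - 1" if "v \<in> {1..n}" "v \<noteq> x" for v
    using dist_Suc[OF x that] cdist_less[OF x(1) that(1)] by simp
  have p: "partner w \<in> {1..n}" "partner (partner w) = w" "partner w \<noteq> w"
    using w partner_in partner_partner partner_neq by auto
  consider "w = x" | "w = partner x" | "w \<noteq> x" "partner w \<noteq> x" "w \<noteq> partner x"
    using p by metis
  then show ?thesis
  proof cases
    case 1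
    then show ?thesis using lt[of "partner w"] p dist_Suc_self[OF x] unfolding opener_def by auto
  next
    case 2
    then have "partner w = x" using partner_partner[OF x(1)] by simp
    then show ?thesis using lt[of w] p 2 w dist_Suc_self[OF x] unfolding opener_def by auto
  next
    case 3
    then show ?thesis using dist_Suc[OF x w] dist_Suc[OF x p(1)] unfolding opener_def by auto
  qed
qed

lemma openers_Suc:
  assumes x: "x \<in> {1..n}" "x < n"
  shows "openers (x + 1) = insert (partner x) (openers x - {x})"
    and "closers (x + 1) = insert x (closers x - {partner x})"
  using opener_Suc[OF x] x partner_in[OF x(1)] opener_self[OF x(1)] partner_neq[OF x(1)]
  unfolding openers_def closers_def by auto

text \<open>The loss of the opener \<open>x\<close> lowers every rank by one; for points beyond
  \<open>partner x\<close> the new opener \<open>partner x\<close> makes up for it.\<close>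

lemma orank_Suc:
  assumes x: "x \<in> {1..n}" "x < n" and w: "w \<in> {1..n}" "w \<noteq> x"
  shows "dist x w \<le> dist x (partner x) \<Longrightarrow> orank (x + 1) w + 1 = orank x w"
    and "dist x (partner x) < dist x w \<Longrightarrow> orank (x + 1) w = orank x w"
proof -
  let ?A = "{v \<in> openers x. dist x v < dist x w}"
  have xA: "x \<in> ?A" using x w opener_self cdist_inj[of x n x w] by (fastforce simp: openers_def)
  have eq: "{v \<in> openers (x + 1). dist (x + 1) v < dist (x + 1) w} =
    {v \<in> insert (partner x) (openers x - {x}). dist x v < dist x w}"
    unfolding openers_Suc[OF x]
    using dist_Suc[OF x w] dist_Suc[OF x] partner_in[OF x(1)] partner_neq[OF x(1)]
    by (auto simp: openers_def simp del: atLeastAtMost_iff)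
  have c1: "card (?A - {x}) + 1 = card ?A" using card_Suc_Diff1[OF _ xA] by simp
  have pc: "partner x \<notin> openers x" using partner_closer[OF x(1)] by (auto simp: openers_def closers_def)
  show "orank (x + 1) w + 1 = orank x w" if "dist x w \<le> dist x (partner x)"
  proof -
    have "{v \<in> insert (partner x) (openers x - {x}). dist x v < dist x w} = ?A - {x}" using that by auto
    then show ?thesis using c1 eq unfolding orank_def by simp
  qed
  show "orank (x + 1) w = orank x w" if "dist x (partner x) < dist x w"
  proof -
    have "{v \<in> insert (partner x) (openers x - {x}). dist x v < dist x w} = insert (partner x) (?A - {x})"
      using that by auto
    then show ?thesis using c1 eq pc unfolding orank_def by simp
  qed
qed

text \<open>The new closer \<open>x\<close> is the farthest point and precedes no other
  (\<open>far\<close>), so only the loss of the closer \<open>partner x\<close> is felt, by the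
  points beyond it.\<close>

lemma crank_Suc:
  assumes x: "x \<in> {1..n}" "x < n" and w: "w \<in> {1..n}" "w \<noteq> x"
  shows "dist x w \<le> dist x (partner x) \<Longrightarrow> crank (x + 1) w = crank x w"
    and "dist x (partner x) < dist x w \<Longrightarrow> crank (x + 1) w + 1 = crank x w"
proof -
  let ?A = "{v \<in> closers x. dist x v < dist x w}"
  have nx: "x \<notin> closers x" using opener_self[OF x(1)] by (auto simp: closers_def)
  have far: "\<not> dist (x + 1) x < dist (x + 1) w"
    using dist_Suc[OF x w] dist_Suc_self[OF x] cdist_less[OF x(1) w(1)] by simp
  have eq: "{v \<in> closers (x + 1). dist (x + 1) v < dist (x + 1) w} = ?A - {partner x}"
  proof -
    have key: "dist (x + 1) v < dist (x + 1) w \<longleftrightarrow> dist x v < dist x w" if "v \<in> closers x" for v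
    proof -
      have "v \<noteq> x" using that nx by blast
      then show ?thesis using dist_Suc[OF x w] dist_Suc[OF x, of v] that by (auto simp: closers_def)
    qed
    have "v \<in> insert x (closers x - {partner x}) \<and> dist (x + 1) v < dist (x + 1) w \<longleftrightarrow> v \<in> ?A - {partner x}" for v
      using far key[of v] by (cases "v = x"; cases "v \<in> closers x") (use nx in auto)
    then show ?thesis unfolding openers_Suc[OF x] by blast
  qed
  show "crank (x + 1) w = crank x w" if "dist x w \<le> dist x (partner x)"
  proof -
    have "?A - {partner x} = ?A" using that by auto
    then show ?thesis using eq unfolding crank_def by simp
  qed
  show "crank (x + 1) w + 1 = crank x w" if "dist x (partner x) < dist x w"
  proof -
    have "partner x \<in> ?A" using that partner_closer[OF x(1)] by simp
    then show ?thesis using eq card_Suc_Diff1[of ?A "partner x"] unfolding crank_def by simp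
  qed
qed

lemma crank_Suc_self:
  assumes "n = 2 * r" and x: "x \<in> {1..n}" "x < n" shows "crank (x + 1) x + 1 = r"
proof -
  have x1: "x + 1 \<in> {1..n}" using x by auto
  have xc: "x \<in> closers (x + 1)" using openers_Suc[OF x] by simp
  have "{v \<in> closers (x + 1). dist (x + 1) v < dist (x + 1) x} = closers (x + 1) - {x}"
  proof -
    have "dist (x + 1) v < dist (x + 1) x" if "v \<in> {1..n}" "v \<noteq> x" for v
      using dist_Suc[OF x that] dist_Suc_self[OF x] cdist_less[OF x(1) that(1)] by simp
    then show ?thesis by (auto simp: closers_def)
  qed
  then show ?thesis using card_openers[OF x1] card_Suc_Diff1[OF finite_openers(2) xc] assms(1) unfolding crank_def by simp
qed

text \<open>The slide matches the change of ranks. In the first column the openers before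
  \<open>partner x\<close> lose one rank and move up, \<open>partner x\<close> arrives in the turn
  row, and later openers stay. In the second column the closers beyond \<open>partner x\<close> move
  up and \<open>x\<close>, now the last point, fills the last row. Subtracting 1 from the entries is
  the decrease of the distances.\<close>

lemma tableau_promotion:
  assumes n: "n = 2 * r" and x: "x \<in> {1..n}" "x < n" and T: "tableau_from r x T"
  shows "tableau_from r (x + 1) (promotion r 2 T)"
proof -
  let ?p = "turn_row x" and ?z = "partner x"
  note b = turn_row_bounds[OF n x(1)]
  note pr = promotion_two_columns[OF b tableau_turn[OF n x(1) T], simplified]
  have z: "?z \<in> closers x" "?z \<in> {1..n}" "?z \<noteq> x" "crank x ?z + 1 = ?p" "orank x ?z = ?p"
    using partner_closer[OF x(1)] partner_in partner_neq x(1) crank_partner_self[OF x(1)]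
    unfolding turn_row_def by simp_all
  show ?thesis unfolding tableau_from_def
  proof (intro conjI ballI)
    fix q assume q: "q \<in> {1..r}"
    show "\<exists>w\<in>openers (x + 1). promotion r 2 T (q, 1) = dist (x + 1) w + 1 \<and> orank (x + 1) w + 1 = q"
    proof (cases "q < ?p")
      case True
      then have "q < r" using b by auto
      then obtain w where w: "w \<in> openers x" "T (q + 1, 1) = dist x w + 1" "orank x w = q"
        using tableau_fromE(2)[OF T] by blast
      have w': "w \<in> {1..n}" "w \<noteq> x" using w q by (auto simp: openers_def orank_def)
      have "dist x w < dist x ?z" using orank_less_iff[OF w(1), of ?z] z True w by simp
      then show ?thesis using w w' True orank_Suc(1)[OF x w'] openers_Suc[OF x] dist_Suc[OF x w'] pr[of q] q
        by (intro bexI[of _ w]) auto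
    next
      case False
      show ?thesis
      proof (cases "q = ?p")
        case True
        obtain w where w: "w \<in> closers x" "T (?p, 2) = dist x w + 1" "crank x w + 1 = ?p"
          using tableau_fromE(3)[OF T b] by blast
        have "w = ?z" using crank_inj[OF x(1) w(1) z(1)] w z by simp
        then show ?thesis using w z True orank_Suc(1)[OF x z(2,3)] openers_Suc[OF x] dist_Suc[OF x z(2,3)] pr[of q] q
          by (intro bexI[of _ ?z]) auto
      next
        case neq: False
        obtain w where w: "w \<in> openers x" "T (q, 1) = dist x w + 1" "orank x w + 1 = q"
          using tableau_fromE(1)[OF T, of q] q by auto
        have w': "w \<in> {1..n}" "w \<noteq> x" "w \<noteq> ?z"
          using w z neq False b by (auto simp: openers_def closers_def orank_def)
        have "\<not> dist x w < dist x ?z" using orank_less_iff[OF w(1), of ?z] z False neq w by simp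
        then have "dist x ?z < dist x w" using cdist_inj[OF x(1) w'(1) z(2)] w' by fastforce
        then show ?thesis using w w' False neq orank_Suc(2)[OF x w'(1,2)] openers_Suc[OF x] dist_Suc[OF x w'(1,2)] pr[of q] q
          by (intro bexI[of _ w]) auto
      qed
    qed
  next
    fix q assume q: "q \<in> {1..r}"
    show "\<exists>w\<in>closers (x + 1). promotion r 2 T (q, 2) = dist (x + 1) w + 1 \<and> crank (x + 1) w + 1 = q"
    proof (cases "q < ?p")
      case True
      obtain w where w: "w \<in> closers x" "T (q, 2) = dist x w + 1" "crank x w + 1 = q"
        using tableau_fromE(3)[OF T, of q] q by auto
      have w': "w \<in> {1..n}" "w \<noteq> x" "w \<noteq> ?z"
        using w z True opener_self[OF x(1)] by (auto simp: closers_def)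
      have "dist x w < dist x ?z" using crank_less_iff[OF w(1), of ?z] z True w by simp
      then show ?thesis using w w' True crank_Suc(1)[OF x w'(1,2)] openers_Suc[OF x] dist_Suc[OF x w'(1,2)] pr[of q] q
        by (intro bexI[of _ w]) auto
    next
      case False
      show ?thesis
      proof (cases "q < r")
        case True
        then obtain w where w: "w \<in> closers x" "T (q + 1, 2) = dist x w + 1" "crank x w = q"
          using tableau_fromE(4)[OF T] by blast
        have w': "w \<in> {1..n}" "w \<noteq> x" "w \<noteq> ?z"
          using w z False opener_self[OF x(1)] by (auto simp: closers_def)
        have "dist x ?z < dist x w" using crank_less_iff[OF z(1), of w] z False w by simp
        then show ?thesis using w w' False True crank_Suc(2)[OF x w'(1,2)] openers_Suc[OF x] dist_Suc[OF x w'(1,2)] pr[of q] q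
          by (intro bexI[of _ w]) auto
      next
        case r: False
        then show ?thesis using q False pr[of q] dist_Suc_self[OF x] crank_Suc_self[OF n x] openers_Suc[OF x] n b
          by (intro bexI[of _ x]) auto
      qed
    qed
  qed
qed

text \<open>The opener of rank \<open>i\<close> precedes \<open>partner x\<close> exactly if
  \<open>i < turn_row x\<close>, so the two alternatives for \<open>y\<close> are the two columns in
  which the empty box can leave row \<open>i\<close> downwards. The entry read there is the distance
  from \<open>x\<close> plus one, and \<open>wrap\<close> turns it back into a point of the
  circle.\<close>

lemma prom_eqI:
  assumes n: "n = 2 * r" and x: "x \<in> {1..n}" and T: "tableau_from r 1 T"
    and i: "1 \<le> i" "i < r" and y: "y \<in> {1..n}"
    and spec: "opener x y \<and> orank x y = i \<and> dist x y < dist x (partner x) \<or>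
      \<not> opener x y \<and> crank x y = i \<and> dist x (partner x) < dist x y"
  shows "prom r 2 i T x = y"
proof -
  have tab: "x \<in> {1..n} \<Longrightarrow> tableau_from r x ((promotion r 2 ^^ (x - 1)) T)" for x
  proof (induction x)
    case (Suc x)
    show ?case
    proof (cases x)
      case 0
      then show ?thesis using T by simp
    next
      case (Suc x')
      then show ?thesis using Suc.IH Suc.prems tableau_promotion[OF n, of x] by simp
    qed
  qed simp
  define T' where "T' = (promotion r 2 ^^ (x - 1)) T"
  have T': "tableau_from r x T'" using tab[OF x] unfolding T'_def .
  have mv: "moving_entry r 2 i T' = (if i < turn_row x then T' (i + 1, 1) else T' (i + 1, 2))"
    by (rule moving_entry_two_columns[OF turn_row_bounds[OF n x] tableau_turn[OF n x T'] i])
  have "moving_entry r 2 i T' = dist x y + 1"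
    using spec
  proof
    assume s: "opener x y \<and> orank x y = i \<and> dist x y < dist x (partner x)"
    then have yo: "y \<in> openers x" using y by (simp add: openers_def)
    then have "i < turn_row x" using s orank_mono unfolding turn_row_def by fastforce
    moreover obtain w where w: "w \<in> openers x" "T' (i + 1, 1) = dist x w + 1" "orank x w = i"
      using tableau_fromE(2)[OF T' i(2)] by blast
    moreover have "w = y" using orank_inj[OF x w(1) yo] w s by simp
    ultimately show ?thesis using mv by simp
  next
    assume s: "\<not> opener x y \<and> crank x y = i \<and> dist x (partner x) < dist x y"
    then have yo: "y \<in> closers x" using y by (simp add: closers_def)
    have "crank x (partner x) < i" using s crank_mono[OF partner_closer[OF x]] by fastforce
    then have "\<not> i < turn_row x" using crank_partner_self[OF x] unfolding turn_row_def by simp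
    moreover obtain w where w: "w \<in> closers x" "T' (i + 1, 2) = dist x w + 1" "crank x w = i"
      using tableau_fromE(4)[OF T' i(2)] by blast
    moreover have "w = y" using crank_inj[OF x w(1) yo] w s by simp
    ultimately show ?thesis using mv by simp
  qed
  then show ?thesis using wrap_cdist[OF x y] n unfolding prom_def T'_def by (simp add: mult.commute)
qed

end

text \<open>For the cut before 1 the openers are the smaller ends of the arcs. The \<open>r\<close>
  entries of the first column are such ends, and there are just \<open>r\<close> openers, so the two
  columns are exactly the openers and the closers; as columns increase, the row of an entry is its
  rank plus one.\<close>

lemma tableau_from_SYT:
  assumes T: "T \<in> SYT r 2" and M: "is_matching_of r T M" and r: "1 \<le> r"
  shows "ncm.tableau_from (2 * r) M r 1 T"
proof -
  interpret ncm "2 * r" M using M by unfold_locales (simp add: is_matching_of_def)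
  have one: "1 \<in> {1..2 * r}" using r by simp
  have d1: "dist 1 w = w - 1" if "w \<in> {1..2 * r}" for w using that by (auto simp: cdist_def)
  have bij: "bij_betw T ({1..r} \<times> {1..2}) {1..2 * r}"
    and col: "\<And>p p' q. p \<in> {1..r} \<Longrightarrow> p' \<in> {1..r} \<Longrightarrow> q \<in> {1..2} \<Longrightarrow> p < p' \<Longrightarrow> T (p, q) < T (p', q)"
    using T by (auto simp: SYT_def mult.commute)
  have Tin: "T (p, q) \<in> {1..2 * r}" if "p \<in> {1..r}" "q \<in> {1..2}" for p q
    using bij_betwE[OF bij] that by blast
  have inj: "inj_on T ({1..r} \<times> {1..2})" using bij by (rule bij_betw_imp_inj_on)
  have op: "opener 1 w \<longleftrightarrow> w < partner w" if "w \<in> {1..2 * r}" for w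
    using d1[OF that] d1[OF partner_in[OF that]] that partner_in[OF that] unfolding opener_def by auto
  have col_inj: "inj_on (\<lambda>p. T (p, q)) {1..r}" if "q \<in> {1..2}" for q
  proof (rule inj_onI)
    fix p p' assume "p \<in> {1..r}" "p' \<in> {1..r}" "T (p, q) = T (p', q)"
    then show "p = p'" using inj_onD[OF inj, of "(p, q)" "(p', q)"] that by blast
  qed
  have card_col: "card ((\<lambda>p. T (p, q)) ` {1..r}) = r" if "q \<in> {1..2}" for q
    using card_image[OF col_inj[OF that]] by simp
  have sub1: "(\<lambda>p. T (p, 1)) ` {1..r} \<subseteq> openers 1"
  proof
    fix w assume "w \<in> (\<lambda>p. T (p, 1)) ` {1..r}"
    then have "w \<in> {1..2 * r}" "w \<in> fst ` M" using M Tin[of _ 1] by (auto simp: is_matching_of_def)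
    then show "w \<in> openers 1" using op[of w] M_iff by (auto simp: openers_def)
  qed
  have c: "card (openers 1) = r" "card (closers 1) = r" using card_openers[OF one] by auto
  have eq1: "(\<lambda>p. T (p, 1)) ` {1..r} = openers 1"
    by (rule card_subset_eq) (use sub1 c card_col[of 1] in auto)
  have sub2: "(\<lambda>p. T (p, 2)) ` {1..r} \<subseteq> closers 1"
  proof
    fix w assume "w \<in> (\<lambda>p. T (p, 2)) ` {1..r}"
    then obtain p where p: "p \<in> {1..r}" "w = T (p, 2)" by auto
    have "w \<notin> openers 1"
    proof
      assume "w \<in> openers 1"
      then obtain p' where "p' \<in> {1..r}" "w = T (p', 1)" unfolding eq1[symmetric] by blast
      then show False using p inj_onD[OF inj, of "(p, 2)" "(p', 1)"] by auto
    qed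
    then show "w \<in> closers 1" using Tin[of p 2] p by (auto simp: openers_def closers_def)
  qed
  have eq2: "(\<lambda>p. T (p, 2)) ` {1..r} = closers 1"
    by (rule card_subset_eq) (use sub2 c card_col[of 2] in auto)
  have rank: "card {v \<in> (\<lambda>p. T (p, k)) ` {1..r}. dist 1 v < dist 1 (T (q, k))} + 1 = q"
    if q: "q \<in> {1..r}" and k: "k \<in> {1..2}" for q k
  proof -
    have mono: "T (p, k) < T (q, k) \<longleftrightarrow> p < q" if "p \<in> {1..r}" for p
      using col[OF that q k] col[OF q that k] by (cases p q rule: linorder_cases) auto
    have "dist 1 (T (p, k)) < dist 1 (T (q, k)) \<longleftrightarrow> p < q" if p: "p \<in> {1..r}" for p
      using mono[OF p] d1[OF Tin[OF p k]] d1[OF Tin[OF q k]] Tin[OF p k] by auto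
    then have "{v \<in> (\<lambda>p. T (p, k)) ` {1..r}. dist 1 v < dist 1 (T (q, k))} = (\<lambda>p. T (p, k)) ` {1..<q}"
      using q by auto
    moreover have "inj_on (\<lambda>p. T (p, k)) {1..<q}"
      by (rule inj_on_subset[OF col_inj[OF k]]) (use q in auto)
    ultimately show ?thesis using q by (simp add: card_image)
  qed
  show ?thesis unfolding tableau_from_def
  proof (intro conjI ballI)
    fix q assume q: "q \<in> {1..r}"
    show "\<exists>w\<in>openers 1. T (q, 1) = dist 1 w + 1 \<and> orank 1 w + 1 = q"
      using rank[OF q, of 1] eq1 q d1[OF Tin[OF q, of 1]] Tin[OF q, of 1] unfolding orank_def
      by (intro bexI[of _ "T (q, 1)"]) auto
    show "\<exists>w\<in>closers 1. T (q, 2) = dist 1 w + 1 \<and> crank 1 w + 1 = q"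
      using rank[OF q, of 2] eq2 q d1[OF Tin[OF q, of 2]] Tin[OF q, of 2] unfolding crank_def
      by (intro bexI[of _ "T (q, 2)"]) auto
  qed
qed

section \<open>Claws\<close>

text \<open>The elements below \<open>w\<close> occupy an initial segment of the sorted list, whose
  length is their number.\<close>

lemma sorted_list_of_set_nth_less:
  fixes A :: "nat set"
  assumes "finite A" "j < card A"
  shows "sorted_list_of_set A ! j < w \<longleftrightarrow> j < card {i \<in> A. i < w}"
proof -
  let ?xs = "sorted_list_of_set A"
  have len: "length ?xs = card A" using assms by simp
  have str: "sorted_wrt (<) ?xs" by simp
  have lt: "?xs ! i < ?xs ! k \<longleftrightarrow> i < k" if "i < card A" "k < card A" for i k
    using sorted_wrt_nth_less[OF str, of i k] sorted_wrt_nth_less[OF str, of k i] that len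
    by (cases i k rule: linorder_cases) auto
  have inj: "inj_on ((!) ?xs) {..<card A}"
    using len by (intro inj_on_nth) auto
  have A: "A = (!) ?xs ` {..<card A}"
    using assms(1) len by (metis set_sorted_list_of_set list.set_map map_nth atLeast_upt set_upt lessThan_atLeast0)
  define S where "S = {i \<in> {..<card A}. ?xs ! i < w}"
  have "{i \<in> A. i < w} = (!) ?xs ` S"
    unfolding S_def by (subst A) auto
  moreover have "inj_on ((!) ?xs) S" by (rule inj_on_subset[OF inj]) (auto simp: S_def)
  ultimately have cS: "card {i \<in> A. i < w} = card S" by (simp add: card_image)
  show ?thesis
  proof
    assume "?xs ! j < w"
    then have "?xs ! k < w" if "k \<le> j" for k
      using lt[of k j] that assms(2) by (cases "k = j") (auto intro: less_trans)
    then have "{..j} \<subseteq> S" unfolding S_def using assms(2) by auto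
    then have "card {..j} \<le> card S" by (intro card_mono) (auto simp: S_def)
    then show "j < card {i \<in> A. i < w}" using cS by simp
  next
    assume j: "j < card {i \<in> A. i < w}"
    show "?xs ! j < w"
    proof (rule ccontr)
      assume "\<not> ?xs ! j < w"
      then have "k < j" if "k < card A" "?xs ! k < w" for k
        using lt[of j k] that assms(2) by (cases j k rule: linorder_cases) auto
      then have "S \<subseteq> {..<j}" unfolding S_def by auto
      then have "card S \<le> card {..<j}" by (intro card_mono) auto
      then show False using j cS by simp
    qed
  qed
qed

locale claws =
  fixes r :: nat and M :: "(nat \<times> nat) set"
  assumes nc: "noncrossing_perfect_matching (2 * r) M" and r_pos: "1 \<le> r"

sublocale claws \<subseteq> ncm "2 * r" M
  using nc by unfold_locales

context claws
begin

abbreviation n where "n \<equiv> 2 * r"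
abbreviation s where "s \<equiv> num_claws r M"

definition shorts :: "nat set" where "shorts = {i \<in> {1..n}. partner i = wrap n (i + 1)}"

lemma finite_shorts [simp]: "finite shorts" by (simp add: shorts_def)

lemma wrap_in: "wrap n i \<in> {1..n}"
  using r_pos unfolding wrap_def by (auto simp: Suc_le_eq mod_greater_zero_iff_not_dvd intro: less_imp_le)

lemma short_arcs_eq: "short_arcs r M = sorted_list_of_set shorts"
proof -
  have "{i \<in> {1..n}. (i, wrap n (i + 1)) \<in> M \<or> (wrap n (i + 1), i) \<in> M} = shorts"
    unfolding shorts_def using partner_iff by blast
  then show ?thesis unfolding short_arcs_def by simp
qed

lemma s_eq: "s = card shorts"
  unfolding num_claws_def short_arcs_eq by simp

definition below :: "nat \<Rightarrow> nat" where "below w = card {i \<in> shorts. i < w}"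

lemma below_le: "below w \<le> s"
  unfolding below_def s_eq by (rule card_mono) auto

lemma below_mono: "v \<le> w \<Longrightarrow> below v \<le> below w"
  unfolding below_def by (rule card_mono) auto

lemma short_arcs_less: "j < s \<Longrightarrow> short_arcs r M ! j < w \<longleftrightarrow> j < below w"
  unfolding short_arcs_eq below_def s_eq by (rule sorted_list_of_set_nth_less) auto

text \<open>How many claws clockwise \<open>w\<close> lies after \<open>x\<close>.  The claw of \<open>x\<close> itself is split at \<open>x\<close> into the block
  \<open>0\<close> from \<open>x\<close> on and the block \<open>s\<close> before \<open>x\<close>, so that \<open>rho x\<close> is monotone in the distance from \<open>x\<close>.\<close>

definition rho :: "nat \<Rightarrow> nat \<Rightarrow> nat" where
  "rho x w = card {i \<in> shorts. dist x i < dist x w}"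

lemma rho_le: "rho x w \<le> s"
  unfolding rho_def s_eq by (rule card_mono) auto

lemma rho_self [simp]: "rho x x = 0"
  unfolding rho_def by simp

lemma rho_mono: "dist x v \<le> dist x w \<Longrightarrow> rho x v \<le> rho x w"
  unfolding rho_def by (rule card_mono) auto

lemma rho_less_dist: "rho x v < rho x w \<Longrightarrow> dist x v < dist x w"
  using rho_mono[of x w v] by (meson not_less)

lemma rho_below:
  assumes "x \<in> {1..n}" "w \<in> {1..n}"
  shows "rho x w = (if x \<le> w then below w - below x else below w + s - below x)"
proof (cases "x \<le> w")
  case True
  have sh: "i \<in> {1..n}" if "i \<in> shorts" for i using that by (auto simp: shorts_def)
  have "{i \<in> shorts. i < w} = {i \<in> shorts. i < x} \<union> {i \<in> shorts. dist x i < dist x w}"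
    using True cdist_less_iff[OF assms(1) sh assms(2)] by auto
  moreover have "{i \<in> shorts. i < x} \<inter> {i \<in> shorts. dist x i < dist x w} = {}"
    using True cdist_less_iff[OF assms(1) sh assms(2)] by auto
  ultimately have "below w = below x + rho x w"
    unfolding below_def rho_def by (simp add: card_Un_disjoint)
  then show ?thesis using True by simp
next
  case False
  have sh: "i \<in> {1..n}" if "i \<in> shorts" for i using that by (auto simp: shorts_def)
  have "shorts \<union> {i \<in> shorts. i < w} = shorts" by auto
  have "rho x w = card (({i \<in> shorts. \<not> i < x}) \<union> {i \<in> shorts. i < w})"
    unfolding rho_def using False cdist_less_iff[OF assms(1) sh assms(2)]
    by (intro arg_cong[where f = card]) auto
  also have "\<dots> = card {i \<in> shorts. \<not> i < x} + below w"
    unfolding below_def using False by (intro card_Un_disjoint) auto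
  also have "card {i \<in> shorts. \<not> i < x} = s - below x"
  proof -
    have "{i \<in> shorts. \<not> i < x} = shorts - {i \<in> shorts. i < x}" by auto
    then show ?thesis unfolding s_eq below_def by (simp add: card_Diff_subset)
  qed
  finally show ?thesis using False below_le[of x] by simp
qed

text \<open>Induction on the length of the arc: if the point \<open>u\<close> after \<open>w\<close>
  is not the partner of \<open>w\<close>, then noncrossing puts the arc of \<open>u\<close> inside
  that of \<open>w\<close>, where it is shorter.\<close>

lemma ex_short:
  assumes x: "x \<in> {1..n}" and "w \<in> {1..n}" "opener x w"
  shows "\<exists>i\<in>shorts. dist x w \<le> dist x i \<and> dist x i < dist x (partner w)"
  using assms(2,3)
proof (induction "dist x (partner w) - dist x w" arbitrary: w rule: less_induct)
  case less
  note pw = partner_in[OF less.prems(1)]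
  have lt: "dist x w < dist x (partner w)" using less.prems by (simp add: opener_def)
  define u where "u = wrap n (w + 1)"
  have u: "u \<in> {1..n}" unfolding u_def by (rule wrap_in)
  \<comment> \<open>The step to \<open>u\<close> does not pass the cut, because
    \<open>partner w\<close> is still ahead of \<open>w\<close> when seen from
    \<open>x\<close>.\<close>
  have du: "dist x u = dist x w + 1"
  proof (cases "w = n")
    case True
    have "\<not> n dvd n + 1" using r_pos by (simp only: dvd_add_triv_left_iff) auto
    then have u1: "u = 1" using True r_pos unfolding u_def wrap_def by (auto simp: mod_Suc)
    have "\<not> x = 1" using lt pw x less.prems True by (auto simp: cdist_def split: if_splits)
    then show ?thesis using u1 True x by (auto simp: cdist_def)
  next
    case False
    then have u1: "u = w + 1" using less.prems unfolding u_def wrap_def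
      by (cases "w + 1 = n") (auto dest: dvd_imp_le)
    have "\<not> x = w + 1"
      using lt pw x less.prems by (auto simp: cdist_def split: if_splits)
    then show ?thesis using u1 less.prems(1) x by (auto simp: cdist_def)
  qed
  show ?case
  proof (cases "partner w = u")
    case True
    then show ?thesis using less.prems lt unfolding shorts_def u_def by (intro bexI[of _ w]) auto
  next
    case False
    then have "dist x u \<noteq> dist x (partner w)" using cdist_inj[OF x u pw] by blast
    then have lu: "dist x w < dist x u" "dist x u < dist x (partner w)" using du lt by auto
    have pu: "dist x w < dist x (partner u)" "dist x (partner u) < dist x (partner w)"
      using noncross[OF x less.prems(1) u lu] by auto
    have "dist x (partner u) \<noteq> dist x u" using cdist_inj[OF x partner_in[OF u] u] partner_neq[OF u] by blast
    then have op: "opener x u" unfolding opener_def using pu du by linarith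
    have "dist x (partner u) - dist x u < dist x (partner w) - dist x w" using lu pu by linarith
    from less.hyps[OF this u op] show ?thesis using lu pu by (meson less_imp_le less_trans order_trans)
  qed
qed

text \<open>A short arc starts at or after \<open>w\<close> and before \<open>partner w\<close>, and
  that start is the end of a claw; so the last end of an arc always lies in a later block than the
  first.\<close>

lemma rho_opener:
  assumes "x \<in> {1..n}" "w \<in> {1..n}" "opener x w"
  shows "rho x w < rho x (partner w)"
proof -
  obtain i where i: "i \<in> shorts" "dist x w \<le> dist x i" "dist x i < dist x (partner w)"
    using ex_short[OF assms] by blast
  have "{i \<in> shorts. dist x i < dist x w} \<subseteq> {i \<in> shorts. dist x i < dist x (partner w)}"
    using i by auto
  moreover have "i \<notin> {i \<in> shorts. dist x i < dist x w}" "i \<in> {i \<in> shorts. dist x i < dist x (partner w)}"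
    using i by auto
  ultimately have "{i \<in> shorts. dist x i < dist x w} \<subset> {i \<in> shorts. dist x i < dist x (partner w)}"
    by blast
  then show ?thesis unfolding rho_def by (intro psubset_card_mono) auto
qed

lemma s_pos: "0 < s"
proof -
  have "1 \<in> {1..n}" using r_pos by simp
  from rho_opener[OF this this opener_self[OF this]] rho_le[of 1 "partner 1"] show ?thesis by simp
qed

text \<open>Indices of claws start at 0, while points of the first claw already have one short arc
  below them. The last claw passes over \<open>n\<close>: it consists of the points with
  \<open>below w = s\<close> and those with \<open>below w = 0\<close>.\<close>

definition claw_of :: "nat \<Rightarrow> nat" where
  "claw_of w = (if below w = 0 then s - 1 else below w - 1)"

lemma claw_of_less [simp]: "claw_of w < s"
  using s_pos below_le[of w] unfolding claw_of_def by auto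

lemma mod_eqI: "v + k * m = u \<Longrightarrow> v < m \<Longrightarrow> u mod m = v" for u v m k :: nat
  by auto

lemma claw_of_rho:
  assumes "x \<in> {1..n}" "w \<in> {1..n}"
  shows "claw_of w = (claw_of x + rho x w) mod s"
proof -
  have s: "0 < s" by (rule s_pos)
  have b: "below w \<le> s" "below x \<le> s" by (rule below_le)+
  have m: "x \<le> w \<Longrightarrow> below x \<le> below w" "\<not> x \<le> w \<Longrightarrow> below w \<le> below x" using below_mono by auto
  have "claw_of w + k * s = claw_of x + rho x w \<Longrightarrow> claw_of w = (claw_of x + rho x w) mod s" for k
    using claw_of_less[of w] mod_eqI[of "claw_of w" k s "claw_of x + rho x w"] by simp
  note this[of 0] this[of 1]
  moreover have "claw_of w + 0 * s = claw_of x + rho x w \<or> claw_of w + 1 * s = claw_of x + rho x w"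
    using s b m unfolding claw_of_def rho_below[OF assms] by (auto split: if_splits)
  ultimately show ?thesis by blast
qed

text \<open>Going once round the circle passes each of the \<open>s\<close> ends of claws
  once.\<close>

lemma rho_antisym:
  assumes "x \<in> {1..n}" "w \<in> {1..n}" "x \<noteq> w"
  shows "rho x w + rho w x = s"
  unfolding rho_below[OF assms(1,2)] rho_below[OF assms(2,1)]
  using assms(3) below_le[of w] below_le[of x] below_mono[of x w] below_mono[of w x] by auto

text \<open>Seen from either end of the arc, the other end lies in a later block. The two positive
  block numbers add up to \<open>s\<close>, so each is strictly below \<open>s\<close> and shifting
  by it modulo \<open>s\<close> has no fixed claw.\<close>

lemma claw_of_partner:
  assumes w: "w \<in> {1..n}" shows "claw_of w \<noteq> claw_of (partner w)"
proof
  assume eq: "claw_of w = claw_of (partner w)"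
  have p: "partner w \<in> {1..n}" "partner w \<noteq> w" using w partner_in partner_neq by auto
  have "0 < rho w (partner w)" using rho_opener[OF w w opener_self[OF w]] by simp
  moreover have "0 < rho (partner w) w"
    using rho_opener[OF p(1) p(1) opener_self[OF p(1)]] partner_partner[OF w] by simp
  ultimately have l: "0 < rho w (partner w)" "rho w (partner w) < s"
    using rho_antisym[OF w p(1)] p(2) by auto
  have "(claw_of w + rho w (partner w)) mod s = claw_of w" using claw_of_rho[OF w p(1)] eq by simp
  then show False using l claw_of_less[of w]
      mod_eqI[of "claw_of w + rho w (partner w) - s" 1 s "claw_of w + rho w (partner w)"]
    by (cases "claw_of w + rho w (partner w) < s") auto
qed

lemma two_le_s: "2 \<le> s"
proof -
  have "1 \<in> {1..n}" using r_pos by simp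
  from claw_of_partner[OF this] claw_of_less[of 1] claw_of_less[of "partner 1"] show ?thesis by linarith
qed

lemma short_in: "j < s \<Longrightarrow> short_arcs r M ! j \<in> {1..n}"
  using nth_mem[of j "short_arcs r M"] unfolding num_claws_def short_arcs_eq by (auto simp: shorts_def)

lemma claw_eq:
  assumes "j < s"
  shows "claw r M j = (if j + 1 < s then [short_arcs r M ! j + 1..<short_arcs r M ! (j + 1) + 1]
    else [short_arcs r M ! j + 1..<n + 1] @ [1..<short_arcs r M ! 0 + 1])"
proof (cases "j + 1 < s")
  case True
  have "sorted_wrt (<) (short_arcs r M)" unfolding short_arcs_eq by simp
  then have "short_arcs r M ! j < short_arcs r M ! (j + 1)"
    using True unfolding num_claws_def by (intro sorted_wrt_nth_less) auto
  then show ?thesis using True by (simp add: claw_def cyc_interval_def)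
next
  case False
  then have j: "j + 1 = s" using assms by simp
  have "\<not> short_arcs r M ! j < short_arcs r M ! 0"
    using short_arcs_less[of j "short_arcs r M ! 0"] short_arcs_less[of 0 "short_arcs r M ! 0"] assms s_pos by auto
  then show ?thesis using j by (simp add: claw_def cyc_interval_def)
qed

lemma claw_mem:
  assumes "j < s"
  shows "w \<in> set (claw r M j) \<longleftrightarrow> w \<in> {1..n} \<and> claw_of w = j"
proof -
  note lt = short_arcs_less[OF assms] short_arcs_less[of "j + 1"] short_arcs_less[of 0]
  note i = short_in[OF assms] short_in[of "j + 1"] short_in[of 0]
  show ?thesis
  proof (cases "j + 1 < s")
    case True
    have "w \<in> set (claw r M j) \<longleftrightarrow> short_arcs r M ! j < w \<and> \<not> short_arcs r M ! (j + 1) < w"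
      using claw_eq[OF assms] True by auto
    also have "\<dots> \<longleftrightarrow> w \<in> {1..n} \<and> claw_of w = j"
      using lt[of w] i True assms unfolding claw_of_def by (auto split: if_splits)
    finally show ?thesis .
  next
    case False
    then have j: "j + 1 = s" using assms by simp
    have "w \<in> set (claw r M j) \<longleftrightarrow> w \<in> {1..n} \<and> (short_arcs r M ! j < w \<or> \<not> short_arcs r M ! 0 < w)"
      using claw_eq[OF assms] False i(1,3) s_pos by auto
    also have "\<dots> \<longleftrightarrow> w \<in> {1..n} \<and> claw_of w = j"
      using lt(1,3)[of w] j s_pos below_le[of w] unfolding claw_of_def by (auto split: if_splits)
    finally show ?thesis .
  qed
qed

section \<open>The order of the points inside a claw\<close>

lemma claw_order:
  assumes "j < s" "k < l" "l < length (claw r M j)"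
  shows "let v = claw r M j ! k; w = claw r M j ! l in
    v < w \<and> below v = below w \<or> w < v \<and> below v = s \<and> below w = 0"
proof -
  note lt = short_arcs_less[OF assms(1)] short_arcs_less[of "j + 1"] short_arcs_less[of 0]
  let ?v = "claw r M j ! k" and ?w = "claw r M j ! l"
  have vw: "?v \<in> set (claw r M j)" "?w \<in> set (claw r M j)" using assms by auto
  show ?thesis
  proof (cases "j + 1 < s")
    case True
    have "sorted_wrt (<) (claw r M j)" unfolding claw_eq[OF assms(1)] if_P[OF True] by (rule sorted_wrt_upt)
    then have "?v < ?w" using assms(2,3) by (rule sorted_wrt_nth_less)
    moreover have "below ?v = j + 1" "below ?w = j + 1"
      using vw claw_mem[OF assms(1)] True unfolding claw_of_def by (auto split: if_splits)
    ultimately show ?thesis by simp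
  next
    case False
    then have j: "j + 1 = s" using assms by simp
    \<comment> \<open>The list of the last claw passes over \<open>n\<close>: first come the
      \<open>n - ?a\<close> points after the last short arc, then the points from 1 to
      \<open>?b\<close>.\<close>
    let ?a = "short_arcs r M ! j" and ?b = "short_arcs r M ! 0"
    have c: "claw r M j = [?a + 1..<n + 1] @ [1..<?b + 1]" using claw_eq[OF assms(1)] False by simp
    have A: "below u = s" if "?a < u" for u using that lt(1)[of u] j below_le[of u] by simp
    have B: "below u = 0" if "u \<le> ?b" for u using that lt(3)[of u] s_pos by simp
    have ab: "?b \<le> ?a" using A[of "?b"] B[of ?b] s_pos by (cases "?a < ?b") auto
    consider "l < n - ?a" | "k < n - ?a" "n - ?a \<le> l" | "n - ?a \<le> k" by linarith
    then show ?thesis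
    proof cases
      case 1
      then have "?v = ?a + 1 + k" "?w = ?a + 1 + l" using assms(2) unfolding c by (auto simp: nth_append simp del: upt_Suc)
      then show ?thesis using A assms(2) by (simp add: Let_def)
    next
      case 2
      then have "?v = ?a + 1 + k" "?w = 1 + (l - (n - ?a))" "l - (n - ?a) < ?b"
        using assms(3) unfolding c by (auto simp: nth_append simp del: upt_Suc)
      then show ?thesis using A B ab by (simp add: Let_def)
    next
      case 3
      then have "?v = 1 + (k - (n - ?a))" "?w = 1 + (l - (n - ?a))" "l - (n - ?a) < ?b"
        using assms(2,3) unfolding c by (auto simp: nth_append simp del: upt_Suc)
      moreover have "k - (n - ?a) < l - (n - ?a)" using assms(2) 3 by linarith
      ultimately show ?thesis using B by (simp add: Let_def)
    qed
  qed
qed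

lemma distinct_claw: "j < s \<Longrightarrow> distinct (claw r M j)"
  unfolding distinct_conv_nth
proof (intro allI impI)
  fix k l assume j: "j < s" and kl: "k < length (claw r M j)" "l < length (claw r M j)" "k \<noteq> l"
  show "claw r M j ! k \<noteq> claw r M j ! l"
    using claw_order[OF j, of k l] claw_order[OF j, of l k] kl by (cases k l rule: linorder_cases) (auto simp: Let_def)
qed

text \<open>The order of the claw lists, expressed relative to the cut. The second alternative
  concerns the claw of \<open>x\<close>: its list runs through block \<open>s\<close>, ends of the
  circle as seen from \<open>x\<close>, before it reaches \<open>x\<close> and block 0.\<close>

definition earlier :: "nat \<Rightarrow> nat \<Rightarrow> nat \<Rightarrow> bool" where
  "earlier x v w \<longleftrightarrow> rho x v = rho x w \<and> dist x v < dist x w \<or> rho x v = s \<and> rho x w = 0"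

lemma claw_order_earlier:
  assumes j: "j < s" and kl: "k < l" "l < length (claw r M j)" and x: "x \<in> {1..n}"
  shows "earlier x (claw r M j ! k) (claw r M j ! l)"
proof -
  let ?v = "claw r M j ! k" and ?w = "claw r M j ! l"
  have v: "?v \<in> {1..n}" and w: "?w \<in> {1..n}"
    using nth_mem[of k "claw r M j"] nth_mem[of l "claw r M j"] kl claw_mem[OF j] by auto
  have "?v < ?w \<and> below ?v = below ?w \<or> ?w < ?v \<and> below ?v = s \<and> below ?w = 0"
    using claw_order[OF j kl] by (simp add: Let_def)
  then show ?thesis
  proof
    assume A: "?v < ?w \<and> below ?v = below ?w"
    consider "x \<le> ?v" | "?v < x" "x \<le> ?w" | "?w < x" by linarith
    then show ?thesis
    proof cases
      case 2
      then have "below x = below ?w" using below_mono[of ?v x] below_mono[of x ?w] A by simp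
      then show ?thesis using 2 A unfolding earlier_def rho_below[OF x v] rho_below[OF x w] by simp
    qed (use A in \<open>simp_all add: earlier_def rho_below[OF x v] rho_below[OF x w] cdist_less_iff[OF x v w]\<close>)
  next
    assume B: "?w < ?v \<and> below ?v = s \<and> below ?w = 0"
    consider "x \<le> ?w" | "?w < x" "x \<le> ?v" | "?v < x" by linarith
    then show ?thesis
    proof cases
      case 1
      then have "below x = 0" using below_mono[of x ?w] B by simp
      then show ?thesis using 1 B unfolding earlier_def rho_below[OF x v] rho_below[OF x w] by simp
    next
      case 2
      then show ?thesis using B unfolding earlier_def rho_below[OF x v] rho_below[OF x w] cdist_less_iff[OF x v w] by simp
    next
      case 3
      then have "below x = s" using below_mono[of ?v x] below_le[of x] B by simp
      then show ?thesis using 3 B unfolding earlier_def rho_below[OF x v] rho_below[OF x w] by simp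
    qed
  qed
qed

lemma claw_nth_earlier:
  assumes j: "j < s" and l: "l < length (claw r M j)" and x: "x \<in> {1..n}"
  shows "l = card {v \<in> set (claw r M j). earlier x v (claw r M j ! l)}"
    and "length (claw r M j) - l - 1 = card {v \<in> set (claw r M j). earlier x (claw r M j ! l) v}"
proof -
  let ?c = "claw r M j"
  have asym: "\<not> earlier x w v" if "earlier x v w" for v w
    using that s_pos unfolding earlier_def by auto
  have iff: "earlier x (?c ! k) (?c ! k') \<longleftrightarrow> k < k'" if "k < length ?c" "k' < length ?c" for k k'
    using claw_order_earlier[OF j _ _ x, of k k'] claw_order_earlier[OF j _ _ x, of k' k] asym that s_pos
    by (cases k k' rule: linorder_cases) (auto simp: earlier_def)
  have inj: "inj_on ((!) ?c) {..<length ?c}" using distinct_claw[OF j] by (intro inj_on_nth) auto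
  have set: "set ?c = (!) ?c ` {..<length ?c}"
    by (metis list.set_map map_nth atLeast_upt set_upt lessThan_atLeast0)
  have "{v \<in> set ?c. earlier x v (?c ! l)} = (!) ?c ` {..<l}"
    unfolding set using iff l by auto
  then show "l = card {v \<in> set ?c. earlier x v (?c ! l)}"
    using card_image[OF inj_on_subset[OF inj]] l by auto
  have "{v \<in> set ?c. earlier x (?c ! l) v} = (!) ?c ` {l+1..<length ?c}"
    unfolding set using iff l by auto
  moreover have "inj_on ((!) ?c) {l+1..<length ?c}" by (rule inj_on_subset[OF inj]) auto
  ultimately show "length ?c - l - 1 = card {v \<in> set ?c. earlier x (?c ! l) v}"
    by (simp add: card_image)
qed

lemma rho_claw_eq:
  assumes "x \<in> {1..n}" "v \<in> {1..n}" "w \<in> {1..n}" "rho x v = rho x w"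
  shows "claw_of v = claw_of w"
  using claw_of_rho[OF assms(1,2)] claw_of_rho[OF assms(1,3)] assms(4) by simp

text \<open>Partners lie in other blocks: that of an opener in a later one, that of a closer in an
  earlier one. An opener followed by a closer in one block would therefore belong to crossing
  arcs.\<close>

lemma closers_first:
  assumes x: "x \<in> {1..n}" and v: "v \<in> {1..n}" and w: "w \<in> {1..n}"
    and eq: "rho x v = rho x w" and lt: "dist x v < dist x w" and ov: "opener x v"
  shows "opener x w"
proof (rule ccontr)
  assume cw: "\<not> opener x w"
  have pw: "partner w \<in> {1..n}" and pp: "partner (partner w) = w" using w partner_in partner_partner by auto
  have opw: "opener x (partner w)" using opener_partner[OF x w] cw by simp
  have "rho x v < rho x (partner v)" using rho_opener[OF x v ov] .
  then have 1: "dist x w < dist x (partner v)" using rho_less_dist eq by simp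
  have "rho x (partner w) < rho x w" using rho_opener[OF x pw opw] pp by simp
  then have 2: "dist x (partner w) < dist x v" using rho_less_dist eq by simp
  show False using noncross[OF x pw v 2] lt 1 pp by simp
qed

text \<open>The points of the block listed before a closer are closers as well, so its index in the
  claw continues the count of closers in earlier blocks. \<open>0 < rho x y\<close> holds since its
  partner comes in an earlier block; hence if \<open>y\<close> lies in the claw of \<open>x\<close>,
  it is in block \<open>s\<close>, which is listed first.\<close>

lemma closer_position:
  assumes x: "x \<in> {1..n}" and y: "y \<in> closers x" and j: "j < s" "l < length (claw r M j)" "claw r M j ! l = y"
  shows "crank x y = l + card {v \<in> closers x. rho x v < rho x y}"
proof -
  have y': "y \<in> {1..n}" "\<not> opener x y" using y by (auto simp: closers_def)
  have cj: "claw_of y = j" using nth_mem[OF j(2)] j claw_mem[OF j(1)] by auto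
  have py: "partner y \<in> {1..n}" using y' partner_in by blast
  have pos: "0 < rho x y" using rho_opener[OF x py] opener_partner[OF x y'(1)] y' partner_partner[OF y'(1)] by simp
  have "{v \<in> closers x. dist x v < dist x y} =
      {v \<in> closers x. rho x v < rho x y} \<union> {v \<in> set (claw r M j). earlier x v y}"
    (is "?L = ?A \<union> ?B")
  proof (intro set_eqI iffI)
    fix v assume "v \<in> ?L"
    then have v: "v \<in> closers x" "v \<in> {1..n}" "dist x v < dist x y" by (auto simp: closers_def)
    then have "rho x v \<le> rho x y" by (simp add: rho_mono)
    then show "v \<in> ?A \<union> ?B"
      using v rho_claw_eq[OF x v(2) y'(1)] cj claw_mem[OF j(1)] unfolding earlier_def
      by (cases "rho x v = rho x y") auto
  next
    fix v assume "v \<in> ?A \<union> ?B"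
    then show "v \<in> ?L"
    proof
      assume "v \<in> ?A"
      then show ?thesis using rho_less_dist by auto
    next
      assume "v \<in> ?B"
      then have v: "v \<in> {1..n}" "rho x v = rho x y" "dist x v < dist x y"
        using pos claw_mem[OF j(1)] unfolding earlier_def by auto
      then show ?thesis using closers_first[OF x v(1) y'(1) v(2,3)] y' by (auto simp: closers_def)
    qed
  qed
  moreover have "?A \<inter> ?B = {}" using pos by (auto simp: earlier_def)
  ultimately have "crank x y = card ?A + card ?B"
    unfolding crank_def by (simp add: card_Un_disjoint)
  then show ?thesis using claw_nth_earlier(1)[OF j(1,2) x] j(3) by simp
qed

text \<open>The index has to be counted from the end of the claw: the points listed after an opener
  are openers of the same block, whereas before it there may be closers and, in the claw of
  \<open>x\<close>, all of block \<open>s\<close>.\<close>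

lemma opener_position:
  assumes x: "x \<in> {1..n}" and y: "y \<in> openers x" and j: "j < s" "l < length (claw r M j)" "claw r M j ! l = y"
  shows "card {v \<in> openers x. rho x v \<le> rho x y} + l = orank x y + length (claw r M j)"
proof -
  have y': "y \<in> {1..n}" "opener x y" using y by (auto simp: openers_def)
  have cj: "claw_of y = j" using nth_mem[OF j(2)] j claw_mem[OF j(1)] by auto
  have pos: "rho x y < s" using rho_opener[OF x y'(1,2)] rho_le[of x "partner y"] by simp
  let ?C = "{v \<in> openers x. dist x v < dist x y}"
  have eq: "{v \<in> openers x. rho x v \<le> rho x y} = insert y ?C \<union> {v \<in> set (claw r M j). earlier x y v}"
    (is "?L = _ \<union> ?B")
  proof (intro set_eqI iffI)
    fix v assume "v \<in> ?L"
    then have v: "v \<in> openers x" "v \<in> {1..n}" "rho x v \<le> rho x y" by (auto simp: openers_def)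
    show "v \<in> insert y ?C \<union> ?B"
    proof (cases "dist x v < dist x y \<or> v = y")
      case False
      then have d: "dist x y < dist x v" using cdist_inj[OF x v(2) y'(1)] by fastforce
      then have "rho x v = rho x y" using v rho_mono[of x y v] by simp
      then show ?thesis using v d rho_claw_eq[OF x v(2) y'(1)] cj claw_mem[OF j(1)] unfolding earlier_def by auto
    qed (use v in auto)
  next
    fix v assume "v \<in> insert y ?C \<union> ?B"
    then consider "v = y" | "v \<in> ?C" | "v \<in> ?B" by blast
    then show "v \<in> ?L"
    proof cases
      case 2
      then show ?thesis by (simp add: rho_mono)
    next
      case 3
      then have v: "v \<in> {1..n}" "rho x v = rho x y" "dist x y < dist x v"
        using pos claw_mem[OF j(1)] unfolding earlier_def by auto
      then show ?thesis using closers_first[OF x y'(1) v(1) v(2)[symmetric] v(3)] y' by (auto simp: openers_def)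
    qed (use y in simp)
  qed
  have dis: "insert y ?C \<inter> ?B = {}" using pos by (auto simp: earlier_def)
  have "card ?L = Suc (card ?C) + card ?B"
    unfolding eq using dis by (subst card_Un_disjoint) auto
  then show ?thesis using claw_nth_earlier(2)[OF j(1,2) x] j unfolding orank_def by simp
qed

end

section \<open>Chords of a polygon\<close>

text \<open>The same clockwise distance, now used for polygon vertices, whose indices start at 0
  instead of 1.\<close>

lemma cdist_less_iff0:
  "j < m \<Longrightarrow> u < m \<Longrightarrow> v < m \<Longrightarrow>
    cdist m j u < cdist m j v \<longleftrightarrow> j \<le> u \<and> u < v \<or> v < j \<and> j \<le> u \<or> u < v \<and> v < j"
  unfolding cdist_def by auto

lemma cdist_less0: "j < m \<Longrightarrow> u < m \<Longrightarrow> cdist m j u < m"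
  unfolding cdist_def by auto

lemma cdist_add: "j < m \<Longrightarrow> p < m \<Longrightarrow> cdist m j ((j + p) mod m) = p"
  by (cases "j + p < m") (auto simp: cdist_def mod_if)

lemma add_cdist: "j < m \<Longrightarrow> u < m \<Longrightarrow> (j + cdist m j u) mod m = u"
  by (auto simp: cdist_def)

lemma cdist_inj0: "j < m \<Longrightarrow> u < m \<Longrightarrow> v < m \<Longrightarrow> cdist m j u = cdist m j v \<Longrightarrow> u = v"
  using add_cdist by metis

text \<open>\<open>crossing\<close> refers to the linear order of the indices. Alternation of the
  ends is invariant under rotation, so it can be tested with the distances from any vertex
  \<open>j\<close>.\<close>

lemma crossing_cdist:
  assumes j: "j < m" and b: "u < m" "v < m" "e < m" "f < m"
    and "cdist m j e < cdist m j u" "cdist m j u < cdist m j f" "cdist m j f < cdist m j v"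
  shows "crossing {u, v} {e, f}"
proof -
  have I: "crossing {a, c} {b, d}" "crossing {b, d} {a, c}" if "a < b" "b < c" "c < d" for a b c d :: nat
    using that unfolding crossing_def by blast+
  have comm: "{v, u} = {u, v}" "{f, e} = {e, f}" by auto
  consider "e < u" "u < f" "f < v" | "u < f" "f < v" "v < e" | "f < v" "v < e" "e < u" | "v < e" "e < u" "u < f"
    using assms(6-) unfolding cdist_less_iff0[OF j b(3,1)] cdist_less_iff0[OF j b(1,4)] cdist_less_iff0[OF j b(4,2)]
    by linarith
  then show ?thesis
  proof cases
    case 1 from I(2)[OF this] show ?thesis unfolding comm .
  next
    case 2 from I(1)[OF this] show ?thesis unfolding comm .
  next
    case 3 from I(2)[OF this] show ?thesis unfolding comm .
  next
    case 4 from I(1)[OF this] show ?thesis unfolding comm .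
  qed
qed

lemma cdist_rotation:
  assumes "j < m" "a < b" "b < c" "c < d" "d < m"
  shows "cdist m j a < cdist m j b \<and> cdist m j b < cdist m j c \<and> cdist m j c < cdist m j d \<or>
    cdist m j b < cdist m j c \<and> cdist m j c < cdist m j d \<and> cdist m j d < cdist m j a \<or>
    cdist m j c < cdist m j d \<and> cdist m j d < cdist m j a \<and> cdist m j a < cdist m j b \<or>
    cdist m j d < cdist m j a \<and> cdist m j a < cdist m j b \<and> cdist m j b < cdist m j c"
proof -
  consider "j \<le> a" | "a < j" "j \<le> b" | "b < j" "j \<le> c" | "c < j" "j \<le> d" | "d < j" by linarith
  then show ?thesis
  proof cases
    case 1 show ?thesis by (rule disjI1) (use 1 assms in \<open>auto simp: cdist_def\<close>)
  next
    case 2 show ?thesis by (rule disjI2, rule disjI1) (use 2 assms in \<open>auto simp: cdist_def\<close>)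
  next
    case 3 show ?thesis by (rule disjI2, rule disjI2, rule disjI1) (use 3 assms in \<open>auto simp: cdist_def\<close>)
  next
    case 4 show ?thesis by (rule disjI2, rule disjI2, rule disjI2) (use 4 assms in \<open>auto simp: cdist_def\<close>)
  next
    case 5 show ?thesis by (rule disjI1) (use 5 assms in \<open>auto simp: cdist_def\<close>)
  qed
qed

lemma crossing_cdistE:
  assumes j: "j < m" and "E \<subseteq> {..<m}" "F \<subseteq> {..<m}" and cr: "crossing E F"
  obtains p q p' q' where "E = {p, p'}" "F = {q, q'}"
    "cdist m j p < cdist m j q" "cdist m j q < cdist m j p'" "cdist m j p' < cdist m j q'"
  | p q p' q' where "E = {p, p'}" "F = {q, q'}"
    "cdist m j q < cdist m j p" "cdist m j p < cdist m j q'" "cdist m j q' < cdist m j p'"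
proof -
  obtain a b c d where o: "a < b" "b < c" "c < d"
    and sets: "E = {a, c} \<and> F = {b, d} \<or> E = {b, d} \<and> F = {a, c}"
    using cr unfolding crossing_def by blast
  have "d < m" using sets assms(2,3) by auto
  note rot = cdist_rotation[OF j o this]
  from sets show thesis
  proof
    assume "E = {a, c} \<and> F = {b, d}"
    then have S: "E = {a, c}" "F = {b, d}" "E = {c, a}" "F = {d, b}" by auto
    from rot show thesis
    proof (elim disjE conjE)
      assume "cdist m j a < cdist m j b" "cdist m j b < cdist m j c" "cdist m j c < cdist m j d"
      then show thesis by (rule that(1)[OF S(1) S(2)])
    next
      assume "cdist m j b < cdist m j c" "cdist m j c < cdist m j d" "cdist m j d < cdist m j a"
      then show thesis by (rule that(2)[OF S(3) S(2)])
    next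
      assume "cdist m j c < cdist m j d" "cdist m j d < cdist m j a" "cdist m j a < cdist m j b"
      then show thesis by (rule that(1)[OF S(3) S(4)])
    next
      assume "cdist m j d < cdist m j a" "cdist m j a < cdist m j b" "cdist m j b < cdist m j c"
      then show thesis by (rule that(2)[OF S(1) S(4)])
    qed
  next
    assume "E = {b, d} \<and> F = {a, c}"
    then have S: "E = {b, d}" "F = {a, c}" "E = {d, b}" "F = {c, a}" by auto
    from rot show thesis
    proof (elim disjE conjE)
      assume "cdist m j a < cdist m j b" "cdist m j b < cdist m j c" "cdist m j c < cdist m j d"
      then show thesis by (rule that(2)[OF S(1) S(2)])
    next
      assume "cdist m j b < cdist m j c" "cdist m j c < cdist m j d" "cdist m j d < cdist m j a"
      then show thesis by (rule that(1)[OF S(1) S(4)])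
    next
      assume "cdist m j c < cdist m j d" "cdist m j d < cdist m j a" "cdist m j a < cdist m j b"
      then show thesis by (rule that(2)[OF S(3) S(4)])
    next
      assume "cdist m j d < cdist m j a" "cdist m j a < cdist m j b" "cdist m j b < cdist m j c"
      then show thesis by (rule that(1)[OF S(3) S(2)])
    qed
  qed
qed

lemma crossing_cdistD:
  assumes "j < m" "u < m" "v < m" "e < m" "f < m"
    and cr: "crossing {u, v} {e, f}" and uv: "cdist m j u < cdist m j v"
  shows "cdist m j u < cdist m j e \<and> cdist m j e < cdist m j v \<and> (cdist m j f < cdist m j u \<or> cdist m j v < cdist m j f) \<or>
     cdist m j u < cdist m j f \<and> cdist m j f < cdist m j v \<and> (cdist m j e < cdist m j u \<or> cdist m j v < cdist m j e)"
proof -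
  have "{u, v} \<subseteq> {..<m}" "{e, f} \<subseteq> {..<m}" using assms by auto
  from assms(1) this cr show ?thesis
  proof (cases rule: crossing_cdistE)
    case (1 p q p' q')
    then have "u = p \<and> v = p'" "e = q \<and> f = q' \<or> e = q' \<and> f = q"
      using uv by (auto simp: doubleton_eq_iff)
    then show ?thesis using 1(3-5) by blast
  next
    case (2 p q p' q')
    then have "u = p \<and> v = p'" "e = q \<and> f = q' \<or> e = q' \<and> f = q"
      using uv by (auto simp: doubleton_eq_iff)
    then show ?thesis using 2(3-5) by blast
  qed
qed

section \<open>Weighted triangulations\<close>

locale fraser = claws +
  fixes D :: "nat set set"
  assumes D: "weighted_triangulation r M D"
begin

lemma D_triangulation: "D \<subseteq> chords s" "\<And>E F. E \<in> D \<Longrightarrow> F \<in> D \<Longrightarrow> \<not> crossing E F"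
    "\<And>E. E \<in> chords s \<Longrightarrow> (\<And>F. F \<in> D \<Longrightarrow> \<not> crossing E F) \<Longrightarrow> E \<in> D"
    "\<And>E. E \<in> chords s \<Longrightarrow> 0 < weight r M E \<Longrightarrow> E \<in> D"
  using D unfolding weighted_triangulation_def triangulation_def by blast+

lemma D_chord:
  assumes "{u, v} \<in> D" shows "u < s \<and> v < s \<and> u \<noteq> v"
proof -
  have "{u, v} \<subseteq> {0..<s}" "card {u, v} = 2" using D_triangulation(1) assms unfolding chords_def by blast+
  then show ?thesis by (cases "u = v") auto
qed

lemmas D_noncross = D_triangulation(2)

lemma D_cross:
  assumes "{u, v} \<in> D" "{e, f} \<in> D" "j < s"
    and "cdist s j e < cdist s j u" "cdist s j u < cdist s j f" "cdist s j f < cdist s j v"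
  shows False
  using crossing_cdist[OF assms(3) _ _ _ _ assms(4-6)] D_chord[OF assms(1)] D_chord[OF assms(2)]
    D_noncross[OF assms(1,2)] by blast

lemma D_maximal:
  assumes "u < s" "v < s" "u \<noteq> v"
    and "\<And>e f. {e, f} \<in> D \<Longrightarrow> e < s \<Longrightarrow> f < s \<Longrightarrow> \<not> crossing {u, v} {e, f}"
  shows "{u, v} \<in> D"
proof -
  have "{u, v} \<in> chords s" using assms(1-3) by (simp add: chords_def)
  moreover have "\<not> crossing {u, v} F" if "F \<in> D" for F
  proof -
    have "card F = 2" "F \<subseteq> {0..<s}"
      using that D_triangulation(1) unfolding chords_def by blast+
    then obtain e f where "F = {e, f}" "e < s" "f < s" by (auto simp: card_2_iff)
    then show ?thesis using assms(4) that by blast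
  qed
  ultimately show ?thesis using D_triangulation(3) by blast
qed

lemma finite_M: "finite M"
proof -
  have "M \<subseteq> {1..n} \<times> {1..n}"
  proof
    fix e assume "e \<in> M"
    then show "e \<in> {1..n} \<times> {1..n}" using M_bounds[of "fst e" "snd e"] by (cases e) auto
  qed
  then show ?thesis by (rule finite_subset) simp
qed

lemma weight_eq: "weight r M E = card {(a, b) \<in> M. {claw_of a, claw_of b} = E}"
proof -
  have "{(a, b) \<in> M. \<exists>j<s. \<exists>k<s. a \<in> set (claw r M j) \<and> b \<in> set (claw r M k) \<and> E = {j, k}}
     = {(a, b) \<in> M. {claw_of a, claw_of b} = E}"
  proof -
    have "(\<exists>j<s. \<exists>k<s. a \<in> set (claw r M j) \<and> b \<in> set (claw r M k) \<and> E = {j, k}) \<longleftrightarrow> {claw_of a, claw_of b} = E"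
      if "(a, b) \<in> M" for a b
    proof -
      have "a \<in> {1..n}" "b \<in> {1..n}" using M_bounds[OF that] by auto
      then have "a \<in> set (claw r M j) \<longleftrightarrow> claw_of a = j" "b \<in> set (claw r M j) \<longleftrightarrow> claw_of b = j"
        if "j < s" for j using that claw_mem by simp_all
      then have "(\<exists>j<s. \<exists>k<s. a \<in> set (claw r M j) \<and> b \<in> set (claw r M k) \<and> E = {j, k}) \<longleftrightarrow>
          (\<exists>j<s. \<exists>k<s. claw_of a = j \<and> claw_of b = k \<and> E = {j, k})"
        by (simp cong: conj_cong)
      then show ?thesis using claw_of_less[of a] claw_of_less[of b] by auto
    qed
    then show ?thesis by auto
  qed
  then show ?thesis unfolding weight_def by simp
qed

text \<open>The arc itself contributes to the weight of its chord, and chords of positive weight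
  belong to \<open>D\<close>. Hence arcs cross no chord of the triangulation.\<close>

lemma arc_chord:
  assumes "w \<in> {1..n}" shows "{claw_of w, claw_of (partner w)} \<in> D"
proof -
  have arc: "{claw_of a, claw_of b} \<in> D" if ab: "(a, b) \<in> M" for a b
  proof -
    have a: "a \<in> {1..n}" "partner a = b" using ab M_iff by auto
    have "0 < weight r M {claw_of a, claw_of b}"
      unfolding weight_eq using ab finite_M by (subst card_gt_0_iff) (auto intro: finite_subset[of _ M])
    moreover have "{claw_of a, claw_of b} \<in> chords s"
      using claw_of_partner[OF a(1)] a(2) by (simp add: chords_def)
    ultimately show ?thesis using D_triangulation(4) by blast
  qed
  show ?thesis
    using arc[of w "partner w"] arc[of "partner w" w] partner_iff[OF assms, of "partner w"]
    by (auto simp: insert_commute)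
qed

definition arcs_in :: "nat set \<Rightarrow> nat" where
  "arcs_in X = card {(a, b) \<in> M. claw_of a \<in> X \<and> claw_of b \<in> X}"

text \<open>Each arc has exactly one opener, wherever the circle is cut.\<close>

lemma arcs_in_openers:
  assumes x: "x \<in> {1..n}"
  shows "arcs_in X = card {w \<in> openers x. claw_of w \<in> X \<and> claw_of (partner w) \<in> X}"
proof -
  define f where "f w = (if w < partner w then (w, partner w) else (partner w, w))" for w
  define g where "g = (\<lambda>(a, b). if opener x a then a else b)"
  let ?A = "{w \<in> openers x. claw_of w \<in> X \<and> claw_of (partner w) \<in> X}"
  let ?B = "{(a, b) \<in> M. claw_of a \<in> X \<and> claw_of b \<in> X}"
  have "bij_betw f ?A ?B"
  proof (rule bij_betw_byWitness[where f' = g])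
    have fA: "f w \<in> ?B \<and> g (f w) = w" if "w \<in> ?A" for w
    proof -
      have w: "w \<in> {1..n}" "opener x w" using that by (auto simp: openers_def)
      then show ?thesis
        using that partner_in[OF w(1)] partner_partner[OF w(1)] partner_neq[OF w(1)] opener_partner[OF x w(1)]
        unfolding f_def g_def by (auto simp: M_iff)
    qed
    have gB: "g e \<in> ?A \<and> f (g e) = e" if "e \<in> ?B" for e
    proof -
      obtain a b where e: "e = (a, b)" by (cases e)
      have a: "a \<in> {1..n}" "a < b" "partner a = b" using that e M_iff by auto
      then show ?thesis
        using that e partner_in[OF a(1)] partner_partner[OF a(1)] opener_partner[OF x a(1)]
        unfolding f_def g_def openers_def by auto
    qed
    show "\<forall>a\<in>?A. g (f a) = a" using fA by (intro ballI) (rule conjunct2)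
    show "\<forall>a'\<in>?B. f (g a') = a'" using gB by (intro ballI) (rule conjunct2)
    show "f ` ?A \<subseteq> ?B" using fA by (intro image_subsetI) (rule conjunct1)
    show "g ` ?B \<subseteq> ?A" using gB by (intro image_subsetI) (rule conjunct1)
  qed
  then show ?thesis unfolding arcs_in_def by (simp add: bij_betw_same_card)
qed

text \<open>The arcs are sorted by their chords. Different chords have disjoint sets of arcs, and
  the chord of every arc is in \<open>D\<close>, so the sum over \<open>D\<close> misses no arc of
  the part cut off.\<close>

lemma corner_mult_arcs:
  assumes "\<And>w. w < s \<Longrightarrow> w \<in> cut_off (\<Delta> - {z}) z \<longleftrightarrow> w \<in> X"
  shows "corner_mult r M D \<Delta> z = arcs_in X"
proof -
  define C where "C = {E \<in> D. E \<subseteq> cut_off (\<Delta> - {z}) z}"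
  define P where "P E = {(a, b) \<in> M. {claw_of a, claw_of b} = E}" for E
  have "D \<subseteq> Pow {0..<s}" using D_triangulation(1) unfolding chords_def by blast
  then have finC: "finite C" unfolding C_def by (auto intro: finite_subset)
  have finP: "finite (P E)" for E unfolding P_def using finite_M by (rule finite_subset[rotated]) auto
  have "corner_mult r M D \<Delta> z = (\<Sum>E\<in>C. card (P E))"
    unfolding corner_mult_def C_def P_def weight_eq ..
  also have "\<dots> = card (\<Union>E\<in>C. P E)"
    by (rule card_UN_disjoint[symmetric]) (use finC finP in \<open>auto simp: P_def\<close>)
  also have "(\<Union>E\<in>C. P E) = {(a, b) \<in> M. claw_of a \<in> X \<and> claw_of b \<in> X}"
  proof -
    have "{claw_of a, claw_of b} \<in> D" if "(a, b) \<in> M" for a b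
      using arc_chord[of a] that M_iff by auto
    then show ?thesis unfolding C_def P_def using assms[OF claw_of_less] by auto
  qed
  finally show ?thesis unfolding arcs_in_def .
qed

lemma cut_off_cdist:
  assumes j: "j < s" "e < s" "f < s" "e \<noteq> j" and lt: "cdist s j e < cdist s j f" and w: "w < s"
  shows "w \<in> cut_off ({j, e, f} - {j}) j \<longleftrightarrow> cdist s j e \<le> cdist s j w \<and> cdist s j w \<le> cdist s j f"
proof -
  have fj: "f \<noteq> j" using lt by auto
  have eq: "{j, e, f} - {j} = {e, f}" using fj j by auto
  have ef: "e \<noteq> f" using lt by auto
  have mm: "Min {e, f} = (if e < f then e else f)" "Max {e, f} = (if e < f then f else e)" using ef by auto
  show ?thesis
    using lt fj j(4) ef w unfolding eq cut_off_def mm not_less[symmetric]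
    unfolding cdist_less_iff0[OF j(1,2,3)] cdist_less_iff0[OF j(1) w j(2)] cdist_less_iff0[OF j(1,3) w]
    by (cases "e < f") (simp_all, linarith+)
qed

lemma corner_mult_cdist:
  assumes "j < s" "e < s" "f < s" "e \<noteq> j" "cdist s j e < cdist s j f"
  shows "corner_mult r M D {j, e, f} j = arcs_in {w. w < s \<and> cdist s j e \<le> cdist s j w \<and> cdist s j w \<le> cdist s j f}"
  by (rule corner_mult_arcs) (use cut_off_cdist[OF assms] in simp)

text \<open>Neighbours are recorded by their clockwise distance from \<open>j\<close>, so that
  consecutive ones can be found by comparing numbers and wrapping over index 0 plays no
  part.\<close>

definition nbrs :: "nat \<Rightarrow> nat set" where
  "nbrs j = {p \<in> {1..<s}. {j, (j + p) mod s} \<in> D}"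

definition consec :: "nat \<Rightarrow> nat \<Rightarrow> nat \<Rightarrow> bool" where
  "consec j p q \<longleftrightarrow> p \<in> nbrs j \<and> q \<in> nbrs j \<and> p < q \<and> (\<forall>e. p < e \<and> e < q \<longrightarrow> e \<notin> nbrs j)"

lemma cdist_nbrs: "{j, e} \<in> D \<Longrightarrow> cdist s j e \<in> nbrs j"
  using D_chord[of j e] cdist_less0[of j s e] add_cdist[of j s e]
  unfolding nbrs_def by (auto simp: cdist_def)

lemma side_in_D:
  assumes "j < s" shows "{j, (j + 1) mod s} \<in> D"
proof (rule D_maximal)
  show "(j + 1) mod s < s" using s_pos by simp
  show "j \<noteq> (j + 1) mod s" using cdist_add[OF assms, of 1] two_le_s by force
  show "\<not> crossing {j, (j + 1) mod s} {e, f}" if "e < s" "f < s" for e f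
  proof
    assume "crossing {j, (j + 1) mod s} {e, f}"
    from crossing_cdistD[OF assms assms \<open>(j + 1) mod s < s\<close> that this]
    show False using cdist_add[OF assms, of 1] two_le_s by auto
  qed
qed (use assms in simp_all)

lemma one_nbrs: "j < s \<Longrightarrow> 1 \<in> nbrs j"
  using side_in_D two_le_s unfolding nbrs_def by auto

lemma last_nbrs: "j < s \<Longrightarrow> s - 1 \<in> nbrs j"
proof -
  assume j: "j < s"
  define i where "i = (j + (s - 1)) mod s"
  have "i < s" using s_pos unfolding i_def by simp
  moreover have "(i + 1) mod s = j"
    unfolding i_def using j s_pos by (simp add: mod_simps)
  ultimately have "{i, j} \<in> D" using side_in_D[of i] by simp
  then show ?thesis using two_le_s unfolding nbrs_def i_def by (auto simp: insert_commute)
qed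

lemma nbrs_cross:
  assumes "j < s" "p \<in> nbrs j" "{e, f} \<in> D" "e \<noteq> j"
    and "cdist s j e < p" "p < cdist s j f"
  shows False
proof -
  have p: "p < s" "{j, (j + p) mod s} \<in> D" using assms(2) by (auto simp: nbrs_def)
  have "cdist s j e \<noteq> 0"
    using cdist_inj0[OF assms(1) _ assms(1), of e] D_chord[OF assms(3)] assms(4) by auto
  then show False
    using D_cross[OF assms(3) p(2) assms(1)] cdist_add[OF assms(1) p(1)] assms(5,6) by auto
qed

text \<open>A neighbour of \<open>j\<close> strictly between would give a chord crossing the third
  side. Conversely, a chord of \<open>D\<close> crossing the third side has one end strictly
  between; its other end is either \<open>j\<close>, which contradicts consecutiveness, or such that
  the chord crosses one of the two sides at \<open>j\<close> (\<open>no\<close>). So maximality puts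
  the third side into \<open>D\<close>.\<close>

lemma triangle_iff_consec:
  assumes j: "j < s" and pq: "1 \<le> p" "p < q" "q < s"
  shows "{j, (j + p) mod s, (j + q) mod s} \<in> triangles D \<longleftrightarrow> consec j p q"
proof -
  let ?u = "(j + p) mod s" and ?v = "(j + q) mod s"
  have uv: "?u < s" "?v < s" "cdist s j ?u = p" "cdist s j ?v = q"
    using s_pos cdist_add[OF j] pq by auto
  have "cdist s j ?u \<noteq> cdist s j j" "cdist s j ?v \<noteq> cdist s j j" "cdist s j ?u \<noteq> cdist s j ?v"
    unfolding uv(3,4) cdist_self using pq by simp_all
  then have ne: "?u \<noteq> j" "?v \<noteq> j" "?u \<noteq> ?v" by metis+
  have tri: "{j, ?u, ?v} \<in> triangles D \<longleftrightarrow> {j, ?u} \<in> D \<and> {j, ?v} \<in> D \<and> {?u, ?v} \<in> D"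
    unfolding triangles_def using ne by (auto simp: insert_commute)
  show ?thesis
  proof
    assume "{j, ?u, ?v} \<in> triangles D"
    then have d: "{j, ?u} \<in> D" "{j, ?v} \<in> D" "{?u, ?v} \<in> D" using tri by auto
    have "e \<notin> nbrs j" if "p < e" "e < q" for e
      using nbrs_cross[OF j _ d(3) ne(1), of e] that uv by auto
    then show "consec j p q" unfolding consec_def nbrs_def using d pq by auto
  next
    assume c: "consec j p q"
    then have pn: "p \<in> nbrs j" and qn: "q \<in> nbrs j" and none: "\<And>e. p < e \<Longrightarrow> e < q \<Longrightarrow> e \<notin> nbrs j"
      unfolding consec_def by auto
    have no: False if "{e, f} \<in> D" "p < cdist s j e" "cdist s j e < q" "cdist s j f < p \<or> q < cdist s j f" for e f
    proof -
      have ef: "{f, e} \<in> D" using that(1) by (simp add: insert_commute)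
      have ej: "e \<noteq> j" using that by auto
      show False
      proof (cases "f = j")
        case True
        then show False using none[OF that(2,3)] cdist_nbrs[of j e] ef by simp
      next
        case False
        show False using nbrs_cross[OF j pn ef False] nbrs_cross[OF j qn that(1) ej] that by auto
      qed
    qed
    have "{?u, ?v} \<in> D"
    proof (rule D_maximal[OF uv(1,2) ne(3)])
      fix e f assume ef: "{e, f} \<in> D" "e < s" "f < s"
      have fe: "{f, e} \<in> D" using ef(1) by (simp add: insert_commute)
      show "\<not> crossing {?u, ?v} {e, f}"
      proof
        assume "crossing {?u, ?v} {e, f}"
        from crossing_cdistD[OF j uv(1,2) ef(2,3) this] show False
          using no[OF ef(1)] no[OF fe] pq uv by auto
      qed
    qed
    then show "{j, ?u, ?v} \<in> triangles D" using tri pn qn by (auto simp: nbrs_def)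
  qed
qed

end

section \<open>Strands at the vertices\<close>

lemma concat_map_filter:
  "(\<And>x. x \<in> set xs \<Longrightarrow> \<not> P x \<Longrightarrow> f x = []) \<Longrightarrow> concat (map f (filter P xs)) = concat (map f xs)"
  by (induction xs) auto

lemma concat_map_filter_if:
  "concat (map f (filter P xs)) = concat (map (\<lambda>x. if P x then f x else []) xs)"
  by (induction xs) auto

lemma concat_map_concat:
  "concat (map f (concat (map g xs))) = concat (map (\<lambda>x. concat (map f (g x))) xs)"
  by (induction xs) auto

lemma concat_map_single:
  assumes "distinct xs" "y \<in> set xs"
  shows "concat (map (\<lambda>x. if x = y then f x else []) xs) = f y"
  using assms
proof (induction xs)
  case (Cons x xs)
  have "concat (map (\<lambda>x. if x = y then f x else []) xs) = []" if "y \<notin> set xs" using that by (induction xs) auto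
  then show ?case using Cons by (cases "x = y") auto
qed simp

context fraser
begin

abbreviation G where "G \<equiv> fraser_graph r M D"

definition seg :: "nat \<Rightarrow> nat \<Rightarrow> nat \<Rightarrow> nat set" where
  "seg j p q = {w. w < s \<and> p \<le> cdist s j w \<and> cdist s j w \<le> q}"

lemma arcs_in_seg_single: "j < s \<Longrightarrow> arcs_in (seg j p p) = 0"
proof -
  assume j: "j < s"
  have "{(a, b) \<in> M. claw_of a \<in> seg j p p \<and> claw_of b \<in> seg j p p} = {}"
  proof -
    have False if "(a, b) \<in> M" "claw_of a \<in> seg j p p" "claw_of b \<in> seg j p p" for a b
    proof -
      have "cdist s j (claw_of a) = cdist s j (claw_of b)" using that by (auto simp: seg_def)
      then have "claw_of a = claw_of b" using cdist_inj0[OF j] by simp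
      moreover have "a \<in> {1..n}" "partner a = b" using that(1) M_iff by auto
      ultimately show False using claw_of_partner by blast
    qed
    then show ?thesis by auto
  qed
  then show ?thesis unfolding arcs_in_def by (simp only: card.empty)
qed

text \<open>Arcs not meeting \<open>j\<close> up to the vertex at distance \<open>p\<close>.  If that vertex is a neighbour of \<open>j\<close>, this is the
  number of strands at \<open>j\<close> that lie clockwise between the claw and the chord joining the two.\<close>

definition inner :: "nat \<Rightarrow> nat \<Rightarrow> nat" where "inner j p = arcs_in (seg j 1 p)"

text \<open>No arc crosses the chord from \<open>j\<close> to its neighbour at distance
  \<open>p\<close> (\<open>key\<close>), so each arc counted lies on one side of it; an arc on both
  sides would have both ends in one claw.\<close>

lemma inner_split:
  assumes j: "j < s" and p: "p \<in> nbrs j" and "p \<le> q"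
  shows "inner j q = inner j p + arcs_in (seg j p q)"
proof -
  have p1: "1 \<le> p" using p by (simp add: nbrs_def)
  let ?P = "\<lambda>X. {(a, b) \<in> M. claw_of a \<in> X \<and> claw_of b \<in> X}"
  let ?c = "\<lambda>a. cdist s j (claw_of a)"
  have fin: "finite (?P X)" for X using finite_M by (rule finite_subset[rotated]) auto
  have key: "\<not> (1 \<le> ?c a \<and> ?c a < p \<and> p < ?c b)" if "(a, b) \<in> M \<or> (b, a) \<in> M" for a b
  proof
    assume A: "1 \<le> ?c a \<and> ?c a < p \<and> p < ?c b"
    have "{claw_of a, claw_of b} \<in> D"
      using that arc_chord[of a] arc_chord[of b] M_iff by (auto simp: insert_commute)
    moreover have "claw_of a \<noteq> j" using A by auto
    ultimately show False using nbrs_cross[OF j p] A by blast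
  qed
  have "?P (seg j 1 q) = ?P (seg j 1 p) \<union> ?P (seg j p q)"
  proof (intro set_eqI iffI)
    fix e assume "e \<in> ?P (seg j 1 q)"
    then obtain a b where e: "e = (a, b)" "(a, b) \<in> M" "1 \<le> ?c a" "?c a \<le> q" "1 \<le> ?c b" "?c b \<le> q"
      by (auto simp: seg_def)
    have "?c a \<le> p \<and> ?c b \<le> p \<or> p \<le> ?c a \<and> p \<le> ?c b"
      using key[of a b] key[of b a] e by linarith
    then show "e \<in> ?P (seg j 1 p) \<union> ?P (seg j p q)" using e by (auto simp: seg_def)
  next
    fix e assume "e \<in> ?P (seg j 1 p) \<union> ?P (seg j p q)"
    then show "e \<in> ?P (seg j 1 q)" using p1 assms(3) by (auto simp: seg_def)
  qed
  moreover have "?P (seg j 1 p) \<inter> ?P (seg j p q) = ?P (seg j p p)"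
    using p1 assms(3) by (auto simp: seg_def)
  moreover have "?P (seg j p p) = {}"
    using arcs_in_seg_single[OF j, of p] fin unfolding arcs_in_def by simp
  ultimately show ?thesis unfolding inner_def arcs_in_def
    using card_Un_disjoint[OF fin fin] by simp
qed

lemma inner_one: "j < s \<Longrightarrow> inner j 1 = 0"
  unfolding inner_def by (rule arcs_in_seg_single)

lemma inner_mono: "p \<le> q \<Longrightarrow> inner j p \<le> inner j q"
  unfolding inner_def arcs_in_def using finite_M
  by (intro card_mono) (auto simp: seg_def intro: finite_subset[of _ M])

text \<open>An arc meets claw \<open>j\<close> in at most one end, so the arcs with an end there are
  as many as the points of the claw; \<open>inner j (s - 1)\<close> counts all other arcs.\<close>

lemma inner_last:
  assumes j: "j < s"
  shows "length (claw r M j) + inner j (s - 1) = r"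
proof -
  have one: "1 \<in> {1..n}" using r_pos by simp
  let ?O = "openers 1" and ?C = "closers 1"
  have seg: "claw_of w \<in> seg j 1 (s - 1) \<longleftrightarrow> claw_of w \<noteq> j" for w
    using cdist_less0[OF j claw_of_less, of w] cdist_inj0[OF j claw_of_less j, of w]
    by (auto simp: seg_def Suc_le_eq)
  have bij: "bij_betw partner {w \<in> ?O. claw_of (partner w) = j} {w \<in> ?C. claw_of w = j}"
    using bij_partner[OF one] by (auto simp: bij_betw_def intro: inj_on_subset)
  have "set (claw r M j) = {w \<in> ?O. claw_of w = j} \<union> {w \<in> ?C. claw_of w = j}"
    using claw_mem[OF j] by (auto simp: openers_def closers_def)
  moreover have "{w \<in> ?O. claw_of w = j} \<inter> {w \<in> ?C. claw_of w = j} = {}"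
    by (auto simp: openers_def closers_def)
  ultimately have "length (claw r M j) = card {w \<in> ?O. claw_of w = j} + card {w \<in> ?C. claw_of w = j}"
    using distinct_card[OF distinct_claw[OF j]] by (simp add: card_Un_disjoint)
  then have len: "length (claw r M j) = card {w \<in> ?O. claw_of w = j} + card {w \<in> ?O. claw_of (partner w) = j}"
    using bij_betw_same_card[OF bij] by simp
  have split: "?O = {w \<in> ?O. claw_of w = j} \<union> {w \<in> ?O. claw_of (partner w) = j}
    \<union> {w \<in> ?O. claw_of w \<in> seg j 1 (s - 1) \<and> claw_of (partner w) \<in> seg j 1 (s - 1)}"
    (is "_ = ?A \<union> ?B \<union> ?E") unfolding seg by auto
  have "card (?A \<union> ?B \<union> ?E) = card {w \<in> ?O. claw_of w = j} + card {w \<in> ?O. claw_of (partner w) = j}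
    + card {w \<in> ?O. claw_of w \<in> seg j 1 (s - 1) \<and> claw_of (partner w) \<in> seg j 1 (s - 1)}"
  proof -
    have "{w \<in> ?O. claw_of w = j} \<inter> {w \<in> ?O. claw_of (partner w) = j} = {}"
      using claw_of_partner unfolding openers_def by fastforce
    moreover have "({w \<in> ?O. claw_of w = j} \<union> {w \<in> ?O. claw_of (partner w) = j}) \<inter>
       {w \<in> ?O. claw_of w \<in> seg j 1 (s - 1) \<and> claw_of (partner w) \<in> seg j 1 (s - 1)} = {}"
      unfolding seg by auto
    ultimately show ?thesis by (simp add: card_Un_disjoint)
  qed
  then have "card ?O = card ?A + card ?B + card ?E" unfolding split[symmetric] .
  then show ?thesis
    using card_openers(1)[OF one] len unfolding inner_def arcs_in_openers[OF one] by linarith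
qed

definition block :: "nat \<Rightarrow> nat set \<Rightarrow> (fedge \<times> nat) list" where
  "block j \<Delta> = map (Pair (White j, Black \<Delta>)) [0..<corner_mult r M D \<Delta> j]"

text \<open>All candidates for a triangle at \<open>j\<close> whose first side clockwise ends at
  distance \<open>p\<close>, in the order of \<open>triangles_at\<close>. At most one of them is in
  \<open>D\<close>, the one spanned with the next neighbour.\<close>

definition fan :: "nat \<Rightarrow> nat \<Rightarrow> (fedge \<times> nat) list" where
  "fan j p = concat (map (\<lambda>q. let \<Delta> = {j, (j + p) mod s, (j + q) mod s} in
     if \<Delta> \<in> triangles D then block j \<Delta> else []) [p + 1..<s])"

lemma triangles_at_elem: "\<Delta> \<in> set (triangles_at s D j) \<Longrightarrow> \<Delta> \<in> triangles D \<and> j \<in> \<Delta>"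
  unfolding triangles_at_def by auto

lemma white_strands:
  assumes j: "j < s"
  shows "strands_at G (White j) =
    map (\<lambda>k. ((White j, Boundary k), 0)) (claw r M j) @ concat (map (fan j) [1..<s])"
proof -
  let ?f = "\<lambda>e. map (Pair e) [0..<fmult r M D e]"
  let ?L = "map (\<lambda>k. (White j, Boundary k)) (claw r M j) @ map (\<lambda>\<Delta>. (White j, Black \<Delta>)) (triangles_at s D j)"
  have wv: "White j \<in> fverts r M D" using j by (simp add: fverts_def)
  have "?f e = []" if "e \<in> set ?L" "e \<notin> fedges r M D" for e
  proof -
    have "e \<in> fverts r M D \<times> fverts r M D"
      using that(1) wv claw_mem[OF j] triangles_at_elem by (auto simp: fverts_def)
    then show ?thesis using that(2) by (simp add: fedges_def)
  qed
  then have "concat (map ?f (filter (\<lambda>e. e \<in> fedges r M D) ?L)) = concat (map ?f ?L)"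
    by (rule concat_map_filter)
  then have "strands_at G (White j) = concat (map ?f ?L)"
    unfolding strands_at_def fraser_graph_def by simp
  also have "\<dots> = concat (map (\<lambda>k. ?f (White j, Boundary k)) (claw r M j)) @
      concat (map (\<lambda>\<Delta>. ?f (White j, Black \<Delta>)) (triangles_at s D j))" by (simp add: comp_def)
  also have "concat (map (\<lambda>k. ?f (White j, Boundary k)) (claw r M j)) = map (\<lambda>k. ((White j, Boundary k), 0)) (claw r M j)"
  proof -
    have "map (\<lambda>k. ?f (White j, Boundary k)) (claw r M j) = map (\<lambda>k. [((White j, Boundary k), 0)]) (claw r M j)"
      by (rule map_cong) simp_all
    then show ?thesis by (simp only: concat_map_singleton)
  qed
  also have "concat (map (\<lambda>\<Delta>. ?f (White j, Black \<Delta>)) (triangles_at s D j)) =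
      concat (map (block j) (triangles_at s D j))"
    using triangles_at_elem[of _ j]
    by (intro arg_cong[where f = concat] map_cong) (auto simp: block_def)
  also have "\<dots> = concat (map (fan j) [1..<s])"
    unfolding triangles_at_def fan_def Let_def concat_map_filter_if concat_map_concat
    by (simp add: comp_def)
  finally show ?thesis .
qed

lemma fan_consec:
  assumes j: "j < s" and c: "consec j p q"
  shows "fan j p = block j {j, (j + p) mod s, (j + q) mod s}"
    and "corner_mult r M D {j, (j + p) mod s, (j + q) mod s} j = arcs_in (seg j p q)"
proof -
  have pq: "p \<in> nbrs j" "q \<in> nbrs j" "1 \<le> p" "p < q" "q < s" using c by (auto simp: consec_def nbrs_def)
  have tri: "{j, (j + p) mod s, (j + q') mod s} \<in> triangles D \<longleftrightarrow> q' = q" if "q' \<in> set [p + 1..<s]" for q'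
  proof -
    have "consec j p q' \<longleftrightarrow> q' = q"
      using c unfolding consec_def by (cases q' q rule: linorder_cases) auto
    then show ?thesis using triangle_iff_consec[OF j pq(3), of q'] that by simp
  qed
  have "fan j p = concat (map (\<lambda>q'. if q' = q then block j {j, (j + p) mod s, (j + q') mod s} else []) [p + 1..<s])"
    unfolding fan_def Let_def by (intro arg_cong[where f = concat] map_cong) (use tri in simp_all)
  also have "\<dots> = block j {j, (j + p) mod s, (j + q) mod s}"
    by (rule concat_map_single) (use pq in auto)
  finally show "fan j p = block j {j, (j + p) mod s, (j + q) mod s}" .
  have uv: "cdist s j ((j + p) mod s) = p" "cdist s j ((j + q) mod s) = q"
    using cdist_add[OF j] pq by auto
  have "cdist s j ((j + p) mod s) \<noteq> cdist s j j" unfolding uv using pq by simp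
  then have "(j + p) mod s \<noteq> j" by metis
  then show "corner_mult r M D {j, (j + p) mod s, (j + q) mod s} j = arcs_in (seg j p q)"
    using corner_mult_cdist[OF j, of "(j + p) mod s" "(j + q) mod s"] s_pos uv pq unfolding seg_def by simp
qed

lemma fan_nil:
  assumes j: "j < s" and p: "p \<notin> nbrs j \<or> p = s - 1" "1 \<le> p"
  shows "fan j p = []"
proof (cases "p = s - 1")
  case False
  have "{j, (j + p) mod s, (j + q) mod s} \<notin> triangles D" if "q \<in> set [p + 1..<s]" for q
    using triangle_iff_consec[OF j p(2), of q] that p False by (simp add: consec_def)
  then have "fan j p = concat (map (\<lambda>q. []) [p + 1..<s])"
    unfolding fan_def Let_def by (intro arg_cong[where f = concat] map_cong) simp_all
  then show ?thesis by simp
qed (use two_le_s in \<open>simp add: fan_def\<close>)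

definition next_nbr :: "nat \<Rightarrow> nat \<Rightarrow> nat" where "next_nbr j p = (LEAST q. p \<le> q \<and> q \<in> nbrs j)"

lemma next_nbr:
  assumes "j < s" "p < s"
  shows "p \<le> next_nbr j p" "next_nbr j p \<in> nbrs j" "\<And>q. p \<le> q \<Longrightarrow> q \<in> nbrs j \<Longrightarrow> next_nbr j p \<le> q"
proof -
  have ex: "p \<le> s - 1 \<and> s - 1 \<in> nbrs j" using last_nbrs assms by auto
  from LeastI[of "\<lambda>q. p \<le> q \<and> q \<in> nbrs j", OF ex]
  show "p \<le> next_nbr j p" "next_nbr j p \<in> nbrs j" unfolding next_nbr_def by auto
  show "\<And>q. p \<le> q \<Longrightarrow> q \<in> nbrs j \<Longrightarrow> next_nbr j p \<le> q" unfolding next_nbr_def by (rule Least_le) simp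
qed

lemma next_nbr_self: "j < s \<Longrightarrow> p \<in> nbrs j \<Longrightarrow> next_nbr j p = p"
  using next_nbr[of j p] by (auto simp: nbrs_def intro: antisym)

lemma consec_next: "j < s \<Longrightarrow> p \<in> nbrs j \<Longrightarrow> p + 1 < s \<Longrightarrow> consec j p (next_nbr j (p + 1))"
  using next_nbr[of j "p + 1"] unfolding consec_def by (auto simp: Suc_le_eq dest: leD)

text \<open>A distance that belongs to no neighbour contributes an empty fan and does not change
  \<open>next_nbr\<close>; a neighbour contributes the arcs cut off up to the next one, by which
  \<open>inner\<close> grows.\<close>

lemma length_fans:
  assumes j: "j < s"
  shows "1 \<le> p \<Longrightarrow> p < s \<Longrightarrow> length (concat (map (fan j) [1..<p])) = inner j (next_nbr j p)"
proof (induction p rule: dec_induct)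
  case base
  then show ?case using next_nbr_self[OF j one_nbrs[OF j]] inner_one[OF j] by simp
next
  case (step p)
  have len: "length (concat (map (fan j) [1..<Suc p])) = inner j (next_nbr j p) + length (fan j p)"
    using step by simp
  have p1: "p + 1 < s" using step by simp
  show ?case
  proof (cases "p \<in> nbrs j")
    case True
    note c = consec_next[OF j True p1]
    have "length (fan j p) = arcs_in (seg j p (next_nbr j (p + 1)))"
      using fan_consec[OF j c] by (simp add: block_def)
    moreover have "p \<le> next_nbr j (p + 1)" using c by (simp add: consec_def)
    ultimately show ?thesis using len next_nbr_self[OF j True] inner_split[OF j True, of "next_nbr j (p + 1)"] by simp
  next
    case False
    have nn: "next_nbr j p = next_nbr j (p + 1)"
    proof (rule antisym)
      have ps: "p < s" using p1 by simp
      show "next_nbr j p \<le> next_nbr j (p + 1)"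
        using next_nbr(1,2)[OF j p1] by (intro next_nbr(3)[OF j ps]) auto
      have "next_nbr j p \<noteq> p" using next_nbr(2)[OF j ps] False by metis
      then show "next_nbr j (p + 1) \<le> next_nbr j p"
        using next_nbr(1,2)[OF j ps] by (intro next_nbr(3)[OF j p1]) auto
    qed
    show ?thesis using len fan_nil[OF j] False step nn by simp
  qed
qed

lemma length_white:
  assumes j: "j < s" shows "length (strands_at G (White j)) = r"
proof -
  have "[1..<s] = [1..<s - 1] @ [s - 1]" using two_le_s upt_Suc_append[of 1 "s - 1"] by simp
  then have "length (concat (map (fan j) [1..<s])) = inner j (s - 1)"
    using length_fans[OF j, of "s - 1"] next_nbr_self[OF j last_nbrs[OF j]] fan_nil[OF j, of "s - 1"] two_le_s by simp
  then show ?thesis unfolding white_strands[OF j] using inner_last[OF j] by simp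
qed

lemma white_nth_claw:
  assumes j: "j < s" and "k < length (claw r M j)"
  shows "strands_at G (White j) ! k = ((White j, Boundary (claw r M j ! k)), 0)"
  using assms unfolding white_strands[OF j] by (simp add: nth_append)

lemma white_nth_triangle:
  assumes j: "j < s" and c: "consec j p q" and t: "t < arcs_in (seg j p q)"
  shows "strands_at G (White j) ! (length (claw r M j) + inner j p + t) =
    ((White j, Black {j, (j + p) mod s, (j + q) mod s}), t)"
proof -
  have pq: "p \<in> nbrs j" "1 \<le> p" "p < s" using c by (auto simp: consec_def nbrs_def)
  have "[1..<s] = [1..<p] @ p # [p + 1..<s]"
    using upt_add_eq_append[of 1 p "s - p"] upt_conv_Cons[of p s] pq by simp
  then have "concat (map (fan j) [1..<s]) = concat (map (fan j) [1..<p]) @ fan j p @ concat (map (fan j) [p + 1..<s])"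
    by simp
  moreover have "length (concat (map (fan j) [1..<p])) = inner j p"
    using length_fans[OF j pq(2,3)] next_nbr_self[OF j pq(1)] by simp
  ultimately show ?thesis
    using fan_consec[OF j c] t unfolding white_strands[OF j]
    by (simp add: nth_append block_def)
qed

lemma consec_position:
  assumes j: "j < s" and k: "k < inner j (s - 1)"
  obtains p q t where "consec j p q" "k = inner j p + t" "t < arcs_in (seg j p q)"
proof -
  \<comment> \<open>Triangles of multiplicity 0 make several neighbours share one value of
    \<open>inner\<close>; the maximal element of \<open>S\<close> skips them, so that the remainder
    \<open>t\<close> lies in the range of actual strands.\<close>
  define S where "S = {p \<in> nbrs j. inner j p \<le> k}"
  have fin: "finite S" unfolding S_def nbrs_def by simp
  have ne: "S \<noteq> {}" using one_nbrs[OF j] inner_one[OF j] unfolding S_def by auto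
  define p where "p = Max S"
  have p: "p \<in> nbrs j" "inner j p \<le> k" using Max_in[OF fin ne] unfolding p_def S_def by auto
  have ps: "p < s" using p by (simp add: nbrs_def)
  have "p \<noteq> s - 1" using p k by auto
  then have p1: "p + 1 < s" using ps by simp
  define q where "q = next_nbr j (p + 1)"
  have c: "consec j p q" unfolding q_def by (rule consec_next[OF j p(1) p1])
  have "q \<notin> S" using Max_ge[OF fin, of q] c unfolding p_def[symmetric] consec_def by auto
  then have "k < inner j q" using c unfolding S_def consec_def by auto
  moreover have "inner j q = inner j p + arcs_in (seg j p q)"
    using inner_split[OF j p(1), of q] c by (simp add: consec_def)
  ultimately show thesis using that[OF c, of "k - inner j p"] p by simp
qed

end

section \<open>Turns at black and white vertices\<close>

context fraser
begin

lemma G_simps: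
  "white G (White j)" "\<not> white G (Black \<Delta>)" "bdry G = Boundary" "bdry_size G = n"
  "other_end G (White j, v) (White j) = v" "other_end G (White j, Black \<Delta>) (Black \<Delta>) = White j"
  "other_end G (White j, Boundary k) (Boundary k) = White j"
  by (auto simp: fraser_graph_def other_end_def)

lemma black_strands:
  assumes "\<Delta> \<in> triangles D" "\<Delta> \<subseteq> {..<s}"
  shows "strands_at G (Black \<Delta>) = concat (map (\<lambda>j. block j \<Delta>) (sorted_list_of_set \<Delta>))"
proof -
  let ?f = "\<lambda>e. map (Pair e) [0..<fmult r M D e]"
  let ?L = "map (\<lambda>j. (White j, Black \<Delta>)) (sorted_list_of_set \<Delta>)"
  have fin: "finite \<Delta>" using assms(2) finite_subset by blast
  have "?f e = []" if "e \<in> set ?L" "e \<notin> fedges r M D" for e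
  proof -
    have "e \<in> fverts r M D \<times> fverts r M D"
      using that(1) assms fin by (auto simp: fverts_def)
    then show ?thesis using that(2) by (simp add: fedges_def)
  qed
  then have "concat (map ?f (filter (\<lambda>e. e \<in> fedges r M D) ?L)) = concat (map ?f ?L)"
    by (rule concat_map_filter)
  then have "strands_at G (Black \<Delta>) = concat (map ?f ?L)"
    unfolding strands_at_def fraser_graph_def by simp
  also have "\<dots> = concat (map (\<lambda>j. block j \<Delta>) (sorted_list_of_set \<Delta>))"
    unfolding map_map using fin assms(1)
    by (intro arg_cong[where f = concat] map_cong) (auto simp: block_def)
  finally show ?thesis .
qed

lemma triangle_sorted:
  fixes a b c :: nat
  assumes "a < b" "b < c"
  shows "sorted_list_of_set {a, b, c} = [a, b, c]"
  using assms by (simp add: sorted_list_of_set_insert_remove insort_key.simps)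

lemma turn_index:
  assumes "p < (m :: nat)" "0 < m"
  shows "i \<le> p \<Longrightarrow> nat ((int p - int i) mod int m) = p - i"
    and "p < i \<Longrightarrow> i \<le> p + m \<Longrightarrow> nat ((int p - int i) mod int m) = p + m - i"
proof -
  assume "i \<le> p"
  then have "(int p - int i) mod int m = int p - int i" using assms by (intro mod_pos_pos_trivial) auto
  then show "nat ((int p - int i) mod int m) = p - i" by simp
next
  assume a: "p < i" "i \<le> p + m"
  have "(int p - int i) mod int m = (int p - int i + int m) mod int m" by simp
  also have "\<dots> = int p - int i + int m" using a by (intro mod_pos_pos_trivial) auto
  finally show "nat ((int p - int i) mod int m) = p + m - i" using a by simp
qed

text \<open>The rotation lists corners by number, so the cyclic order \<open>a, b, c\<close> occurs
  in three linear forms. Going backwards from the block of \<open>a\<close> one meets that of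
  \<open>c\<close> and then that of \<open>b\<close>; \<open>t < i\<close> makes the turn leave the
  block of \<open>a\<close>, and the size of \<open>i\<close> decides how far it goes.\<close>

lemma black_turn:
  assumes tri: "{a, b, c} \<in> triangles D" "{a, b, c} \<subseteq> {..<s}"
    and ord: "a < b \<and> b < c \<or> b < c \<and> c < a \<or> c < a \<and> a < b"
    and mult: "corner_mult r M D {a, b, c} a = A" "corner_mult r M D {a, b, c} b = B" "corner_mult r M D {a, b, c} c = C"
    and sum: "A + B + C = r"
    and walk: "trip_walk G i j ((White a, Black {a, b, c}), t) (Black {a, b, c})"
    and t: "t < A" "t < i"
  shows "i \<le> t + C \<Longrightarrow> trip_walk G i j ((White c, Black {a, b, c}), C + t - i) (White c)"
    and "t + C < i \<Longrightarrow> i \<le> t + C + B \<Longrightarrow> trip_walk G i j ((White b, Black {a, b, c}), B + C + t - i) (White b)"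
proof -
  let ?\<Delta> = "{a, b, c}"
  let ?e = "\<lambda>v. (White v, Black ?\<Delta>)"
  let ?L = "strands_at G (Black ?\<Delta>)"
  have len: "length (block a ?\<Delta>) = A" "length (block b ?\<Delta>) = B" "length (block c ?\<Delta>) = C"
    using mult by (simp_all add: block_def)
  have nth: "block a ?\<Delta> ! q = (?e a, q)" if "q < A" for q using that mult by (simp add: block_def)
  have nthb: "block b ?\<Delta> ! q = (?e b, q)" if "q < B" for q using that mult by (simp add: block_def)
  have nthc: "block c ?\<Delta> ! q = (?e c, q)" if "q < C" for q using that mult by (simp add: block_def)
  have step: "trip_walk G i j (?L ! nat ((int p - int i) mod int r)) (other_end G (fst (?L ! nat ((int p - int i) mod int r))) (Black ?\<Delta>))"
    if "p < r" "length ?L = r" "?L ! p = (?e a, t)" for p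
    using trip_walk.turn[OF walk _ refl _ that(3) refl] that(1,2) G_simps(2)[of ?\<Delta>]
    by (auto simp: G_simps(3))
  have idx: "\<exists>p. p < r \<and> length ?L = r \<and> ?L ! p = (?e a, t) \<and>
      (i \<le> t + C \<longrightarrow> ?L ! nat ((int p - int i) mod int r) = (?e c, C + t - i)) \<and>
      (t + C < i \<longrightarrow> i \<le> t + C + B \<longrightarrow> ?L ! nat ((int p - int i) mod int r) = (?e b, B + C + t - i))"
    using ord
  proof (elim disjE)
    assume o: "a < b \<and> b < c"
    have L: "?L = block a ?\<Delta> @ block b ?\<Delta> @ block c ?\<Delta>"
      using black_strands[OF tri] triangle_sorted[of a b c] o by simp
    show ?thesis unfolding L
      using t sum len nth nthb nthc turn_index(2)[of t r i] by (intro exI[of _ t]) (auto simp: nth_append)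
  next
    assume o: "b < c \<and> c < a"
    have s3: "{a, b, c} = {b, c, a}" by auto
    have L: "?L = block b ?\<Delta> @ block c ?\<Delta> @ block a ?\<Delta>"
      using black_strands[OF tri] triangle_sorted[of b c a] o by (simp flip: s3)
    show ?thesis unfolding L
      using t sum len nth nthb nthc turn_index(1)[of "B + C + t" r i] by (intro exI[of _ "B + C + t"]) (auto simp: nth_append)
  next
    assume o: "c < a \<and> a < b"
    have s3: "{a, b, c} = {c, a, b}" by auto
    have L: "?L = block c ?\<Delta> @ block a ?\<Delta> @ block b ?\<Delta>"
      using black_strands[OF tri] triangle_sorted[of c a b] o by (simp flip: s3)
    show ?thesis unfolding L
      using t sum len nth nthb nthc turn_index[of "C + t" r i] by (intro exI[of _ "C + t"]) (auto simp: nth_append)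
  qed
  then obtain p where p: "p < r" "length ?L = r" "?L ! p = (?e a, t)"
    "i \<le> t + C \<Longrightarrow> ?L ! nat ((int p - int i) mod int r) = (?e c, C + t - i)"
    "t + C < i \<Longrightarrow> i \<le> t + C + B \<Longrightarrow> ?L ! nat ((int p - int i) mod int r) = (?e b, B + C + t - i)"
    by blast
  show "i \<le> t + C \<Longrightarrow> trip_walk G i j (?e c, C + t - i) (White c)"
    using step[OF p(1-3)] p(4) by (simp add: G_simps)
  show "t + C < i \<Longrightarrow> i \<le> t + C + B \<Longrightarrow> trip_walk G i j (?e b, B + C + t - i) (White b)"
    using step[OF p(1-3)] p(5) by (simp add: G_simps)
qed

text \<open>\<open>k\<close> is read modulo \<open>r\<close>, the number of strands at a white
  vertex, so that positions can be stated as unreduced sums.\<close>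

definition leaves :: "nat \<Rightarrow> nat \<Rightarrow> nat \<Rightarrow> nat \<Rightarrow> bool" where
  "leaves i j v k \<longleftrightarrow> (let s' = strands_at G (White v) ! (k mod r) in
     trip_walk G i j s' (other_end G (fst s') (White v)))"

lemma leavesI:
  assumes "v < s" "trip_walk G i j (strands_at G (White v) ! p) (White v)" "p < r"
  shows "leaves i j v (p + i)"
proof -
  let ?L = "strands_at G (White v)"
  let ?q = "nat ((if white G (White v) then int p + int i else int p - int i) mod int (length ?L))"
  have "trip_walk G i j (?L ! ?q) (other_end G (fst (?L ! ?q)) (White v))"
    by (rule trip_walk.turn[OF assms(2) _ refl _ refl refl])
      (use length_white[OF assms(1)] assms(3) in \<open>auto simp: G_simps\<close>)
  moreover have "?q = (p + i) mod r"
    using length_white[OF assms(1)] G_simps(1) by (simp flip: of_nat_add of_nat_mod)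
  ultimately show ?thesis unfolding leaves_def Let_def by simp
qed

lemma leaves_boundary:
  assumes "leaves i j v k" "v < s" "l < length (claw r M v)" "k mod r = l"
  shows "\<exists>s'. trip_walk G i j s' (Boundary (claw r M v ! l))"
  using assms white_nth_claw[OF assms(2,3)] unfolding leaves_def by (auto simp: G_simps Let_def)

lemma triangle_rotate:
  assumes "b < s" "c < s" and "{a, b, c} \<in> triangles D" "a < s" and lt: "cdist s a b < cdist s a c" "a \<noteq> b"
  shows "consec b (cdist s b c) (cdist s b a)" "consec c (cdist s c a) (cdist s c b)"
    "a < b \<and> b < c \<or> b < c \<and> c < a \<or> c < a \<and> a < b"
    "cdist s b c < cdist s b a" "cdist s c a < cdist s c b" "a \<noteq> c" "b \<noteq> c"
proof -
  have ne: "a \<noteq> c" "b \<noteq> c" using lt by auto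
  have o: "a < b \<and> b < c \<or> b < c \<and> c < a \<or> c < a \<and> a < b"
    using lt ne unfolding cdist_less_iff0[OF assms(4,1,2)] by linarith
  have l2: "cdist s b c < cdist s b a" "cdist s c a < cdist s c b"
    using o lt(2) ne unfolding cdist_less_iff0[OF assms(1,2,4)] cdist_less_iff0[OF assms(2,4,1)] by linarith+
  have pos: "1 \<le> cdist s b c" "1 \<le> cdist s c a" "cdist s b a < s" "cdist s c b < s"
    using ne assms cdist_inj0[of b s c b] cdist_inj0[of c s a c] cdist_less0
    by (auto simp: Suc_le_eq intro: ccontr)
  have s3: "{b, c, a} = {a, b, c}" "{c, a, b} = {a, b, c}" by auto
  show "consec b (cdist s b c) (cdist s b a)"
    using triangle_iff_consec[OF assms(1) pos(1) l2(1) pos(3)] add_cdist assms s3 by simp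
  show "consec c (cdist s c a) (cdist s c b)"
    using triangle_iff_consec[OF assms(2) pos(2) l2(2) pos(4)] add_cdist assms s3 by simp
  show "a < b \<and> b < c \<or> b < c \<and> c < a \<or> c < a \<and> a < b" "cdist s b c < cdist s b a" "cdist s c a < cdist s c b"
     "a \<noteq> c" "b \<noteq> c" using o l2 ne by auto
qed

lemma consec_bound:
  assumes "j < s" "consec j p q"
  shows "length (claw r M j) + inner j p + arcs_in (seg j p q) \<le> r"
proof -
  have "p \<in> nbrs j" "p \<le> q" "q \<le> s - 1" using assms(2) by (auto simp: consec_def nbrs_def)
  then show ?thesis
    using inner_split[OF assms(1), of p q] inner_mono[of q "s - 1" j] inner_last[OF assms(1)] by linarith
qed

text \<open>The turns by \<open>i\<close> backwards and forwards cancel, so the exit depends on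
  \<open>i\<close> only through the corner. At \<open>c\<close> it is strand number
  \<open>t\<close>, counted from 0, after those of the triangle. At \<open>b\<close>, since
  \<open>A + B + C = r\<close>, it lies modulo \<open>r\<close> exactly \<open>A - t\<close> places
  before the first strand of the triangle.\<close>

lemma through_triangle:
  assumes v: "a < s" "b < s" "c < s" and con: "consec a (cdist s a b) (cdist s a c)"
    and lv: "leaves i j a k" and k: "k mod r = length (claw r M a) + inner a (cdist s a b) + t" and t: "t < A" "t < i"
    and A: "A = arcs_in (seg a (cdist s a b) (cdist s a c))"
    and B: "B = arcs_in (seg b (cdist s b c) (cdist s b a))"
    and C: "C = arcs_in (seg c (cdist s c a) (cdist s c b))"
    and sum: "A + B + C = r"
  shows "i \<le> t + C \<Longrightarrow> leaves i j c (length (claw r M c) + inner c (cdist s c a) + C + t)"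
    and "t + C < i \<Longrightarrow> i \<le> t + C + B \<Longrightarrow>
      leaves i j b (length (claw r M b) + inner b (cdist s b c) + B + C + t)"
proof -
  have lt: "cdist s a b < cdist s a c" and p1: "1 \<le> cdist s a b"
    using con by (auto simp: consec_def nbrs_def)
  have ab: "a \<noteq> b" using p1 by auto
  have eq: "{a, (a + cdist s a b) mod s, (a + cdist s a c) mod s} = {a, b, c}"
    using add_cdist v by simp
  have tri: "{a, b, c} \<in> triangles D"
    using triangle_iff_consec[OF v(1) p1 lt cdist_less0[OF v(1,3)]] con eq by simp
  note rot = triangle_rotate[OF v(2,3) tri v(1) lt ab]
  have s3: "{b, c, a} = {a, b, c}" "{c, a, b} = {a, b, c}" by auto
  have eqb: "{b, (b + cdist s b c) mod s, (b + cdist s b a) mod s} = {a, b, c}"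
    and eqc: "{c, (c + cdist s c a) mod s, (c + cdist s c b) mod s} = {a, b, c}"
    using add_cdist v s3 by simp_all
  have mult: "corner_mult r M D {a, b, c} a = A" "corner_mult r M D {a, b, c} b = B" "corner_mult r M D {a, b, c} c = C"
    using fan_consec(2)[OF v(1) con] fan_consec(2)[OF v(2) rot(1)] fan_consec(2)[OF v(3) rot(2)]
    unfolding eq eqb eqc A B C by simp_all
  have sub: "{a, b, c} \<subseteq> {..<s}" using v by simp
  have at: "strands_at G (White a) ! (k mod r) = ((White a, Black {a, b, c}), t)"
    using white_nth_triangle[OF v(1) con] t(1) unfolding k A eq by simp
  have w: "trip_walk G i j ((White a, Black {a, b, c}), t) (Black {a, b, c})"
    using lv at unfolding leaves_def by (simp add: G_simps Let_def)
  note bt = black_turn[OF tri sub rot(3) mult sum w t]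
  show "leaves i j c (length (claw r M c) + inner c (cdist s c a) + C + t)" if i: "i \<le> t + C"
  proof -
    have less: "C + t - i < C" using t i by simp
    have "strands_at G (White c) ! (length (claw r M c) + inner c (cdist s c a) + (C + t - i)) = ((White c, Black {a, b, c}), C + t - i)"
      using white_nth_triangle[OF v(3) rot(2)] less unfolding C eqc by simp
    moreover have "length (claw r M c) + inner c (cdist s c a) + (C + t - i) < r"
      using consec_bound[OF v(3) rot(2)] less unfolding C by linarith
    ultimately have "leaves i j c (length (claw r M c) + inner c (cdist s c a) + (C + t - i) + i)"
      using bt(1)[OF i] by (intro leavesI[OF v(3)]) simp_all
    then show ?thesis using i by (simp add: ac_simps)
  qed
  show "leaves i j b (length (claw r M b) + inner b (cdist s b c) + B + C + t)" if i: "t + C < i" "i \<le> t + C + B"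
  proof -
    have less: "B + C + t - i < B" using i by simp
    have "strands_at G (White b) ! (length (claw r M b) + inner b (cdist s b c) + (B + C + t - i)) = ((White b, Black {a, b, c}), B + C + t - i)"
      using white_nth_triangle[OF v(2) rot(1)] less unfolding B eqb by simp
    moreover have "length (claw r M b) + inner b (cdist s b c) + (B + C + t - i) < r"
      using consec_bound[OF v(2) rot(1)] less unfolding B by linarith
    ultimately have "leaves i j b (length (claw r M b) + inner b (cdist s b c) + (B + C + t - i) + i)"
      using bt(2)[OF i] by (intro leavesI[OF v(2)]) simp_all
    then show ?thesis using i by (simp add: ac_simps)
  qed
qed

end

section \<open>Trips\<close>

locale fraser_trip = fraser +
  fixes x :: nat
  assumes x: "x \<in> {1..2 * r}"
begin

text \<open>Polygon vertices renumbered from the claw of \<open>x\<close>, so that a point in block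
  \<open>p\<close> belongs to the claw with vertex \<open>V p\<close>.\<close>

definition V :: "nat \<Rightarrow> nat" where "V p = (claw_of x + p) mod s"

lemma V_less [simp]: "V p < s"
  unfolding V_def using s_pos by simp

lemma V_s: "V s = V 0"
  unfolding V_def by simp

lemma claw_V: "w \<in> {1..n} \<Longrightarrow> claw_of w = V (rho x w)"
  unfolding V_def using claw_of_rho[OF x] by simp

lemma V_cdist0:
  assumes "p < s" "q < s" shows "cdist s (V p) (V q) = cdist s p q"
proof -
  obtain c where c: "c = claw_of x" "c < s" using claw_of_less by blast
  have V: "V m = (if c + m < s then c + m else c + m - s)" if "m < s" for m
  proof -
    have "c + m - s < s" using c that by linarith
    then show ?thesis unfolding V_def c(1)[symmetric] using mod_eqI[of "c + m - s" 1 s "c + m"] by auto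
  qed
  show ?thesis unfolding V[OF assms(1)] V[OF assms(2)] cdist_def using c(2) assms by auto
qed

lemma V_cdist:
  assumes "p < s" "q \<le> s"
  shows "cdist s (V p) (V q) = (if p = 0 \<and> q = s then 0 else if p \<le> q then q - p else q + s - p)"
proof (cases "q = s")
  case True
  then show ?thesis using V_cdist0[of p 0] assms s_pos V_s by (auto simp: cdist_def)
qed (use V_cdist0[of p q] assms in \<open>auto simp: cdist_def\<close>)

abbreviation lo :: "nat \<Rightarrow> nat" where "lo \<equiv> rho x"
abbreviation hi :: "nat \<Rightarrow> nat" where "hi w \<equiv> rho x (partner w)"

text \<open>Arcs are counted through their openers, by the blocks \<open>l < h\<close> of their two
  ends. All multiplicities and strand positions are expressed in this form, and identities between
  them reduce to partitions of the openers.\<close>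

definition cnt :: "(nat \<Rightarrow> nat \<Rightarrow> bool) \<Rightarrow> nat" where
  "cnt P = card {w \<in> openers x. P (lo w) (hi w)}"

lemma opener_arc:
  assumes "w \<in> openers x"
  shows "lo w < hi w" "hi w \<le> s" "\<not> (lo w = 0 \<and> hi w = s)" "w \<in> {1..n}"
    "claw_of w = V (lo w)" "claw_of (partner w) = V (hi w)"
proof -
  show w: "w \<in> {1..n}" using assms by (simp add: openers_def)
  show "lo w < hi w" using rho_opener[OF x w] assms by (simp add: openers_def)
  show "hi w \<le> s" by (rule rho_le)
  show c: "claw_of w = V (lo w)" "claw_of (partner w) = V (hi w)"
    using claw_V w partner_in[OF w] by auto
  show "\<not> (lo w = 0 \<and> hi w = s)" using claw_of_partner[OF w] c V_s by auto
qed

lemma cnt_add: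
  assumes "\<And>w. w \<in> openers x \<Longrightarrow> (R (lo w) (hi w) \<longleftrightarrow> P (lo w) (hi w) \<or> Q (lo w) (hi w))"
    and "\<And>w. w \<in> openers x \<Longrightarrow> \<not> (P (lo w) (hi w) \<and> Q (lo w) (hi w))"
  shows "cnt R = cnt P + cnt Q"
proof -
  have "{w \<in> openers x. R (lo w) (hi w)} = {w \<in> openers x. P (lo w) (hi w)} \<union> {w \<in> openers x. Q (lo w) (hi w)}"
    using assms(1) by auto
  moreover have "{w \<in> openers x. P (lo w) (hi w)} \<inter> {w \<in> openers x. Q (lo w) (hi w)} = {}"
    using assms(2) by auto
  ultimately show ?thesis unfolding cnt_def by (simp add: card_Un_disjoint)
qed

lemma cnt_mono:
  "(\<And>w. w \<in> openers x \<Longrightarrow> P (lo w) (hi w) \<Longrightarrow> Q (lo w) (hi w)) \<Longrightarrow> cnt P \<le> cnt Q"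
  unfolding cnt_def by (intro card_mono) auto

lemma cnt_True: "cnt (\<lambda>l h. True) = r"
  unfolding cnt_def using card_openers(1)[OF x] by simp

lemma cnt_le: "cnt P \<le> r"
  using cnt_mono[of P "\<lambda>l h. True"] cnt_True by simp

lemma cnt_closers: "card {v \<in> closers x. P (rho x v)} = cnt (\<lambda>l h. P h)"
proof -
  have "bij_betw partner {w \<in> openers x. P (hi w)} {v \<in> closers x. P (rho x v)}"
    using bij_partner[OF x] by (auto simp: bij_betw_def intro: inj_on_subset)
  then show ?thesis unfolding cnt_def by (simp add: bij_betw_same_card)
qed

lemma arcs_in_cnt:
  assumes "\<And>l h. l < h \<Longrightarrow> h \<le> s \<Longrightarrow> \<not> (l = 0 \<and> h = s) \<Longrightarrow> (V l \<in> X \<and> V h \<in> X \<longleftrightarrow> P l h)"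
  shows "arcs_in X = cnt P"
proof -
  have "{w \<in> openers x. claw_of w \<in> X \<and> claw_of (partner w) \<in> X} = {w \<in> openers x. P (lo w) (hi w)}"
  proof (rule Collect_cong)
    fix w
    show "(w \<in> openers x \<and> claw_of w \<in> X \<and> claw_of (partner w) \<in> X) \<longleftrightarrow> (w \<in> openers x \<and> P (lo w) (hi w))"
    proof (cases "w \<in> openers x")
      case True
      then show ?thesis using assms[OF opener_arc(1-3)[OF True]] opener_arc(5,6)[OF True] by simp
    qed simp
  qed
  then show ?thesis unfolding arcs_in_openers[OF x] cnt_def by simp
qed

lemma V_seg: "V m \<in> seg (V p) d e \<longleftrightarrow> d \<le> cdist s (V p) (V m) \<and> cdist s (V p) (V m) \<le> e"
  by (simp add: seg_def)

text \<open>An arc with \<open>hi w = s\<close> ends at \<open>V 0\<close>, at distance 0 instead of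
  \<open>s\<close>, and so acts as a chord from \<open>V 0\<close> to \<open>V (lo w)\<close>; its
  crossing pattern is stated separately.\<close>

lemma arc_cross:
  assumes w: "w \<in> openers x" and pq: "{V p, V q} \<in> D" "p < q" "q < s"
  shows "hi w < s \<Longrightarrow> \<not> (lo w < p \<and> p < hi w \<and> hi w < q) \<and> \<not> (p < lo w \<and> lo w < q \<and> q < hi w)"
    and "hi w = s \<Longrightarrow> \<not> (0 < p \<and> p < lo w \<and> lo w < q)"
proof -
  note o = opener_arc[OF w]
  have arc: "{V (lo w), V (hi w)} \<in> D" using arc_chord[OF o(4)] o(5,6) by simp
  then have arc': "{V (hi w), V (lo w)} \<in> D" by (simp add: insert_commute)
  have pq': "{V q, V p} \<in> D" using pq(1) by (simp add: insert_commute)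
  have ls: "lo w < s" using o(1,2) by simp
  have z: "cdist s (V 0) (V m) = m" if "m < s" for m using V_cdist[of 0 m] that s_pos by simp
  note zz = z[OF ls] z[OF pq(3)]
  have zp: "cdist s (V 0) (V p) = p" using pq z by simp
  show "hi w < s \<Longrightarrow> \<not> (lo w < p \<and> p < hi w \<and> hi w < q) \<and> \<not> (p < lo w \<and> lo w < q \<and> q < hi w)"
    using D_cross[OF pq(1) arc V_less, of 0] D_cross[OF arc pq(1) V_less, of 0] zz zp z[of "hi w"] by auto
  show "hi w = s \<Longrightarrow> \<not> (0 < p \<and> p < lo w \<and> lo w < q)"
    using D_cross[OF pq(1) arc' V_less, of 0] zz zp V_s by auto
qed

section \<open>Strand positions as numbers of arcs\<close>

abbreviation clen :: "nat \<Rightarrow> nat" where "clen p \<equiv> length (claw r M (V p))"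

lemma cdist_back:
  assumes "0 < e" "e < F" "F \<le> s"
  shows "cdist s (V F) (V e) = e + s - F" "cdist s (V e) (V F) = F - e"
  using assms V_cdist[of F e] V_cdist[of 0 e] V_cdist[of e F] V_s by (cases "F = s"; auto)+

text \<open>An arc closing before \<open>F\<close> stays on one side of the chord. If
  \<open>F = s\<close>, an arc opening in block 0 shares the end \<open>V 0\<close> with the chord,
  so noncrossing says nothing about it; \<open>last\<close> settles this case.\<close>

lemma closer_split:
  assumes eF: "0 < e" "e < F" "F \<le> s" and chord: "{V e, V F} \<in> D"
    and last: "\<And>w. F = s \<Longrightarrow> w \<in> openers x \<Longrightarrow> lo w = 0 \<Longrightarrow> hi w \<le> e"
    and w: "w \<in> openers x"
  shows "hi w < F \<Longrightarrow> hi w \<le> e \<or> e \<le> lo w"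
proof -
  assume h: "hi w < F"
  show ?thesis
  proof (cases "F = s")
    case True
    have "{V 0, V e} \<in> D" using chord True V_s by (simp add: insert_commute)
    then show ?thesis using arc_cross[OF w, of 0 e] eF h last[OF True w] True by fastforce
  next
    case False
    then show ?thesis using arc_cross[OF w chord] eF h opener_arc(1,2)[OF w] by fastforce
  qed
qed

text \<open>The strands at \<open>V F\<close> beyond the chord to \<open>V e\<close> count the arcs
  with both ends in the blocks from \<open>e\<close> to \<open>F - 1\<close>. These are the arcs
  closing after \<open>e\<close> and before \<open>F\<close>, and the remaining strands are the
  complement in \<open>r\<close>.\<close>

lemma white_count_back:
  assumes eF: "0 < e" "e < F" "F \<le> s" and chord: "{V e, V F} \<in> D"
    and last: "\<And>w. F = s \<Longrightarrow> w \<in> openers x \<Longrightarrow> lo w = 0 \<Longrightarrow> hi w \<le> e"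
  shows "clen F + inner (V F) (e + s - F) + cnt (\<lambda>l h. h < F) = r + cnt (\<lambda>l h. h \<le> e)"
proof -
  have "{V F, V e} \<in> D" using chord by (simp add: insert_commute)
  from cdist_nbrs[OF this] have nb: "e + s - F \<in> nbrs (V F)" using cdist_back[OF eF] by simp
  then have "inner (V F) (s - 1) = inner (V F) (e + s - F) + arcs_in (seg (V F) (e + s - F) (s - 1))"
    using inner_split[OF V_less nb, of "s - 1"] eF by simp
  moreover have "arcs_in (seg (V F) (e + s - F) (s - 1)) = cnt (\<lambda>l h. e \<le> l \<and> h < F)"
  proof (rule arcs_in_cnt)
    have m: "V m \<in> seg (V F) (e + s - F) (s - 1) \<longleftrightarrow> e \<le> m \<and> m < F" if "m \<le> s" for m
      unfolding V_seg using V_cdist[of F m] V_cdist[of 0 m] V_s that eF by (cases "F = s") auto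
    show "V l \<in> seg (V F) (e + s - F) (s - 1) \<and> V h \<in> seg (V F) (e + s - F) (s - 1) \<longleftrightarrow> e \<le> l \<and> h < F"
      if "l < h" "h \<le> s" for l h using m[of l] m[of h] that by auto
  qed
  moreover have "cnt (\<lambda>l h. h < F) = cnt (\<lambda>l h. h \<le> e) + cnt (\<lambda>l h. e \<le> l \<and> h < F)"
    by (rule cnt_add) (use closer_split[OF eF chord last] opener_arc(1) eF in fastforce)+
  ultimately show ?thesis using inner_last[OF V_less, of F] by simp
qed

text \<open>For \<open>u = 0\<close> an arc with \<open>hi w = s\<close> shares the end
  \<open>V 0\<close> with the chord and escapes the noncrossing argument; \<open>first\<close> keeps
  its opener out of the range.\<close>

lemma opener_split:
  assumes ud: "u < d" "d < s" and chord: "{V u, V d} \<in> D"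
    and first: "\<And>w. u = 0 \<Longrightarrow> w \<in> openers x \<Longrightarrow> hi w = s \<Longrightarrow> d \<le> lo w"
    and w: "w \<in> openers x"
  shows "u < lo w \<Longrightarrow> lo w < d \<Longrightarrow> hi w \<le> d"
proof (cases "hi w = s")
  case True
  assume l: "u < lo w" "lo w < d"
  have "u \<noteq> 0" using first[OF _ w True] l by linarith
  then show ?thesis using arc_cross(2)[OF w chord ud True] l by simp
next
  case False
  assume l: "u < lo w" "lo w < d"
  have "hi w < s" using opener_arc(2)[OF w] False by simp
  then show ?thesis using arc_cross(1)[OF w chord ud] l by linarith
qed

text \<open>The strands at \<open>V u\<close> between the claw and the chord to \<open>V d\<close>
  count the arcs inside the blocks \<open>u + 1\<close> to \<open>d\<close>. As an arc opening
  strictly between \<open>u\<close> and \<open>d\<close> cannot pass that chord, these are all arcs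
  opening there.\<close>

lemma white_count_forward:
  assumes ud: "u < d" "d < s" and chord: "{V u, V d} \<in> D"
    and first: "\<And>w. u = 0 \<Longrightarrow> w \<in> openers x \<Longrightarrow> hi w = s \<Longrightarrow> d \<le> lo w"
  shows "cnt (\<lambda>l h. l \<le> u) + inner (V u) (d - u) = cnt (\<lambda>l h. l < d)"
proof -
  have "inner (V u) (d - u) = cnt (\<lambda>l h. u < l \<and> h \<le> d)"
    unfolding inner_def
  proof (rule arcs_in_cnt)
    have m: "V m \<in> seg (V u) 1 (d - u) \<longleftrightarrow> u < m \<and> m \<le> d" if "m \<le> s" for m
      unfolding V_seg using V_cdist[of u m] that ud by auto
    show "V l \<in> seg (V u) 1 (d - u) \<and> V h \<in> seg (V u) 1 (d - u) \<longleftrightarrow> u < l \<and> h \<le> d"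
      if "l < h" "h \<le> s" for l h using m[of l] m[of h] that by auto
  qed
  moreover have "cnt (\<lambda>l h. l < d) = cnt (\<lambda>l h. l \<le> u) + cnt (\<lambda>l h. u < l \<and> h \<le> d)"
  proof (rule cnt_add)
    fix w assume w: "w \<in> openers x"
    note os = opener_split[OF ud chord first w]
    show "lo w < d \<longleftrightarrow> lo w \<le> u \<or> u < lo w \<and> hi w \<le> d" using os opener_arc(1)[OF w] ud by linarith
    show "\<not> (lo w \<le> u \<and> u < lo w \<and> hi w \<le> d)" by linarith
  qed
  ultimately show ?thesis by simp
qed

text \<open>No arc crosses a side and none lies within one claw, so each of the \<open>r\<close>
  arcs is cut off by exactly one side. The extra clause in the third part is due to arcs that end at
  \<open>V 0\<close> with block index \<open>s\<close>.\<close>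

lemma triangle_parts:
  assumes uvw: "u < d" "d < e" "e < s" and chords: "{V u, V d} \<in> D" "{V d, V e} \<in> D" "{V u, V e} \<in> D"
  shows "arcs_in (seg (V u) (d - u) (e - u)) = cnt (\<lambda>l h. d \<le> l \<and> h \<le> e)"
    and "arcs_in (seg (V d) (e - d) (u + s - d)) = cnt (\<lambda>l h. (e \<le> l \<or> l \<le> u) \<and> (e \<le> h \<or> h \<le> u))"
    and "arcs_in (seg (V e) (u + s - e) (d + s - e)) =
      cnt (\<lambda>l h. u \<le> l \<and> h \<le> d \<or> u = 0 \<and> l \<le> d \<and> h = s)"
    and "arcs_in (seg (V u) (d - u) (e - u)) + arcs_in (seg (V d) (e - d) (u + s - d)) +
      arcs_in (seg (V e) (u + s - e) (d + s - e)) = r"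
proof -
  have m1: "V m \<in> seg (V u) (d - u) (e - u) \<longleftrightarrow> d \<le> m \<and> m \<le> e" if "m \<le> s" for m
    unfolding V_seg using V_cdist[of u m] that uvw by auto
  show 1: "arcs_in (seg (V u) (d - u) (e - u)) = cnt (\<lambda>l h. d \<le> l \<and> h \<le> e)"
    by (rule arcs_in_cnt) (use m1 in auto)
  have m2: "V m \<in> seg (V d) (e - d) (u + s - d) \<longleftrightarrow> e \<le> m \<or> m \<le> u" if "m \<le> s" for m
    unfolding V_seg using V_cdist[of d m] that uvw by auto
  show 2: "arcs_in (seg (V d) (e - d) (u + s - d)) = cnt (\<lambda>l h. (e \<le> l \<or> l \<le> u) \<and> (e \<le> h \<or> h \<le> u))"
    by (rule arcs_in_cnt) (use m2 in auto)
  have m3: "V m \<in> seg (V e) (u + s - e) (d + s - e) \<longleftrightarrow> u \<le> m \<and> m \<le> d \<or> u = 0 \<and> m = s" if "m \<le> s" for m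
    unfolding V_seg using V_cdist[of e m] that uvw by auto
  show 3: "arcs_in (seg (V e) (u + s - e) (d + s - e)) =
      cnt (\<lambda>l h. u \<le> l \<and> h \<le> d \<or> u = 0 \<and> l \<le> d \<and> h = s)"
  proof (rule arcs_in_cnt)
    show "V l \<in> seg (V e) (u + s - e) (d + s - e) \<and> V h \<in> seg (V e) (u + s - e) (d + s - e) \<longleftrightarrow>
        (u \<le> l \<and> h \<le> d \<or> u = 0 \<and> l \<le> d \<and> h = s)" if "l < h" "h \<le> s" for l h
      using m3[of l] m3[of h] that uvw by auto
  qed
  let ?P = "\<lambda>l h :: nat. d \<le> l \<and> h \<le> e"
  let ?Q = "\<lambda>l h :: nat. (e \<le> l \<or> l \<le> u) \<and> (e \<le> h \<or> h \<le> u)"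
  let ?R = "\<lambda>l h :: nat. u \<le> l \<and> h \<le> d \<or> u = 0 \<and> l \<le> d \<and> h = s"
  have one: "(?P (lo w) (hi w) \<or> ?Q (lo w) (hi w)) \<or> ?R (lo w) (hi w)"
    and two: "\<not> (?P (lo w) (hi w) \<and> ?Q (lo w) (hi w))"
    and three: "\<not> ((?P (lo w) (hi w) \<or> ?Q (lo w) (hi w)) \<and> ?R (lo w) (hi w))" if w: "w \<in> openers x" for w
  proof -
    note o = opener_arc(1-3)[OF w]
    have es: "d < s" "u < e" using uvw by auto
    note c = arc_cross[OF w chords(1) uvw(1) es(1)] arc_cross[OF w chords(2) uvw(2,3)] arc_cross[OF w chords(3) es(2) uvw(3)]
    show "(?P (lo w) (hi w) \<or> ?Q (lo w) (hi w)) \<or> ?R (lo w) (hi w)"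
    proof (cases "hi w = s")
      case True
      then show ?thesis using c(2,4,6) uvw o by linarith
    next
      case False
      then have hs: "hi w < s" using o by simp
      consider "lo w < u" | "lo w = u" | "u < lo w" "lo w < d" | "d \<le> lo w" "lo w < e" | "e \<le> lo w" by linarith
      then show ?thesis
      proof cases
        case 1
        then show ?thesis using c(5)[OF hs] o by linarith
      next
        case 2
        then show ?thesis using c(3)[OF hs] o uvw by linarith
      next
        case 3
        then show ?thesis using c(1)[OF hs] by linarith
      next
        case 4
        then show ?thesis using c(5)[OF hs] uvw by linarith
      next
        case 5
        then show ?thesis using o by linarith
      qed
    qed
    show "\<not> (?P (lo w) (hi w) \<and> ?Q (lo w) (hi w))" using o uvw by linarith
    show "\<not> ((?P (lo w) (hi w) \<or> ?Q (lo w) (hi w)) \<and> ?R (lo w) (hi w))" using o uvw by linarith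
  qed
  have "cnt (\<lambda>l h. ?P l h \<or> ?Q l h) = cnt ?P + cnt ?Q" by (rule cnt_add) (use two in auto)
  moreover have "cnt (\<lambda>l h. True) = cnt (\<lambda>l h. ?P l h \<or> ?Q l h) + cnt ?R"
    by (rule cnt_add) (use one three in auto)
  ultimately show "arcs_in (seg (V u) (d - u) (e - u)) + arcs_in (seg (V d) (e - d) (u + s - d)) +
      arcs_in (seg (V e) (u + s - e) (d + s - e)) = r"
    unfolding 1 2 3 using cnt_True by simp
qed

end

text \<open>Ranks are injective with values below the cardinality, hence take all of these
  values.\<close>

lemma ex_rank:
  fixes f :: "'a \<Rightarrow> nat"
  assumes "finite A" "inj_on f A" "i < card A"
  shows "\<exists>y\<in>A. card {v \<in> A. f v < f y} = i"
proof -
  let ?g = "\<lambda>y. card {v \<in> A. f v < f y}"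
  have "inj_on ?g A"
  proof (rule inj_onI)
    fix y z assume "y \<in> A" "z \<in> A" "?g y = ?g z"
    then show "y = z" using card_less_inj[OF assms(1) _ _ assms(2)] by blast
  qed
  then have c: "card (?g ` A) = card A" by (rule card_image)
  have "?g y < card A" if "y \<in> A" for y
    using assms(1) that by (intro psubset_card_mono) auto
  then have sub: "?g ` A \<subseteq> {..<card A}" by auto
  have "?g ` A = {..<card A}" by (rule card_subset_eq[OF _ sub]) (use c in simp_all)
  then have "i \<in> ?g ` A" using assms(3) by simp
  then show ?thesis by auto
qed

context fraser
begin

lemma consec_chords:
  assumes "a < s" "b < s" "c < s" "consec a (cdist s a b) (cdist s a c)"
  shows "{a, b} \<in> D" "{a, c} \<in> D" "{b, c} \<in> D"
proof -
  have eq: "{a, (a + cdist s a b) mod s, (a + cdist s a c) mod s} = {a, b, c}"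
    using add_cdist assms by simp
  have p: "1 \<le> cdist s a b" "cdist s a b < cdist s a c" "cdist s a c < s"
    using assms(4) by (auto simp: consec_def nbrs_def)
  have "{a, b, c} \<in> triangles D" using triangle_iff_consec[OF assms(1) p] assms(4) eq by simp
  moreover have "b \<noteq> c" using p by auto
  ultimately show "{b, c} \<in> D" by (auto simp: triangles_def)
  show "{a, b} \<in> D" "{a, c} \<in> D" using assms(4) add_cdist assms(1-3) unfolding consec_def nbrs_def by auto
qed

end

section \<open>Trips heading for openers\<close>

context fraser_trip
begin

lemma V_add: "(V u + m) mod s = V (u + m)"
  unfolding V_def by (simp add: mod_simps add.assoc)

lemma clen_le: "p \<le> s \<Longrightarrow> clen p \<le> r"
  using inner_last[OF V_less, of p] by simp

abbreviation reaches :: "nat \<Rightarrow> nat \<Rightarrow> bool" where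
  "reaches i y \<equiv> \<exists>s'. trip_walk G i x s' (Boundary y)"

lemma opener_of_rank:
  assumes u: "u < s" and i: "cnt (\<lambda>l h. l < u) \<le> i" "i < cnt (\<lambda>l h. l \<le> u)"
  shows "\<exists>y\<in>openers x. orank x y = i \<and> rho x y = u"
proof -
  have "i < card (openers x)" using i(2) cnt_le[of "\<lambda>l h. l \<le> u"] card_openers(1)[OF x] by simp
  moreover have "inj_on (dist x) (openers x)"
    by (rule inj_on_subset[OF dist_inj_on[OF x]]) (auto simp: openers_def)
  ultimately obtain y where y: "y \<in> openers x" "orank x y = i"
    using ex_rank[OF finite_openers(1)] unfolding orank_def by blast
  have "\<not> rho x y < u"
  proof
    assume a: "rho x y < u"
    have "rho x v < u" if "dist x v < dist x y" for v using rho_mono[of x v y] that a by simp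
    then have "insert y {v \<in> openers x. dist x v < dist x y} \<subseteq> {v \<in> openers x. rho x v < u}"
      using a y(1) by auto
    then have "card (insert y {v \<in> openers x. dist x v < dist x y}) \<le> cnt (\<lambda>l h. l < u)"
      unfolding cnt_def by (intro card_mono) auto
    then show False using y i(1) unfolding orank_def by simp
  qed
  moreover have "\<not> u < rho x y"
  proof
    assume a: "u < rho x y"
    have "dist x v < dist x y" if "rho x v \<le> u" for v using rho_less_dist[of x v y] that a by simp
    then have "{v \<in> openers x. rho x v \<le> u} \<subseteq> {v \<in> openers x. dist x v < dist x y}" by auto
    then have "cnt (\<lambda>l h. l \<le> u) \<le> orank x y" unfolding cnt_def orank_def by (intro card_mono) auto
    then show False using y i(2) by simp
  qed
  ultimately show ?thesis using y by auto
qed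

lemma closer_of_rank:
  assumes f: "f \<le> s" and i: "cnt (\<lambda>l h. h < f) \<le> i" "i < cnt (\<lambda>l h. h \<le> f)"
  shows "\<exists>y\<in>closers x. crank x y = i \<and> rho x y = f"
proof -
  have "i < card (closers x)" using i(2) cnt_le[of "\<lambda>l h. h \<le> f"] card_openers(2)[OF x] by simp
  moreover have "inj_on (dist x) (closers x)"
    by (rule inj_on_subset[OF dist_inj_on[OF x]]) (auto simp: closers_def)
  ultimately obtain y where y: "y \<in> closers x" "crank x y = i"
    using ex_rank[OF finite_openers(2)] unfolding crank_def by blast
  have "\<not> rho x y < f"
  proof
    assume a: "rho x y < f"
    have "rho x v < f" if "dist x v < dist x y" for v using rho_mono[of x v y] that a by simp
    then have "insert y {v \<in> closers x. dist x v < dist x y} \<subseteq> {v \<in> closers x. rho x v < f}"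
      using a y(1) by auto
    then have "card (insert y {v \<in> closers x. dist x v < dist x y}) \<le> card {v \<in> closers x. rho x v < f}"
      by (intro card_mono) auto
    then show False using y i(1) cnt_closers[of "\<lambda>m. m < f"] unfolding crank_def by simp
  qed
  moreover have "\<not> f < rho x y"
  proof
    assume a: "f < rho x y"
    have "dist x v < dist x y" if "rho x v \<le> f" for v using rho_less_dist[of x v y] that a by simp
    then have "{v \<in> closers x. rho x v \<le> f} \<subseteq> {v \<in> closers x. dist x v < dist x y}" by auto
    then have "card {v \<in> closers x. rho x v \<le> f} \<le> crank x y" unfolding crank_def by (intro card_mono) auto
    then show False using y i(2) cnt_closers[of "\<lambda>m. m \<le> f"] by simp
  qed
  ultimately show ?thesis using y by auto
qed

lemma index_in_claw:
  assumes "y \<in> {1..n}" "rho x y = p"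
  obtains l where "l < clen p" "claw r M (V p) ! l = y"
proof -
  have "y \<in> set (claw r M (V p))" using claw_mem[OF V_less] claw_V[OF assms(1)] assms by simp
  then show thesis using that by (auto simp: in_set_conv_nth)
qed

text \<open>The block of the sought opener has been reached: by \<open>opener_position\<close> the
  leaving position is \<open>r\<close> plus its index in the claw, so the next strand is its
  boundary edge.\<close>

lemma opener_end:
  assumes u: "u < s" and i: "cnt (\<lambda>l h. l < u) \<le> i" "i < cnt (\<lambda>l h. l \<le> u)"
    and lv: "leaves i x (V u) (clen u + i + (r - cnt (\<lambda>l h. l \<le> u)))"
  shows "\<exists>y\<in>openers x. orank x y = i \<and> reaches i y"
proof -
  obtain y where y: "y \<in> openers x" "orank x y = i" "rho x y = u" using opener_of_rank[OF u i] by blast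
  then have "y \<in> {1..n}" by (simp add: openers_def)
  from index_in_claw[OF this y(3)] obtain l where l: "l < clen u" "claw r M (V u) ! l = y" .
  have "cnt (\<lambda>l h. l \<le> u) + l = i + clen u"
    using opener_position[OF x y(1) V_less l] y(2,3) unfolding cnt_def by simp
  then have "clen u + i + (r - cnt (\<lambda>l h. l \<le> u)) = l + r" using cnt_le[of "\<lambda>l h. l \<le> u"] by simp
  moreover have "l < r" using l(1) clen_le[of u] u by simp
  ultimately have "(clen u + i + (r - cnt (\<lambda>l h. l \<le> u))) mod r = l" by simp
  from leaves_boundary[OF lv V_less l(1) this] show ?thesis using y l(2) by auto
qed

lemma closer_end:
  assumes f: "f \<le> s" and i: "cnt (\<lambda>l h. h < f) \<le> i" "i < cnt (\<lambda>l h. h \<le> f)"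
    and lv: "leaves i x (V f) (i + (r - cnt (\<lambda>l h. h < f)))"
  shows "\<exists>y\<in>closers x. crank x y = i \<and> reaches i y"
proof -
  obtain y where y: "y \<in> closers x" "crank x y = i" "rho x y = f" using closer_of_rank[OF f i] by blast
  then have "y \<in> {1..n}" by (simp add: closers_def)
  from index_in_claw[OF this y(3)] obtain l where l: "l < clen f" "claw r M (V f) ! l = y" .
  have "i = l + cnt (\<lambda>l h. h < f)"
    using closer_position[OF x y(1) V_less l] y(2,3) cnt_closers[of "\<lambda>m. m < f"] by simp
  then have "i + (r - cnt (\<lambda>l h. h < f)) = l + r" using cnt_le[of "\<lambda>l h. h < f"] by simp
  moreover have "l < r" using l(1) clen_le[of f] f by simp
  ultimately have "(i + (r - cnt (\<lambda>l h. h < f))) mod r = l" by simp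
  from leaves_boundary[OF lv V_less l(1) this] show ?thesis using y l(2) by auto
qed

lemma x_opener: "x \<in> openers x" "lo x = 0"
  using opener_self[OF x] x by (auto simp: openers_def)

text \<open>A trip heading for the opener of rank \<open>i\<close> leaves every white vertex \<open>V u\<close> on its way in position
  \<open>clen u + i - cnt (\<lambda>l h. l \<le> u)\<close> modulo \<open>r\<close>, and a trip heading for the closer of rank \<open>i\<close> leaves \<open>V f\<close> in
  position \<open>i - cnt (\<lambda>l h. h < f)\<close>.  Adding \<open>r\<close> keeps the subtractions from being truncated.
  The vertex \<open>V 0 = V s\<close> occurs as \<open>u = 0\<close> for openers and as \<open>F = s\<close> for closers.\<close>

lemma opener_step:
  assumes ude: "u < d" "d < e" "e < s" and con: "consec (V u) (d - u) (e - u)"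
    and first: "\<And>w. u = 0 \<Longrightarrow> w \<in> openers x \<Longrightarrow> hi w = s \<Longrightarrow> e \<le> lo w"
    and beyond: "u = 0 \<Longrightarrow> d < hi x"
    and i: "cnt (\<lambda>l h. l \<le> u) \<le> i" and t: "i = cnt (\<lambda>l h. l < d) + t" "t < arcs_in (seg (V u) (d - u) (e - u))"
    and lv: "leaves i x (V u) (clen u + i + (r - cnt (\<lambda>l h. l \<le> u)))"
  shows "leaves i x (V d) (clen d + i + (r - cnt (\<lambda>l h. l \<le> d)))"
proof -
  have es: "u < s" "d < s" "u < e" using ude by auto
  have cd: "cdist s (V u) (V d) = d - u" "cdist s (V u) (V e) = e - u" "cdist s (V d) (V e) = e - d"
    "cdist s (V d) (V u) = u + s - d" "cdist s (V e) (V u) = u + s - e" "cdist s (V e) (V d) = d + s - e"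
    using V_cdist ude by auto
  have con': "consec (V u) (cdist s (V u) (V d)) (cdist s (V u) (V e))" unfolding cd by (rule con)
  note chords = consec_chords[OF V_less V_less V_less con']
  define A where "A = arcs_in (seg (V u) (d - u) (e - u))"
  define B where "B = arcs_in (seg (V d) (e - d) (u + s - d))"
  define C where "C = arcs_in (seg (V e) (u + s - e) (d + s - e))"
  note parts = triangle_parts[OF ude chords(1) chords(3) chords(2), folded A_def B_def C_def]
  have first_d: "d \<le> lo w" if "u = 0" "w \<in> openers x" "hi w = s" for w using first[OF that] ude by simp
  have fwd: "cnt (\<lambda>l h. l \<le> u) + inner (V u) (d - u) = cnt (\<lambda>l h. l < d)"
    by (rule white_count_forward[OF ude(1) es(2) chords(1) first_d])
  have "clen u + i + (r - cnt (\<lambda>l h. l \<le> u)) = clen u + inner (V u) (d - u) + t + r"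
    using fwd t(1) cnt_le[of "\<lambda>l h. l \<le> u"] by simp
  moreover have "clen u + inner (V u) (d - u) + t < r"
    using consec_bound[OF V_less con] t(2) by simp
  ultimately have k: "(clen u + i + (r - cnt (\<lambda>l h. l \<le> u))) mod r = clen u + inner (V u) (cdist s (V u) (V d)) + t"
    unfolding cd by (intro mod_eqI[of _ 1]) simp_all
  \<comment> \<open>\<open>C\<close> counts arcs under the side from \<open>V u\<close> to
    \<open>V d\<close>, all of which open before \<open>d\<close>. The opener \<open>x\<close> also
    comes before \<open>d\<close>, but its arc is not among them; the strict inequality gives
    \<open>t + C < i\<close>, which sends the trip to \<open>V d\<close> and not to
    \<open>V e\<close>.\<close>
  have CO: "C < cnt (\<lambda>l h. l < d)"
  proof -
    have "{w \<in> openers x. u \<le> lo w \<and> hi w \<le> d \<or> u = 0 \<and> lo w \<le> d \<and> hi w = s} \<subset> {w \<in> openers x. lo w < d}"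
    proof (rule psubsetI)
      show "{w \<in> openers x. u \<le> lo w \<and> hi w \<le> d \<or> u = 0 \<and> lo w \<le> d \<and> hi w = s} \<subseteq> {w \<in> openers x. lo w < d}"
      proof
        fix w assume "w \<in> {w \<in> openers x. u \<le> lo w \<and> hi w \<le> d \<or> u = 0 \<and> lo w \<le> d \<and> hi w = s}"
        then have w: "w \<in> openers x" "u \<le> lo w \<and> hi w \<le> d \<or> u = 0 \<and> lo w \<le> d \<and> hi w = s" by auto
        then show "w \<in> {w \<in> openers x. lo w < d}"
          using opener_arc(1)[OF w(1)] first[OF _ w(1)] ude by auto
      qed
      have "\<not> (u \<le> lo x \<and> hi x \<le> d \<or> u = 0 \<and> lo x \<le> d \<and> hi x = s)"
        using x_opener beyond first[OF _ x_opener(1)] ude by (cases "u = 0") auto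
      then have "x \<notin> {w \<in> openers x. u \<le> lo w \<and> hi w \<le> d \<or> u = 0 \<and> lo w \<le> d \<and> hi w = s}" by simp
      moreover have "x \<in> {w \<in> openers x. lo w < d}" using x_opener ude by simp
      ultimately show "{w \<in> openers x. u \<le> lo w \<and> hi w \<le> d \<or> u = 0 \<and> lo w \<le> d \<and> hi w = s} \<noteq> {w \<in> openers x. lo w < d}"
        by metis
    qed
    then show ?thesis unfolding parts(3) unfolding cnt_def by (intro psubset_card_mono) auto
  qed
  \<comment> \<open>The \<open>A\<close> arcs inside the blocks from \<open>d\<close> to
    \<open>e\<close> open at \<open>d\<close> or later, so together with those opening before
    \<open>d\<close> they number at most \<open>r = A + B + C\<close>.\<close>
  have OB: "cnt (\<lambda>l h. l < d) \<le> C + B"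
  proof -
    have "cnt (\<lambda>l h. l < d \<or> d \<le> l \<and> h \<le> e) = cnt (\<lambda>l h. l < d) + A"
      unfolding parts(1) by (rule cnt_add) auto
    then have "cnt (\<lambda>l h. l < d) + A \<le> r" using cnt_le[of "\<lambda>l h. l < d \<or> d \<le> l \<and> h \<le> e"] by simp
    then show ?thesis using parts(4) by simp
  qed
  have ti: "t < i" "t + C < i" "i \<le> t + C + B" using CO OB t(1) by auto
  have lv': "leaves i x (V d) (clen d + inner (V d) (e - d) + B + C + t)"
    using through_triangle(2)[OF V_less V_less V_less con' lv k _ ti(1) refl refl refl _ , unfolded cd, folded A_def B_def C_def]
      t(2) ti parts(4) unfolding A_def[symmetric] by simp
  have nb: "e - d \<in> nbrs (V d)" using cdist_nbrs[OF chords(3)] unfolding cd .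
  have i1: "inner (V d) (u + s - d) = inner (V d) (e - d) + B"
    using inner_split[OF V_less nb, of "u + s - d"] ude unfolding B_def by simp
  have i2: "inner (V d) (u + s - d) = cnt (\<lambda>l h. (d < l \<or> l \<le> u) \<and> (d < h \<or> h \<le> u))"
    unfolding inner_def
  proof (rule arcs_in_cnt)
    have m: "V m \<in> seg (V d) 1 (u + s - d) \<longleftrightarrow> d < m \<or> m \<le> u" if "m \<le> s" for m
      unfolding V_seg using V_cdist[of d m] that ude by auto
    show "V l \<in> seg (V d) 1 (u + s - d) \<and> V h \<in> seg (V d) 1 (u + s - d) \<longleftrightarrow> (d < l \<or> l \<le> u) \<and> (d < h \<or> h \<le> u)"
      if "l < h" "h \<le> s" for l h using m[of l] m[of h] that by auto
  qed
  \<comment> \<open>The arcs split into those with no end in the blocks \<open>u + 1\<close> to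
    \<open>d\<close>, those counted by \<open>C\<close>, and those opening in block
    \<open>d\<close>. This rewrites the exit position at \<open>V d\<close> in terms of the arcs
    opening up to \<open>d\<close>.\<close>
  let ?P = "\<lambda>l h :: nat. (d < l \<or> l \<le> u) \<and> (d < h \<or> h \<le> u)"
  let ?R = "\<lambda>l h :: nat. u \<le> l \<and> h \<le> d \<or> u = 0 \<and> l \<le> d \<and> h = s"
  have one: "(?P (lo w) (hi w) \<or> ?R (lo w) (hi w)) \<or> lo w = d"
    and two: "\<not> (?P (lo w) (hi w) \<and> ?R (lo w) (hi w))"
    and three: "\<not> ((?P (lo w) (hi w) \<or> ?R (lo w) (hi w)) \<and> lo w = d)" if w: "w \<in> openers x" for w
  proof -
    note o = opener_arc(1-3)[OF w]
    note c1 = arc_cross[OF w chords(1) ude(1) es(2)] and c2 = arc_cross[OF w chords(2) es(3) ude(3)]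
    have h: "u = 0 \<Longrightarrow> hi w = s \<Longrightarrow> e \<le> lo w" using first[OF _ w] by simp
    show "(?P (lo w) (hi w) \<or> ?R (lo w) (hi w)) \<or> lo w = d"
    proof (cases "hi w = s")
      case True
      have "lo w \<le> u \<or> e \<le> lo w" using h c2(2)[OF True] True by linarith
      then show ?thesis using True ude by linarith
    next
      case False
      then have hs: "hi w < s" using o by simp
      consider "lo w < u" | "lo w = u" | "u < lo w" "lo w < d" | "d = lo w" | "d < lo w" by linarith
      then show ?thesis
      proof cases
        case 1
        then show ?thesis using c2(1)[OF hs] ude by linarith
      next
        case 2
        then show ?thesis by linarith
      next
        case 3
        then show ?thesis using c1(1)[OF hs] by linarith
      next
        case 5
        then show ?thesis using o by linarith
      qed simp
    qed
    show "\<not> (?P (lo w) (hi w) \<and> ?R (lo w) (hi w))" using o h ude by linarith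
    show "\<not> ((?P (lo w) (hi w) \<or> ?R (lo w) (hi w)) \<and> lo w = d)" using o h ude by linarith
  qed
  have "cnt (\<lambda>l h. ?P l h \<or> ?R l h) = cnt ?P + cnt ?R" by (rule cnt_add) (use two in auto)
  moreover have "cnt (\<lambda>l h. True) = cnt (\<lambda>l h. ?P l h \<or> ?R l h) + cnt (\<lambda>l h. l = d)"
    by (rule cnt_add) (use one three in auto)
  ultimately have "inner (V d) (u + s - d) + C + cnt (\<lambda>l h. l = d) = r"
    unfolding i2 parts(3) using cnt_True by simp
  moreover have "cnt (\<lambda>l h. l \<le> d) = cnt (\<lambda>l h. l < d) + cnt (\<lambda>l h. l = d)"
    by (rule cnt_add) auto
  ultimately have eqn: "clen d + inner (V d) (e - d) + B + C + t = clen d + i + (r - cnt (\<lambda>l h. l \<le> d))"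
    using i1 t(1) cnt_le[of "\<lambda>l h. l \<le> d"] by simp
  show ?thesis using lv' unfolding eqn .
qed

text \<open>The sought opener lies in the blocks from \<open>u\<close> to \<open>v - 1\<close>. If
  it is not in block \<open>u\<close>, the trip enters a triangle on \<open>u < d < e\<close> with
  \<open>e <= v\<close> and comes out at \<open>V d\<close>, with the opener between
  \<open>d\<close> and \<open>e\<close>; the index of the current vertex has grown.
  \<open>0 < u\<close> keeps the trip away from \<open>V 0\<close> and makes the condition
  \<open>first\<close> vacuous.\<close>

lemma opener_trip:
  assumes "u < v" "v < s" "0 < u" "{V u, V v} \<in> D"
    and "cnt (\<lambda>l h. l < u) \<le> i" "i < cnt (\<lambda>l h. l < v)"
    and "leaves i x (V u) (clen u + i + (r - cnt (\<lambda>l h. l \<le> u)))"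
  shows "\<exists>y\<in>openers x. orank x y = i \<and> reaches i y"
  using assms
proof (induction "s - u" arbitrary: u v rule: less_induct)
  case less
  show ?case
  proof (cases "i < cnt (\<lambda>l h. l \<le> u)")
    case True
    show ?thesis by (rule opener_end[OF _ less.prems(5) True less.prems(7)]) (use less.prems in simp)
  next
    case False
    \<comment> \<open>The index of the next strand among those after the claw: the leaving position
      less \<open>clen u\<close>, reduced modulo \<open>r\<close>.\<close>
    define k where "k = i - cnt (\<lambda>l h. l \<le> u)"
    have fwd: "cnt (\<lambda>l h. l \<le> u) + inner (V u) (v - u) = cnt (\<lambda>l h. l < v)"
      by (rule white_count_forward[OF less.prems(1,2,4)]) (use less.prems in simp)
    have kv: "k < inner (V u) (v - u)" using fwd less.prems(6) False unfolding k_def by simp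
    also have "\<dots> \<le> inner (V u) (s - 1)" by (rule inner_mono) (use less.prems in simp)
    finally obtain p q t where pqt: "consec (V u) p q" "k = inner (V u) p + t" "t < arcs_in (seg (V u) p q)"
      using consec_position[OF V_less] by blast
    have vn: "v - u \<in> nbrs (V u)" using cdist_nbrs[OF less.prems(4)] V_cdist[of u v] less.prems by simp
    have p1: "1 \<le> p" "p < q" using pqt(1) by (auto simp: consec_def nbrs_def)
    have "p < v - u" using inner_mono[of "v - u" p "V u"] kv pqt(2) by (meson le_add1 le_trans not_less)
    then have qv: "q \<le> v - u" using pqt(1) vn unfolding consec_def by (meson not_less)
    define d where "d = u + p"
    define e where "e = u + q"
    have ude: "u < d" "d < e" "e < s" "e \<le> v" "d - u = p" "e - u = q" using p1 qv less.prems unfolding d_def e_def by auto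
    have con': "consec (V u) (cdist s (V u) (V d)) (cdist s (V u) (V e))"
      using V_cdist[of u d] V_cdist[of u e] ude pqt(1) less.prems by simp
    note chords = consec_chords[OF V_less V_less V_less con']
    have fd: "cnt (\<lambda>l h. l \<le> u) + inner (V u) (d - u) = cnt (\<lambda>l h. l < d)"
      by (rule white_count_forward[OF ude(1) _ chords(1)]) (use less.prems ude in simp_all)
    have fe: "cnt (\<lambda>l h. l \<le> u) + inner (V u) (e - u) = cnt (\<lambda>l h. l < e)"
      by (rule white_count_forward[OF _ ude(3) chords(2)]) (use less.prems ude in simp_all)
    have "inner (V u) q = inner (V u) p + arcs_in (seg (V u) p q)"
      by (rule inner_split) (use pqt(1) in \<open>auto simp: consec_def\<close>)
    then have ie: "i < cnt (\<lambda>l h. l < e)" using fe pqt(2,3) False ude(6) unfolding k_def by simp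
    have id: "i = cnt (\<lambda>l h. l < d) + t" using fd pqt(2) False ude(5) unfolding k_def by simp
    have con: "consec (V u) (d - u) (e - u)" using pqt(1) ude(5,6) by simp
    have tt: "t < arcs_in (seg (V u) (d - u) (e - u))" using pqt(3) ude(5,6) by simp
    have i: "cnt (\<lambda>l h. l \<le> u) \<le> i" using False by simp
    have lv: "leaves i x (V d) (clen d + i + (r - cnt (\<lambda>l h. l \<le> d)))"
      by (rule opener_step[OF ude(1-3) con _ _ i id tt less.prems(7)]) (use less.prems(3) in simp_all)
    have less': "s - d < s - u" using ude by simp
    show ?thesis
      by (rule less.hyps[OF less' ude(2,3) _ chords(3) _ ie lv]) (use id ude in simp_all)
  qed
qed

end

section \<open>Trips heading for closers\<close>

context fraser_trip
begin

text \<open>The triangle is now entered at its last corner \<open>V F\<close> and left at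
  \<open>V f\<close>: the count \<open>C\<close> includes all arcs closing up to \<open>e\<close>,
  whence \<open>i <= t + C\<close>. The assumption \<open>pos\<close> gives \<open>t < i\<close>, so
  the turn at the black vertex really leaves the edge by which it was entered.\<close>

lemma closer_step:
  assumes efF: "0 < e" "e < f" "f < F" "F \<le> s" and con: "consec (V F) (e + s - F) (f + s - F)"
    and last: "\<And>w. F = s \<Longrightarrow> w \<in> openers x \<Longrightarrow> lo w = 0 \<Longrightarrow> hi w \<le> e"
    and pos: "0 < cnt (\<lambda>l h. h \<le> e)" and t: "i = cnt (\<lambda>l h. h \<le> e) + t" "t < arcs_in (seg (V F) (e + s - F) (f + s - F))"
    and lv: "leaves i x (V F) (i + (r - cnt (\<lambda>l h. h < F)))"
  shows "leaves i x (V f) (i + (r - cnt (\<lambda>l h. h < f)))" "i < cnt (\<lambda>l h. h \<le> f)" "{V e, V f} \<in> D"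
proof -
  have cd: "cdist s (V F) (V e) = e + s - F" "cdist s (V F) (V f) = f + s - F" "cdist s (V e) (V f) = f - e"
    "cdist s (V e) (V F) = F - e" "cdist s (V f) (V F) = F - f" "cdist s (V f) (V e) = e + s - f"
    using cdist_back[of e F] cdist_back[of f F] V_cdist[of e f] V_cdist[of f e] efF by auto
  have con': "consec (V F) (cdist s (V F) (V e)) (cdist s (V F) (V f))" unfolding cd by (rule con)
  note chords = consec_chords[OF V_less V_less V_less con']
  show "{V e, V f} \<in> D" by (rule chords(3))
  have eF: "{V e, V F} \<in> D" and fF: "{V f, V F} \<in> D" using chords by (simp_all add: insert_commute)
  have e_lt: "e < F" using efF by simp
  define A where "A = arcs_in (seg (V F) (e + s - F) (f + s - F))"
  define B where "B = arcs_in (seg (V e) (f - e) (F - e))"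
  define C where "C = arcs_in (seg (V f) (F - f) (e + s - f))"
  \<comment> \<open>\<open>triangle_parts\<close> expects indices below \<open>s\<close>. For
    \<open>F = s\<close> the corner \<open>V F\<close> is taken as \<open>V 0\<close>, which makes
    it the first corner instead of the last.\<close>
  have ABC: "A = cnt (\<lambda>l h. e \<le> l \<and> h \<le> f) \<and> cnt (\<lambda>l h. h \<le> e) \<le> C \<and> A + B + C = r"
  proof (cases "F = s")
    case True
    have ch: "{V 0, V e} \<in> D" "{V 0, V f} \<in> D" using chords True V_s by auto
    note parts = triangle_parts[OF efF(1,2) _ ch(1) chords(3) ch(2)]
    have "f < s" using efF True by simp
    note p = parts[OF this]
    have "A = arcs_in (seg (V 0) (e - 0) (f - 0))" "B = arcs_in (seg (V e) (f - e) (0 + s - e))"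
      "C = arcs_in (seg (V f) (0 + s - f) (e + s - f))"
      unfolding A_def B_def C_def True V_s by simp_all
    then show ?thesis using p(1,3,4) by (auto intro: cnt_mono)
  next
    case False
    then have Fs: "F < s" using efF by simp
    note p = triangle_parts[OF efF(2,3) Fs chords(3) fF eF]
    have m: "cnt (\<lambda>l h. h \<le> e) \<le> cnt (\<lambda>l h. (F \<le> l \<or> l \<le> e) \<and> (F \<le> h \<or> h \<le> e))"
      using opener_arc(1) by (intro cnt_mono) fastforce
    have "A = cnt (\<lambda>l h. e \<le> l \<and> h \<le> f)"
      unfolding A_def p(3) using efF by simp
    then show ?thesis using p m unfolding A_def B_def C_def by simp
  qed
  have cb: "clen F + inner (V F) (e + s - F) + cnt (\<lambda>l h. h < F) = r + cnt (\<lambda>l h. h \<le> e)"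
    by (rule white_count_back[OF efF(1) e_lt efF(4) eF last])
  have "i + (r - cnt (\<lambda>l h. h < F)) = clen F + inner (V F) (e + s - F) + t"
    using cb t(1) cnt_le[of "\<lambda>l h. h < F"] by simp
  moreover have "clen F + inner (V F) (e + s - F) + t < r"
    using consec_bound[OF V_less con] t(2) by simp
  ultimately have k: "(i + (r - cnt (\<lambda>l h. h < F))) mod r = clen F + inner (V F) (cdist s (V F) (V e)) + t"
    unfolding cd by simp
  have ti: "t < i" "i \<le> t + C" using pos t(1) ABC by auto
  have lv': "leaves i x (V f) (clen f + inner (V f) (F - f) + C + t)"
    using through_triangle(1)[OF V_less V_less V_less con' lv k _ ti(1) refl refl refl _ , unfolded cd, folded A_def B_def C_def]
      t(2) ti ABC unfolding A_def[symmetric] by simp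
  have nb: "F - f \<in> nbrs (V f)" using cdist_nbrs[OF fF] unfolding cd .
  have i1: "inner (V f) (e + s - f) = inner (V f) (F - f) + C"
    using inner_split[OF V_less nb, of "e + s - f"] efF unfolding C_def by simp
  have fs: "f < s" using efF by simp
  have cb2: "clen f + inner (V f) (e + s - f) + cnt (\<lambda>l h. h < f) = r + cnt (\<lambda>l h. h \<le> e)"
    by (rule white_count_back[OF efF(1,2) _ chords(3)]) (use fs in simp_all)
  have eqn: "clen f + inner (V f) (F - f) + C + t = i + (r - cnt (\<lambda>l h. h < f))"
    using i1 cb2 t(1) cnt_le[of "\<lambda>l h. h < f"] by simp
  show "leaves i x (V f) (i + (r - cnt (\<lambda>l h. h < f)))" using lv' unfolding eqn .
  have "cnt (\<lambda>l h. h \<le> f) = cnt (\<lambda>l h. h \<le> e) + cnt (\<lambda>l h. e \<le> l \<and> h \<le> f)"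
  proof (rule cnt_add)
    fix w assume w: "w \<in> openers x"
    note cs = closer_split[OF efF(1) e_lt efF(4) eF last w]
    show "hi w \<le> f \<longleftrightarrow> hi w \<le> e \<or> e \<le> lo w \<and> hi w \<le> f" using cs efF by linarith
    show "\<not> (hi w \<le> e \<and> e \<le> lo w \<and> hi w \<le> f)" using opener_arc(1)[OF w] by linarith
  qed
  then show "i < cnt (\<lambda>l h. h \<le> f)" using t ABC unfolding A_def by simp
qed

text \<open>The sought closer lies in the blocks from \<open>e + 1\<close> to \<open>F\<close>, and
  each triangle replaces \<open>F\<close> by a smaller index \<open>f'\<close>. As
  \<open>F < s\<close>, the condition \<open>last\<close> of \<open>closer_step\<close> is
  vacuous.\<close>

lemma closer_trip:
  assumes "0 < e" "e < F" "F < s" "{V e, V F} \<in> D"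
    and "0 < cnt (\<lambda>l h. h \<le> e)" "cnt (\<lambda>l h. h \<le> e) \<le> i" "i < cnt (\<lambda>l h. h \<le> F)"
    and "leaves i x (V F) (i + (r - cnt (\<lambda>l h. h < F)))"
  shows "\<exists>y\<in>closers x. crank x y = i \<and> reaches i y"
  using assms
proof (induction F arbitrary: e rule: less_induct)
  case (less F)
  have Fs: "F \<le> s" using less.prems by simp
  show ?case
  proof (cases "cnt (\<lambda>l h. h < F) \<le> i")
    case True
    show ?thesis by (rule closer_end[OF Fs True less.prems(7,8)])
  next
    case False
    have cb: "clen F + inner (V F) (e + s - F) + cnt (\<lambda>l h. h < F) = r + cnt (\<lambda>l h. h \<le> e)"
      by (rule white_count_back[OF less.prems(1,2) Fs less.prems(4)]) (use less.prems in simp)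
    define k where "k = i + (r - cnt (\<lambda>l h. h < F)) - clen F"
    have kF: "clen F + k = i + (r - cnt (\<lambda>l h. h < F))"
      using cb less.prems(6) cnt_le[of "\<lambda>l h. h < F"] unfolding k_def by simp
    have k1: "inner (V F) (e + s - F) \<le> k" using kF cb less.prems(6) cnt_le[of "\<lambda>l h. h < F"] by simp
    have "k < inner (V F) (s - 1)"
      using kF False inner_last[OF V_less, of F] cnt_le[of "\<lambda>l h. h < F"] by simp
    then obtain p q t where pqt: "consec (V F) p q" "k = inner (V F) p + t" "t < arcs_in (seg (V F) p q)"
      using consec_position[OF V_less] by blast
    have pq: "p \<in> nbrs (V F)" "p < q" "q < s" using pqt(1) by (auto simp: consec_def nbrs_def)
    have "{V F, V e} \<in> D" using less.prems(4) by (simp add: insert_commute)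
    from cdist_nbrs[OF this] have nb: "e + s - F \<in> nbrs (V F)" using cdist_back[OF less.prems(1,2) Fs] by simp
    have kq: "k < inner (V F) q" using inner_split[OF V_less pq(1), of q] pq(2) pqt(2,3) by simp
    have "\<not> q \<le> e + s - F" using inner_mono[of q "e + s - F" "V F"] kq k1 by linarith
    then have pe: "e + s - F \<le> p" using pqt(1) nb unfolding consec_def by (meson not_less)
    \<comment> \<open>Translates the distance \<open>p\<close> from \<open>V F\<close> back into an
      index; the clockwise way from \<open>V F\<close> to \<open>V e'\<close> passes
      \<open>V 0\<close>, hence the subtraction of \<open>s\<close>.\<close>
    define e' where "e' = p + F - s"
    define f' where "f' = q + F - s"
    have ef: "e \<le> e'" "0 < e'" "e' < f'" "f' < F" "e' < F" "e' + s - F = p" "f' + s - F = q"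
      using pe pq less.prems unfolding e'_def f'_def by auto
    have con: "consec (V F) (e' + s - F) (f' + s - F)" using pqt(1) unfolding ef .
    have "{V F, V e'} \<in> D"
    proof -
      have "{V F, (V F + p) mod s} \<in> D" using pq(1) by (simp add: nbrs_def)
      moreover have "(V F + p) mod s = V e'"
      proof -
        have "F + p = e' + s" using pe less.prems unfolding e'_def by simp
        then show ?thesis unfolding V_add unfolding V_def by (simp add: add.assoc[symmetric])
      qed
      ultimately show ?thesis by simp
    qed
    then have ch: "{V e', V F} \<in> D" by (simp add: insert_commute)
    have cb': "clen F + inner (V F) (e' + s - F) + cnt (\<lambda>l h. h < F) = r + cnt (\<lambda>l h. h \<le> e')"
      by (rule white_count_back[OF ef(2,5) Fs ch]) (use less.prems in simp)
    have it: "i = cnt (\<lambda>l h. h \<le> e') + t"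
      using cb' kF pqt(2) cnt_le[of "\<lambda>l h. h < F"] unfolding ef by simp
    have pos: "0 < cnt (\<lambda>l h. h \<le> e')"
      using less.prems(5) cnt_mono[of "\<lambda>l h. h \<le> e" "\<lambda>l h. h \<le> e'"] ef(1) by fastforce
    have tt: "t < arcs_in (seg (V F) (e' + s - F) (f' + s - F))" using pqt(3) unfolding ef .
    have noF: "\<And>w. F = s \<Longrightarrow> w \<in> openers x \<Longrightarrow> lo w = 0 \<Longrightarrow> hi w \<le> e'" using less.prems(3) by simp
    note st = closer_step[OF ef(2-4) Fs con noF pos it tt less.prems(8)]
    have fs: "f' < s" using ef less.prems by simp
    have id: "cnt (\<lambda>l h. h \<le> e') \<le> i" using it by linarith
    show ?thesis by (rule less.IH[OF ef(4) ef(2,3) fs st(3) pos id st(2,1)])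
  qed
qed

section \<open>The start of a trip and the choice of its goal\<close>

lemma leaves_add: "leaves i j v (k + r) \<longleftrightarrow> leaves i j v k"
  unfolding leaves_def by simp

text \<open>If \<open>y\<close> did not precede \<open>partner x\<close>, every opener in a block
  below \<open>b\<close> would precede \<open>y\<close>, since such blocks come before that of
  \<open>partner x\<close>; there are more of them than the rank of \<open>y\<close> allows.\<close>

lemma opener_before:
  assumes y: "y \<in> openers x" and i: "orank x y < cnt (\<lambda>l h. l < b)" and b: "b \<le> hi x"
  shows "dist x y < dist x (partner x)"
proof (rule ccontr)
  assume a: "\<not> dist x y < dist x (partner x)"
  have "dist x v < dist x y" if "rho x v < b" for v using rho_less_dist[of x v "partner x"] that a b by simp
  then have "{v \<in> openers x. rho x v < b} \<subseteq> {v \<in> openers x. dist x v < dist x y}" by auto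
  then have "cnt (\<lambda>l h. l < b) \<le> orank x y" unfolding cnt_def orank_def by (intro card_mono) auto
  then show False using i by simp
qed

lemma closer_after:
  assumes y: "y \<in> closers x" and i: "cnt (\<lambda>l h. h \<le> b) \<le> crank x y" and b: "hi x \<le> b"
  shows "dist x (partner x) < dist x y"
proof (rule ccontr)
  assume a: "\<not> dist x (partner x) < dist x y"
  have z: "partner x \<in> closers x" by (rule partner_closer[OF x])
  have "rho x v \<le> b" if "dist x v < dist x y" for v using rho_mono[of x v "partner x"] that a b by simp
  then have "{v \<in> closers x. dist x v < dist x y} \<subseteq> {v \<in> closers x. rho x v \<le> b}" by auto
  moreover have "partner x \<in> {v \<in> closers x. rho x v \<le> b}" "partner x \<notin> {v \<in> closers x. dist x v < dist x y}"
    using z b a by auto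
  ultimately have "{v \<in> closers x. dist x v < dist x y} \<subset> {v \<in> closers x. rho x v \<le> b}" by blast
  then have "crank x y < card {v \<in> closers x. rho x v \<le> b}" unfolding crank_def by (intro psubset_card_mono) auto
  then show False using i cnt_closers[of "\<lambda>m. m \<le> b"] by simp
qed

lemma boundary_strands:
  assumes k: "k \<in> {1..n}"
  shows "set (strands_at G (Boundary k)) = {((White (claw_of k), Boundary k), 0)}"
proof -
  have m: "fmult r M D (White j, Boundary k) = (if claw_of k = j then 1 else 0)" if "j < s" for j
    using claw_mem[OF that] k by simp
  have e: "(White j, Boundary k) \<in> fedges r M D \<longleftrightarrow> claw_of k = j" if "j < s" for j
    using m[OF that] k that by (auto simp: fedges_def fverts_def)
  have "set (rot G (Boundary k)) = {(White (claw_of k), Boundary k)}"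
    using e claw_of_less[of k] by (auto simp: fraser_graph_def)
  moreover have "mult G (White (claw_of k), Boundary k) = 1"
    using m[OF claw_of_less] by (simp add: fraser_graph_def)
  ultimately show ?thesis unfolding strands_at_def by auto
qed

text \<open>\<open>x\<close> is the opener of rank 0, and the points listed before it in its claw
  form block \<open>s\<close>, all of them closers. The two equations make the first exit position
  \<open>l + i\<close> fit the invariant for openers at \<open>V 0\<close> and the one for closers
  at \<open>V s\<close>.\<close>

lemma start_position:
  obtains l where "l < clen 0" "claw r M (V 0) ! l = x" "cnt (\<lambda>l h. l \<le> 0) + l = clen 0"
    "l + cnt (\<lambda>l h. h < s) = r"
proof -
  obtain l where l: "l < clen 0" "claw r M (V 0) ! l = x" using index_in_claw[OF x x_opener(2)] by blast
  have "orank x x = 0" by (simp add: orank_def)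
  then have 1: "cnt (\<lambda>l h. l \<le> 0) + l = clen 0"
    using opener_position[OF x x_opener(1) V_less l] unfolding cnt_def by simp
  have "{v \<in> set (claw r M (V 0)). earlier x v x} = {v \<in> closers x. rho x v = s}"
  proof -
    have "v \<in> set (claw r M (V 0)) \<and> earlier x v x \<longleftrightarrow> v \<in> closers x \<and> rho x v = s" for v
    proof (cases "v \<in> {1..n}")
      case True
      have "\<not> opener x v" if "rho x v = s" using rho_opener[OF x True] rho_le[of x "partner v"] that by auto
      then show ?thesis
        using claw_mem[OF V_less] claw_V[OF True] V_s True s_pos unfolding earlier_def closers_def by auto
    qed (use claw_mem[OF V_less] in \<open>auto simp: closers_def\<close>)
    then show ?thesis by auto
  qed
  then have "l = cnt (\<lambda>l h. h = s)"
    using claw_nth_earlier(1)[OF V_less l(1) x] l(2) cnt_closers[of "\<lambda>m. m = s"] by simp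
  moreover have "cnt (\<lambda>l h. True) = cnt (\<lambda>l h. h = s) + cnt (\<lambda>l h. h < s)"
    by (rule cnt_add) (use opener_arc(2) in \<open>auto simp: le_less\<close>)
  ultimately show thesis using that[OF l 1] cnt_True by simp
qed

lemma start_leaves:
  assumes "l < clen 0" "claw r M (V 0) ! l = x"
  shows "leaves i x (V 0) (l + i)"
proof -
  have c: "claw_of x = V 0" using claw_V[OF x] x_opener(2) by simp
  have "((White (V 0), Boundary x), 0) \<in> set (strands_at G (bdry G x))"
    using boundary_strands[OF x] c by (simp add: G_simps)
  from trip_walk.start[OF this] have "trip_walk G i x ((White (V 0), Boundary x), 0) (White (V 0))"
    by (simp add: G_simps)
  moreover have "strands_at G (White (V 0)) ! l = ((White (V 0), Boundary x), 0)"
    using white_nth_claw[OF V_less assms(1)] assms(2) by simp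
  moreover have "l < r" using assms(1) clen_le[of 0] by simp
  ultimately show ?thesis by (intro leavesI[OF V_less]) simp_all
qed

text \<open>Two cases need no triangle: the goal is an opener of block 0 or a closer of block
  \<open>s\<close>, both in the claw of \<open>x\<close>. In the remaining case the arc of
  \<open>x\<close> ends at most at \<open>d\<close> or at least at \<open>e\<close>, where
  \<open>V d\<close> and \<open>V e\<close> are the other corners of the first triangle.\<close>

lemma trip_exists:
  assumes i: "1 \<le> i" "i < r"
  shows "\<exists>y\<in>{1..n}. reaches i y \<and> (opener x y \<and> orank x y = i \<and> dist x y < dist x (partner x) \<or>
      \<not> opener x y \<and> crank x y = i \<and> dist x (partner x) < dist x y)"
proof -
  have openI: ?thesis if "\<exists>y\<in>openers x. orank x y = i \<and> reaches i y" "i < cnt (\<lambda>l h. l < b)" "b \<le> hi x" for b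
    using that opener_before[of _ b] unfolding openers_def by blast
  have closeI: ?thesis if "\<exists>y\<in>closers x. crank x y = i \<and> reaches i y" "cnt (\<lambda>l h. h \<le> b) \<le> i" "hi x \<le> b" for b
    using that closer_after[of _ b] unfolding closers_def by blast
  obtain l where l: "l < clen 0" "claw r M (V 0) ! l = x" "cnt (\<lambda>l h. l \<le> 0) + l = clen 0"
    "l + cnt (\<lambda>l h. h < s) = r" by (rule start_position)
  note lv = start_leaves[OF l(1,2), of i]
  note ox = opener_arc(1-3)[OF x_opener(1)]
  have hx: "0 < hi x" "hi x < s" using ox x_opener(2) by auto
  have eqo: "clen 0 + i + (r - cnt (\<lambda>l h. l \<le> 0)) = (l + i) + r"
    using l(3) cnt_le[of "\<lambda>l h. l \<le> 0"] by linarith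
  have lvo: "leaves i x (V 0) (clen 0 + i + (r - cnt (\<lambda>l h. l \<le> 0)))"
    unfolding eqo leaves_add by (rule lv)
  have eqc: "i + (r - cnt (\<lambda>l h. h < s)) = l + i" using l(4) by linarith
  have lvc: "leaves i x (V s) (i + (r - cnt (\<lambda>l h. h < s)))" unfolding eqc V_s by (rule lv)
  consider "i < cnt (\<lambda>l h. l \<le> 0)" | "cnt (\<lambda>l h. h < s) \<le> i" | "cnt (\<lambda>l h. l \<le> 0) \<le> i" "i < cnt (\<lambda>l h. h < s)"
    by linarith
  then show ?thesis
  proof cases
    case 1
    have ex: "\<exists>y\<in>openers x. orank x y = i \<and> reaches i y"
      by (rule opener_end[OF s_pos _ 1 lvo]) (simp add: cnt_def)
    have lt: "i < cnt (\<lambda>l h. l < 1)" using 1 by (simp add: less_Suc_eq_le)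
    show ?thesis by (rule openI[OF ex lt]) (use hx in simp)
  next
    case 2
    have "cnt (\<lambda>l h. h \<le> s) = cnt (\<lambda>l h. True)" unfolding cnt_def using rho_le by simp
    then have "i < cnt (\<lambda>l h. h \<le> s)" using i cnt_True by simp
    from closer_end[OF _ 2 this lvc] have y: "\<exists>y\<in>closers x. crank x y = i \<and> reaches i y" by simp
    have "cnt (\<lambda>l h. h \<le> s - 1) \<le> cnt (\<lambda>l h. h < s)" by (rule cnt_mono) (use s_pos in simp)
    then have le: "cnt (\<lambda>l h. h \<le> s - 1) \<le> i" using 2 by linarith
    show ?thesis by (rule closeI[OF y le]) (use hx in simp)
  next
    case 3
    define k where "k = i - cnt (\<lambda>l h. l \<le> 0)"
    have "k < inner (V 0) (s - 1)" using inner_last[OF V_less, of 0] l(3,4) 3 unfolding k_def by simp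
    then obtain d e t where det: "consec (V 0) d e" "k = inner (V 0) d + t" "t < arcs_in (seg (V 0) d e)"
      using consec_position[OF V_less] by blast
    have de: "0 < d" "d < e" "e < s" "d < s" using det(1) by (auto simp: consec_def nbrs_def)
    have con': "consec (V 0) (cdist s (V 0) (V d)) (cdist s (V 0) (V e))"
      using V_cdist[of 0 d] V_cdist[of 0 e] de det(1) by simp
    note chords = consec_chords[OF V_less V_less V_less con']
    have split: "inner (V 0) e = inner (V 0) d + arcs_in (seg (V 0) d e)"
      by (rule inner_split) (use det(1) in \<open>auto simp: consec_def\<close>)
    \<comment> \<open>Arcs opening under the arc of \<open>x\<close> also close under it; this
      supplies the conditions \<open>first\<close> and \<open>last\<close> on arcs touching the claw
      of \<open>x\<close>.\<close>
    have nest: "dist x (partner w) < dist x (partner x)" if w: "w \<in> openers x" "w \<noteq> x" "dist x w < dist x (partner x)" for w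
    proof -
      have "dist x x < dist x w" using w(2) opener_arc(4)[OF w(1)] cdist_inj[OF x x, of w] by fastforce
      then show ?thesis using noncross[OF x x opener_arc(4)[OF w(1)]] w(3) by simp
    qed
    have "hi x \<le> d \<or> e \<le> hi x"
      using arc_cross(1)[OF x_opener(1) chords(3) de(2,3) hx(2)] x_opener(2) de by linarith
    then show ?thesis
    proof
      assume he: "e \<le> hi x"
      have first: "e \<le> lo w" if w: "w \<in> openers x" "hi w = s" for w
      proof (rule ccontr)
        assume a: "\<not> e \<le> lo w"
        then have "dist x w < dist x (partner x)" using rho_less_dist[of x w "partner x"] he by simp
        moreover have "w \<noteq> x" using w(2) hx by auto
        ultimately have "hi w \<le> hi x" using nest[OF w(1)] rho_mono[of x "partner w" "partner x"] by simp
        then show False using w(2) hx by simp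
      qed
      have fd: "cnt (\<lambda>l h. l \<le> 0) + inner (V 0) (d - 0) = cnt (\<lambda>l h. l < d)"
        by (rule white_count_forward[OF de(1,4) chords(1)]) (use first de in fastforce)
      have fe: "cnt (\<lambda>l h. l \<le> 0) + inner (V 0) (e - 0) = cnt (\<lambda>l h. l < e)"
        by (rule white_count_forward[OF _ de(3) chords(2)]) (use first de in auto)
      have it: "i = cnt (\<lambda>l h. l < d) + t" using fd det(2) 3 unfolding k_def by simp
      have ie: "i < cnt (\<lambda>l h. l < e)" using fe split det(2,3) 3 unfolding k_def by simp
      have con: "consec (V 0) (d - 0) (e - 0)" using det(1) by simp
      have tt: "t < arcs_in (seg (V 0) (d - 0) (e - 0))" using det(3) by simp
      have "leaves i x (V d) (clen d + i + (r - cnt (\<lambda>l h. l \<le> d)))"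
        by (rule opener_step[OF de(1-3) con _ _ 3(1) it tt lvo]) (use first he de in auto)
      moreover have "cnt (\<lambda>l h. l < d) \<le> i" using it by linarith
      ultimately have "\<exists>y\<in>openers x. orank x y = i \<and> reaches i y"
        using opener_trip[OF de(2,3,1) chords(3) _ ie] by blast
      then show ?thesis by (rule openI[OF _ ie he])
    next
      assume hd: "hi x \<le> d"
      have last: "hi w \<le> d" if w: "w \<in> openers x" "lo w = 0" for w
      proof (cases "w = x")
        case False
        have "dist x w < dist x (partner x)" using rho_less_dist[of x w "partner x"] w(2) hx by simp
        then show ?thesis using nest[OF w(1) False] rho_mono[of x "partner w" "partner x"] hd by simp
      qed (use hd in simp)
      have ch: "{V d, V s} \<in> D" using chords(1) V_s by (simp add: insert_commute)
      have cb: "clen s + inner (V s) (d + s - s) + cnt (\<lambda>l h. h < s) = r + cnt (\<lambda>l h. h \<le> d)"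
        by (rule white_count_back[OF de(1,4) _ ch]) (use last in auto)
      have it: "i = cnt (\<lambda>l h. h \<le> d) + t"
        using cb det(2) 3 l(3,4) V_s unfolding k_def by simp
      have pos: "0 < cnt (\<lambda>l h. h \<le> d)"
        unfolding cnt_def using x_opener(1) hd by (subst card_gt_0_iff) auto
      have con: "consec (V s) (d + s - s) (e + s - s)" using det(1) V_s by simp
      have tt: "t < arcs_in (seg (V s) (d + s - s) (e + s - s))" using det(3) V_s by simp
      have ls: "\<And>w. s = s \<Longrightarrow> w \<in> openers x \<Longrightarrow> lo w = 0 \<Longrightarrow> hi w \<le> d" using last by simp
      note st = closer_step[OF de(1-3) le_refl con ls pos it tt lvc]
      have id: "cnt (\<lambda>l h. h \<le> d) \<le> i" using it by linarith
      have "\<exists>y\<in>closers x. crank x y = i \<and> reaches i y"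
        by (rule closer_trip[OF de(1-3) st(3) pos id st(2,1)])
      then show ?thesis by (rule closeI[OF _ id hd])
    qed
  qed
qed

end

section \<open>Uniqueness of the end of a trip\<close>

lemma distinct_concat_map_Pair:
  "distinct xs \<Longrightarrow> (\<And>x. distinct (g x)) \<Longrightarrow> distinct (concat (map (\<lambda>x. map (Pair x) (g x)) xs))"
  by (induction xs) (auto simp: distinct_map inj_on_def)

context fraser
begin

text \<open>The distances of its corners from \<open>j\<close> form the set
  \<open>{0, p, q}\<close>, which determines \<open>p < q\<close>; so no triangle is listed
  twice.\<close>

lemma distinct_triangles_at:
  assumes j: "j < s" shows "distinct (triangles_at s D j)"
proof -
  let ?f = "\<lambda>(p, q). {j, (j + p) mod s, (j + q) mod s}"
  let ?ps = "concat (map (\<lambda>p. map (Pair p) [p + 1..<s]) [1..<s])"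
  have "inj_on ?f (set ?ps)"
  proof (rule inj_onI)
    fix a b assume "a \<in> set ?ps" "b \<in> set ?ps" and eq: "?f a = ?f b"
    then obtain p q p' q' where ab: "a = (p, q)" "b = (p', q')"
      and o: "1 \<le> p" "p < q" "q < s" "1 \<le> p'" "p' < q'" "q' < s" by auto
    have img: "cdist s j ` ?f (u, v) = {0, u, v}" if "u < s" "v < s" for u v
      using cdist_add[OF j] that by simp
    have "p < s" "p' < s" using o by auto
    then have "{0, p, q} = {0, p', q'}"
      using img[of p q] img[of p' q'] arg_cong[OF eq, of "image (cdist s j)"] o unfolding ab by simp
    then have "p \<in> {0, p', q'}" "q \<in> {0, p', q'}" "p' \<in> {0, p, q}" by blast+
    then show "a = b" using o ab by auto
  qed
  moreover have "distinct ?ps" by (rule distinct_concat_map_Pair) auto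
  ultimately have "distinct (map ?f ?ps)" by (simp add: distinct_map)
  moreover have "map ?f ?ps = concat (map (\<lambda>p. map (\<lambda>q. {j, (j + p) mod s, (j + q) mod s}) [p + 1..<s]) [1..<s])"
    by (simp add: map_concat comp_def)
  ultimately show ?thesis unfolding triangles_at_def by simp
qed

text \<open>A walk finds its place in the rotation through the strand itself, so a repeated strand
  would make the turn ambiguous.\<close>

lemma distinct_strands: "distinct (strands_at G v)"
proof -
  have "distinct (frot r M D v)"
  proof (cases v)
    case (Boundary k)
    then show ?thesis by (simp add: distinct_map inj_on_def)
  next
    case (Black \<Delta>)
    then show ?thesis by (simp add: distinct_map inj_on_def)
  next
    case (White j)
    show ?thesis
    proof (cases "j < s")
      case True
      then show ?thesis using White distinct_claw[OF True] distinct_triangles_at[OF True]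
        by (auto simp: distinct_map inj_on_def intro!: distinct_filter)
    next
      case False
      then have "\<And>y. (White j, y) \<notin> fedges r M D" by (auto simp: fedges_def fverts_def)
      then show ?thesis using White by (simp add: filter_empty_conv)
    qed
  qed
  then have "distinct (concat (map (\<lambda>e. map (Pair e) [0..<fmult r M D e]) (frot r M D v)))"
    by (intro distinct_concat_map_Pair) simp_all
  then show ?thesis by (simp add: strands_at_def fraser_graph_def)
qed

text \<open>The rule \<open>turn\<close> as a relation between states, a state being a strand with
  the vertex it leads to. Walks become reachability, to which confluence of single-valued relations
  applies.\<close>

definition trip_step :: "nat \<Rightarrow> (((fedge \<times> nat) \<times> fvertex) \<times> ((fedge \<times> nat) \<times> fvertex)) set" where
  "trip_step i = {((s', v), (s'', v')). v \<notin> Boundary ` {1..n} \<and>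
     (\<exists>p < length (strands_at G v). strands_at G v ! p = s' \<and>
        s'' = strands_at G v ! nat ((if white G v then int p + int i else int p - int i) mod int (length (strands_at G v)))) \<and>
     v' = other_end G (fst s'') v}"

lemma single_valued_trip_step: "single_valued (trip_step i)"
proof (rule single_valuedI)
  fix a b c assume ab: "(a, b) \<in> trip_step i" and ac: "(a, c) \<in> trip_step i"
  obtain s' v where a: "a = (s', v)" by (cases a)
  let ?L = "strands_at G v"
  let ?t = "\<lambda>p. ?L ! nat ((if white G v then int p + int i else int p - int i) mod int (length ?L))"
  obtain p where p: "p < length ?L" "?L ! p = s'" "b = (?t p, other_end G (fst (?t p)) v)"
    using ab unfolding trip_step_def a by blast
  obtain q where q: "q < length ?L" "?L ! q = s'" "c = (?t q, other_end G (fst (?t q)) v)"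
    using ac unfolding trip_step_def a by blast
  have "p = q" using nth_eq_iff_index_eq[OF distinct_strands p(1) q(1)] p(2) q(2) by simp
  then show "b = c" using p(3) q(3) by simp
qed

lemma trip_walk_steps:
  assumes "trip_walk G i j s' v" "set (strands_at G (Boundary j)) = {s0}"
  shows "((s0, other_end G (fst s0) (Boundary j)), (s', v)) \<in> (trip_step i)\<^sup>*"
  using assms(1)
proof induction
  case (start s')
  then show ?case using assms(2) by (simp add: G_simps)
next
  case (turn s' v L p s'')
  have "((s', v), (s'', other_end G (fst s'') v)) \<in> trip_step i"
    using turn.hyps(2-6) unfolding trip_step_def G_simps by blast
  with turn.IH show ?case by (rule rtrancl_into_rtrancl)
qed

text \<open>From the only strand at the starting point the reachable states form a single chain, and
  a state at a boundary vertex has no successor (\<open>stop\<close>), so two such states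
  coincide.\<close>

lemma trip_end_unique:
  assumes "trip_walk G i j s1 (Boundary k)" "trip_walk G i j s2 (Boundary l)"
    and "k \<in> {1..n}" "l \<in> {1..n}" "set (strands_at G (Boundary j)) = {s0}"
  shows "k = l"
proof -
  have stop: "b = (s', Boundary m)" if "((s', Boundary m), b) \<in> (trip_step i)\<^sup>*" "m \<in> {1..n}" for s' m b
    using that(1)
  proof (cases rule: converse_rtranclE)
    case (step y)
    then show ?thesis using that(2) unfolding trip_step_def by auto
  qed auto
  from single_valued_confluent[OF single_valued_trip_step trip_walk_steps[OF assms(1,5)] trip_walk_steps[OF assms(2,5)]]
  show ?thesis using stop[OF _ assms(3)] stop[OF _ assms(4)] by blast
qed

end

theorem theorem3p1:
  fixes r :: nat and T :: filling and G :: "(fvertex, fedge) hourglass_graph"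
  assumes "T \<in> SYT r 2"
    and "G \<in> fraser_graphs r T"
  shows "\<forall>i. 1 \<le> i \<and> i \<le> r - 1 \<longrightarrow> (\<forall>j\<in>{1..2 * r}. trip G i j = prom r 2 i T j)"
proof (intro allI impI ballI)
  fix i j assume i: "1 \<le> i \<and> i \<le> r - 1" and j: "j \<in> {1..2 * r}"
  from i have ir: "1 \<le> i" "i < r" "1 \<le> r" by auto
  obtain M D where G: "G = fraser_graph r M D" and M: "is_matching_of r T M"
    and D: "weighted_triangulation r M D"
    using assms(2) unfolding fraser_graphs_def by blast
  interpret fraser_trip r M D j
    using M D ir(3) j by unfold_locales (auto simp: is_matching_of_def)
  obtain y s' where y: "y \<in> {1..2 * r}" "trip_walk (fraser_graph r M D) i j s' (Boundary y)"
    and spec: "opener j y \<and> orank j y = i \<and> cdist (2 * r) j y < cdist (2 * r) j (partner j) \<or>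
      \<not> opener j y \<and> crank j y = i \<and> cdist (2 * r) j (partner j) < cdist (2 * r) j y"
    using trip_exists[OF ir(1,2)] by blast
  have "prom r 2 i T j = y"
    by (rule prom_eqI[OF refl j tableau_from_SYT[OF assms(1) M ir(3)] ir(1,2) y(1) spec])
  moreover have "trip G i j = y"
    unfolding trip_def G G_simps
  proof (rule the_equality)
    show "y \<in> {1..2 * r} \<and> (\<exists>s. trip_walk (fraser_graph r M D) i j s (Boundary y))" using y by blast
    fix k assume "k \<in> {1..2 * r} \<and> (\<exists>s. trip_walk (fraser_graph r M D) i j s (Boundary k))"
    then show "k = y" using trip_end_unique[OF _ y(2) _ y(1) boundary_strands[OF j]] by blast
  qed
  ultimately show "trip G i j = prom r 2 i T j" by simp
qed

end
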